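(* Let $\mathcal C$ be an additive monoidal category that has equalizers and coequalizers which are preserved by all functors of the form $-\otimes X$ and $X\otimes-$. Let $(H,K,\Diamond)$ be a Takeuchi pair in $\mathcal C$. Then the diagram of functors between categories of left (Lie) (co)modules $$\begin{array}{ccc}\mathsf{CoMod}(K)&\xrightarrow{\;F\;}&\mathsf{Mod}(H)\\ {\scriptstyle G'}\downarrow&&\downarrow{\scriptstyle G}\\ \mathsf{LieCoMod}(Q(K))&\xrightarrow{\;F'\;}&\mathsf{LieMod}(P(H))\end{array}$$ commutes, i.e. $G\circ F=F'\circ G'$. All four functors are the identity on underlying objects and morphisms of $\mathcal C$, and are given on structure maps by: $F(M,\rho^M)=(M,(\Diamond\otimes M)\circ(H\otimes\rho^M))$; $G(M,\rho_M)=(M,\rho_M\circ(\mathrm{eq}_H\otimes M))$; $G'(M,\rho^M)=(M,(\mathrm{coeq}_K\otimes M)\circ\rho^M)$; $F'(M,\delta^M)=(M,(\mathrm{ev}\otimes M)\circ(P(H)\otimes\delta^M))$.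
   Context: Conventions: the tensor product is additive in each variable; associativity and unit constraints are suppressed; $I$ is the unit object; an object also denotes its identity morphism. For $c:V\otimes V\to V\otimes V$ put $t_c=(c\otimes V)(V\otimes c)$, $w_c=(V\otimes c)(c\otimes V)$. An involutive Yang-Baxter operator on $V$ is $c$ with $c\circ c=1$ and $(c\otimes V)(V\otimes c)(c\otimes V)=(V\otimes c)(c\otimes V)(V\otimes c)$. A YB-Lie algebra is $(L,\lambda,\Lambda)$ with $\lambda$ such an operator on $L$ and $\Lambda:L\otimes L\to L$ with $\Lambda(1+\lambda)=0$, $\Lambda(L\otimes\Lambda)(1+t_\lambda+w_\lambda)=0$, $\lambda(\Lambda\otimes L)=(L\otimes\Lambda)t_\lambda$. A YB-Lie coalgebra is $(C,\gamma,\Upsilon)$ with $\gamma$ such an operator on $C$ and $\Upsilon:C\to C\otimes C$ with $\Upsilon+\gamma\Upsilon=0$, $(1+w_\gamma+t_\gamma)(C\otimes\Upsilon)\Upsilon=0$, $(\Upsilon\otimes C)\gamma=w_\gamma(C\otimes\Upsilon)$. A left $L$-Lie module is $(X,\varrho)$ with $\varrho:L\otimes X\to X$ and $\varrho(L\otimes\varrho)-\varrho(L\otimes\varrho)(\lambda\otimes X)-\varrho(\Lambda\otimes X)=0$. A left $C$-Lie comodule is $(X,\delta)$ with $\delta:X\to C\otimes X$ and $\big((C\otimes\delta)-(\gamma\otimes X)(C\otimes\delta)-\Upsilon\otimes X\big)\delta=0$. Morphisms are morphisms of $\mathcal C$ commuting with the (co)actions. $\mathsf{Mod}(H)$ and $\mathsf{CoMod}(K)$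 are the usual categories of left modules over the algebra $H$ and left comodules over the coalgebra $K$. A braided bialgebra in $\mathcal C$ is $(H,\mu,\eta,\Delta,\epsilon,\lambda)$ such that: $(H,\mu,\eta)$ is an algebra; $(H,\Delta,\epsilon)$ is a coalgebra; $\lambda$ is an involutive Yang-Baxter operator on $H$; $\lambda(\mu\otimes H)=(H\otimes\mu)t_\lambda$, $\lambda(H\otimes\mu)=(\mu\otimes H)w_\lambda$, $\lambda(\eta\otimes H)=H\otimes\eta$, $\lambda(H\otimes\eta)=\eta\otimes H$, $(H\otimes\Delta)\lambda=t_\lambda(\Delta\otimes H)$, $(\Delta\otimes H)\lambda=w_\lambda(H\otimes\Delta)$, $(\epsilon\otimes H)\lambda=H\otimes\epsilon$, $(H\otimes\epsilon)\lambda=\epsilon\otimes H$; $\epsilon$ is an algebra morphism, $\eta$ is a coalgebra morphism, and $(\mu\otimes\mu)(H\otimes\lambda\otimes H)(\Delta\otimes\Delta)=\Delta\mu$. A Takeuchi pair $(H,K,\Diamond)$ consists of braided bialgebras $H,K$ and a morphism $\Diamond:H\otimes K\to I$ such that, with $\Diamond^2=\Diamond\circ(H\otimes\Diamond\otimes K)$: $\Diamond(H\otimes\eta_K)=\epsilon_H$; $\Diamond(\eta_H\otimes K)=\epsilon_K$; $\Diamond(\mu_H\otimes K)=\Diamond^2(H\otimes H\otimes\Delta_K)$; $\Diamond(H\otimes\mu_K)=\Diamond^2(\Delta_H\otimes K\otimes K)$; $\Diamond^2(\lambda_H\otimes K\otimes K)=\Diamond^2(H\otimes H\otimes\lambda_K)$.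 $\mathrm{eq}_H:P(H)\to H$ is the equalizer of $\Delta_H$ and $\eta_H\otimes H+H\otimes\eta_H$; $P(H)$ is a YB-Lie algebra with $\lambda_{P(H)},\Lambda_{P(H)}$ the unique morphisms with $(\mathrm{eq}_H\otimes\mathrm{eq}_H)\lambda_{P(H)}=\lambda_H(\mathrm{eq}_H\otimes\mathrm{eq}_H)$ and $\mathrm{eq}_H\Lambda_{P(H)}=\mu_H(H\otimes H-\lambda_H)(\mathrm{eq}_H\otimes\mathrm{eq}_H)$. $\mathrm{coeq}_K:K\to Q(K)$ is the coequalizer of $\mu_K$ and $\epsilon_K\otimes K+K\otimes\epsilon_K$; $Q(K)$ is a YB-Lie coalgebra with $\gamma_{Q(K)},\Gamma_{Q(K)}$ the unique morphisms with $\gamma_{Q(K)}(\mathrm{coeq}_K\otimes\mathrm{coeq}_K)=(\mathrm{coeq}_K\otimes\mathrm{coeq}_K)\lambda_K$ and $\Gamma_{Q(K)}\mathrm{coeq}_K=(\mathrm{coeq}_K\otimes\mathrm{coeq}_K)(K\otimes K-\lambda_K)\Delta_K$. The morphism $\mathrm{ev}:P(H)\otimes Q(K)\to I$ is the unique one with $\mathrm{ev}\circ(P(H)\otimes\mathrm{coeq}_K)=\Diamond\circ(\mathrm{eq}_H\otimes K)$. *)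

theory Defs
  imports "HOL-Algebra.Group"
begin

section \<open>Categories and functors\<close>

record ('o, 'm) category_data =
  Ob :: "'o set"
  Arr :: "'m set"
  Dom :: "'m \<Rightarrow> 'o"
  Cod :: "'m \<Rightarrow> 'o"
  Ide :: "'o \<Rightarrow> 'm" ("\<one>\<^sub>m\<index>")
  Comp :: "'m \<Rightarrow> 'm \<Rightarrow> 'm" (infixr "\<cdot>\<index>" 70)

definition Hom :: "('o, 'm, 'z) category_data_scheme \<Rightarrow> 'o \<Rightarrow> 'o \<Rightarrow> 'm set" where
  "Hom C X Y = {f \<in> Arr C. Dom C f = X \<and> Cod C f = Y}"

locale category =
  fixes C :: "('o, 'm, 'z) category_data_scheme" (structure)
  assumes dom_ob: "f \<in> Arr C \<Longrightarrow> Dom C f \<in> Ob C"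
    and cod_ob: "f \<in> Arr C \<Longrightarrow> Cod C f \<in> Ob C"
    and ide_hom: "X \<in> Ob C \<Longrightarrow> \<one>\<^sub>m X \<in> Hom C X X"
    and comp_hom: "\<lbrakk>f \<in> Hom C X Y; g \<in> Hom C Y Z\<rbrakk> \<Longrightarrow> g \<cdot> f \<in> Hom C X Z"
    and comp_assoc: "\<lbrakk>f \<in> Hom C W X; g \<in> Hom C X Y; h \<in> Hom C Y Z\<rbrakk>
      \<Longrightarrow> (h \<cdot> g) \<cdot> f = h \<cdot> (g \<cdot> f)"
    and ide_left: "f \<in> Hom C X Y \<Longrightarrow> \<one>\<^sub>m Y \<cdot> f = f"
    and ide_right: "f \<in> Hom C X Y \<Longrightarrow> f \<cdot> \<one>\<^sub>m X = f"

record ('o1, 'm1, 'o2, 'm2) functor_data =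
  fobj :: "'o1 \<Rightarrow> 'o2"
  farr :: "'m1 \<Rightarrow> 'm2"

definition cat_functor ::
  "('o1, 'm1, 'y) category_data_scheme \<Rightarrow> ('o2, 'm2, 'z) category_data_scheme
    \<Rightarrow> ('o1, 'm1, 'o2, 'm2) functor_data \<Rightarrow> bool" where
  "cat_functor A B F \<longleftrightarrow>
     category A \<and> category B \<and>
     (\<forall>X\<in>Ob A. fobj F X \<in> Ob B) \<and>
     (\<forall>X\<in>Ob A. \<forall>Y\<in>Ob A. \<forall>f\<in>Hom A X Y. farr F f \<in> Hom B (fobj F X) (fobj F Y)) \<and>
     (\<forall>X\<in>Ob A. farr F (Ide A X) = Ide B (fobj F X)) \<and>
     (\<forall>X\<in>Ob A. \<forall>Y\<in>Ob A. \<forall>Z\<in>Ob A. \<forall>f\<in>Hom A X Y. \<forall>g\<in>Hom A Y Z.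
        farr F (Comp A g f) = Comp B (farr F g) (farr F f))"

definition functor_comp ::
  "('o2, 'm2, 'o3, 'm3) functor_data \<Rightarrow> ('o1, 'm1, 'o2, 'm2) functor_data
    \<Rightarrow> ('o1, 'm1, 'o3, 'm3) functor_data" where
  "functor_comp G F = \<lparr>fobj = fobj G \<circ> fobj F, farr = farr G \<circ> farr F\<rparr>"

text \<open>Equality of functors with source \<open>A\<close>: the maps are only compared on objects and arrows
  of \<open>A\<close>, since their values elsewhere are meaningless.\<close>

definition functor_eq ::
  "('o1, 'm1, 'z) category_data_scheme \<Rightarrow> ('o1, 'm1, 'o2, 'm2) functor_data
    \<Rightarrow> ('o1, 'm1, 'o2, 'm2) functor_data \<Rightarrow> bool" where
  "functor_eq A F G \<longleftrightarrow>
     (\<forall>X\<in>Ob A. fobj F X = fobj G X) \<and> (\<forall>f\<in>Arr A. farr F f = farr G f)"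

definition is_inverse :: "('o, 'm, 'z) category_data_scheme \<Rightarrow> 'm \<Rightarrow> 'm \<Rightarrow> bool" where
  "is_inverse C f g \<longleftrightarrow>
     f \<in> Arr C \<and> g \<in> Hom C (Cod C f) (Dom C f) \<and>
     g \<cdot>\<^bsub>C\<^esub> f = Ide C (Dom C f) \<and> f \<cdot>\<^bsub>C\<^esub> g = Ide C (Cod C f)"

definition is_iso :: "('o, 'm, 'z) category_data_scheme \<Rightarrow> 'm \<Rightarrow> bool" where
  "is_iso C f \<longleftrightarrow> (\<exists>g. is_inverse C f g)"

definition arr_inv :: "('o, 'm, 'z) category_data_scheme \<Rightarrow> 'm \<Rightarrow> 'm" where
  "arr_inv C f = (THE g. is_inverse C f g)"

definition is_equalizer ::
  "('o, 'm, 'z) category_data_scheme \<Rightarrow> 'o \<Rightarrow> 'm \<Rightarrow> 'm \<Rightarrow> 'm \<Rightarrow> bool" where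
  "is_equalizer C E e f g \<longleftrightarrow>
     (\<exists>X\<in>Ob C. \<exists>Y\<in>Ob C. f \<in> Hom C X Y \<and> g \<in> Hom C X Y \<and>
        E \<in> Ob C \<and> e \<in> Hom C E X \<and> f \<cdot>\<^bsub>C\<^esub> e = g \<cdot>\<^bsub>C\<^esub> e \<and>
        (\<forall>Z\<in>Ob C. \<forall>h\<in>Hom C Z X. f \<cdot>\<^bsub>C\<^esub> h = g \<cdot>\<^bsub>C\<^esub> h \<longrightarrow>
           (\<exists>!k. k \<in> Hom C Z E \<and> e \<cdot>\<^bsub>C\<^esub> k = h)))"

definition is_coequalizer ::
  "('o, 'm, 'z) category_data_scheme \<Rightarrow> 'o \<Rightarrow> 'm \<Rightarrow> 'm \<Rightarrow> 'm \<Rightarrow> bool" where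
  "is_coequalizer C Q q f g \<longleftrightarrow>
     (\<exists>X\<in>Ob C. \<exists>Y\<in>Ob C. f \<in> Hom C X Y \<and> g \<in> Hom C X Y \<and>
        Q \<in> Ob C \<and> q \<in> Hom C Y Q \<and> q \<cdot>\<^bsub>C\<^esub> f = q \<cdot>\<^bsub>C\<^esub> g \<and>
        (\<forall>Z\<in>Ob C. \<forall>h\<in>Hom C Y Z. h \<cdot>\<^bsub>C\<^esub> f = h \<cdot>\<^bsub>C\<^esub> g \<longrightarrow>
           (\<exists>!k. k \<in> Hom C Q Z \<and> k \<cdot>\<^bsub>C\<^esub> q = h)))"

definition has_equalizers :: "('o, 'm, 'z) category_data_scheme \<Rightarrow> bool" where
  "has_equalizers C \<longleftrightarrow>
     (\<forall>X\<in>Ob C. \<forall>Y\<in>Ob C. \<forall>f\<in>Hom C X Y. \<forall>g\<in>Hom C X Y. \<exists>E e. is_equalizer C E e f g)"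

definition has_coequalizers :: "('o, 'm, 'z) category_data_scheme \<Rightarrow> bool" where
  "has_coequalizers C \<longleftrightarrow>
     (\<forall>X\<in>Ob C. \<forall>Y\<in>Ob C. \<forall>f\<in>Hom C X Y. \<forall>g\<in>Hom C X Y. \<exists>Q q. is_coequalizer C Q q f g)"


section \<open>Additive monoidal categories\<close>

record ('o, 'm) addmon_data = "('o, 'm) category_data" +
  Zero :: "'o \<Rightarrow> 'o \<Rightarrow> 'm"
  Add :: "'m \<Rightarrow> 'm \<Rightarrow> 'm" (infixl "\<oplus>\<^sub>m\<index>" 65)
  TensOb :: "'o \<Rightarrow> 'o \<Rightarrow> 'o" (infixr "\<otimes>\<^sub>o\<index>" 75)
  TensArr :: "'m \<Rightarrow> 'm \<Rightarrow> 'm" (infixr "\<otimes>\<^sub>m\<index>" 75)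
  Unit :: "'o"
  Assoc :: "'o \<Rightarrow> 'o \<Rightarrow> 'o \<Rightarrow> 'm"
  Lunit :: "'o \<Rightarrow> 'm"
  Runit :: "'o \<Rightarrow> 'm"

definition hom_group :: "('o, 'm) addmon_data \<Rightarrow> 'o \<Rightarrow> 'o \<Rightarrow> 'm monoid" where
  "hom_group C X Y = \<lparr>carrier = Hom C X Y, mult = Add C, one = Zero C X Y\<rparr>"

definition Minus :: "('o, 'm) addmon_data \<Rightarrow> 'm \<Rightarrow> 'm \<Rightarrow> 'm" (infixl "\<ominus>\<^sub>m\<index>" 65) where
  "f \<ominus>\<^sub>m\<^bsub>C\<^esub> g = f \<oplus>\<^sub>m\<^bsub>C\<^esub> m_inv (hom_group C (Dom C g) (Cod C g)) g"

locale additive_category = category C for C :: "('o, 'm) addmon_data" (structure) +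
  assumes hom_comm_group: "\<lbrakk>X \<in> Ob C; Y \<in> Ob C\<rbrakk> \<Longrightarrow> comm_group (hom_group C X Y)"
    and comp_add_left: "\<lbrakk>f \<in> Hom C X Y; g \<in> Hom C Y Z; h \<in> Hom C Y Z\<rbrakk>
      \<Longrightarrow> (g \<oplus>\<^sub>m h) \<cdot> f = (g \<cdot> f) \<oplus>\<^sub>m (h \<cdot> f)"
    and comp_add_right: "\<lbrakk>f \<in> Hom C X Y; g \<in> Hom C X Y; h \<in> Hom C Y Z\<rbrakk>
      \<Longrightarrow> h \<cdot> (f \<oplus>\<^sub>m g) = (h \<cdot> f) \<oplus>\<^sub>m (h \<cdot> g)"
    and zero_object: "\<exists>N\<in>Ob C. \<forall>X\<in>Ob C. (\<exists>!f. f \<in> Hom C N X) \<and> (\<exists>!f. f \<in> Hom C X N)"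
    and biproducts: "\<lbrakk>X \<in> Ob C; Y \<in> Ob C\<rbrakk> \<Longrightarrow>
      \<exists>B\<in>Ob C. \<exists>i\<in>Hom C X B. \<exists>j\<in>Hom C Y B. \<exists>p\<in>Hom C B X. \<exists>q\<in>Hom C B Y.
        p \<cdot> i = \<one>\<^sub>m X \<and> q \<cdot> j = \<one>\<^sub>m Y \<and> p \<cdot> j = Zero C Y X \<and> q \<cdot> i = Zero C X Y \<and>
        (i \<cdot> p) \<oplus>\<^sub>m (j \<cdot> q) = \<one>\<^sub>m B"

locale monoidal_category = category C for C :: "('o, 'm) addmon_data" (structure) +
  assumes unit_ob: "Unit C \<in> Ob C"
    and tens_ob: "\<lbrakk>X \<in> Ob C; Y \<in> Ob C\<rbrakk> \<Longrightarrow> X \<otimes>\<^sub>o Y \<in> Ob C"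
    and tens_hom: "\<lbrakk>f \<in> Hom C X Y; g \<in> Hom C X' Y'\<rbrakk>
      \<Longrightarrow> f \<otimes>\<^sub>m g \<in> Hom C (X \<otimes>\<^sub>o X') (Y \<otimes>\<^sub>o Y')"
    and tens_ide: "\<lbrakk>X \<in> Ob C; Y \<in> Ob C\<rbrakk> \<Longrightarrow> \<one>\<^sub>m X \<otimes>\<^sub>m \<one>\<^sub>m Y = \<one>\<^sub>m (X \<otimes>\<^sub>o Y)"
    and tens_comp: "\<lbrakk>f \<in> Hom C X Y; g \<in> Hom C Y Z; f' \<in> Hom C X' Y'; g' \<in> Hom C Y' Z'\<rbrakk>
      \<Longrightarrow> (g \<cdot> f) \<otimes>\<^sub>m (g' \<cdot> f') = (g \<otimes>\<^sub>m g') \<cdot> (f \<otimes>\<^sub>m f')"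
    and assoc_hom: "\<lbrakk>X \<in> Ob C; Y \<in> Ob C; Z \<in> Ob C\<rbrakk>
      \<Longrightarrow> Assoc C X Y Z \<in> Hom C ((X \<otimes>\<^sub>o Y) \<otimes>\<^sub>o Z) (X \<otimes>\<^sub>o (Y \<otimes>\<^sub>o Z))"
    and assoc_iso: "\<lbrakk>X \<in> Ob C; Y \<in> Ob C; Z \<in> Ob C\<rbrakk> \<Longrightarrow> is_iso C (Assoc C X Y Z)"
    and assoc_natural: "\<lbrakk>f \<in> Hom C X X'; g \<in> Hom C Y Y'; h \<in> Hom C Z Z'\<rbrakk>
      \<Longrightarrow> Assoc C X' Y' Z' \<cdot> ((f \<otimes>\<^sub>m g) \<otimes>\<^sub>m h) = (f \<otimes>\<^sub>m (g \<otimes>\<^sub>m h)) \<cdot> Assoc C X Y Z"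
    and lunit_hom: "X \<in> Ob C \<Longrightarrow> Lunit C X \<in> Hom C (Unit C \<otimes>\<^sub>o X) X"
    and lunit_iso: "X \<in> Ob C \<Longrightarrow> is_iso C (Lunit C X)"
    and lunit_natural: "f \<in> Hom C X Y \<Longrightarrow> Lunit C Y \<cdot> (\<one>\<^sub>m (Unit C) \<otimes>\<^sub>m f) = f \<cdot> Lunit C X"
    and runit_hom: "X \<in> Ob C \<Longrightarrow> Runit C X \<in> Hom C (X \<otimes>\<^sub>o Unit C) X"
    and runit_iso: "X \<in> Ob C \<Longrightarrow> is_iso C (Runit C X)"
    and runit_natural: "f \<in> Hom C X Y \<Longrightarrow> Runit C Y \<cdot> (f \<otimes>\<^sub>m \<one>\<^sub>m (Unit C)) = f \<cdot> Runit C X"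
    and pentagon: "\<lbrakk>W \<in> Ob C; X \<in> Ob C; Y \<in> Ob C; Z \<in> Ob C\<rbrakk> \<Longrightarrow>
      Assoc C W X (Y \<otimes>\<^sub>o Z) \<cdot> Assoc C (W \<otimes>\<^sub>o X) Y Z =
      (\<one>\<^sub>m W \<otimes>\<^sub>m Assoc C X Y Z) \<cdot> Assoc C W (X \<otimes>\<^sub>o Y) Z \<cdot> (Assoc C W X Y \<otimes>\<^sub>m \<one>\<^sub>m Z)"
    and triangle: "\<lbrakk>X \<in> Ob C; Y \<in> Ob C\<rbrakk> \<Longrightarrow>
      (\<one>\<^sub>m X \<otimes>\<^sub>m Lunit C Y) \<cdot> Assoc C X (Unit C) Y = Runit C X \<otimes>\<^sub>m \<one>\<^sub>m Y"

locale additive_monoidal_category = additive_category C + monoidal_category C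
  for C :: "('o, 'm) addmon_data" (structure) +
  assumes tens_add_left: "\<lbrakk>f \<in> Hom C X Y; g \<in> Hom C X Y; h \<in> Hom C X' Y'\<rbrakk>
      \<Longrightarrow> (f \<oplus>\<^sub>m g) \<otimes>\<^sub>m h = (f \<otimes>\<^sub>m h) \<oplus>\<^sub>m (g \<otimes>\<^sub>m h)"
    and tens_add_right: "\<lbrakk>f \<in> Hom C X Y; g \<in> Hom C X Y; h \<in> Hom C X' Y'\<rbrakk>
      \<Longrightarrow> h \<otimes>\<^sub>m (f \<oplus>\<^sub>m g) = (h \<otimes>\<^sub>m f) \<oplus>\<^sub>m (h \<otimes>\<^sub>m g)"

definition tensor_preserves_equalizers :: "('o, 'm) addmon_data \<Rightarrow> bool" where
  "tensor_preserves_equalizers C \<longleftrightarrow>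
     (\<forall>E e f g X. is_equalizer C E e f g \<and> X \<in> Ob C \<longrightarrow>
        is_equalizer C (E \<otimes>\<^sub>o\<^bsub>C\<^esub> X) (e \<otimes>\<^sub>m\<^bsub>C\<^esub> Ide C X) (f \<otimes>\<^sub>m\<^bsub>C\<^esub> Ide C X) (g \<otimes>\<^sub>m\<^bsub>C\<^esub> Ide C X) \<and>
        is_equalizer C (X \<otimes>\<^sub>o\<^bsub>C\<^esub> E) (Ide C X \<otimes>\<^sub>m\<^bsub>C\<^esub> e) (Ide C X \<otimes>\<^sub>m\<^bsub>C\<^esub> f) (Ide C X \<otimes>\<^sub>m\<^bsub>C\<^esub> g))"

definition tensor_preserves_coequalizers :: "('o, 'm) addmon_data \<Rightarrow> bool" where
  "tensor_preserves_coequalizers C \<longleftrightarrow>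
     (\<forall>Q q f g X. is_coequalizer C Q q f g \<and> X \<in> Ob C \<longrightarrow>
        is_coequalizer C (Q \<otimes>\<^sub>o\<^bsub>C\<^esub> X) (q \<otimes>\<^sub>m\<^bsub>C\<^esub> Ide C X) (f \<otimes>\<^sub>m\<^bsub>C\<^esub> Ide C X) (g \<otimes>\<^sub>m\<^bsub>C\<^esub> Ide C X) \<and>
        is_coequalizer C (X \<otimes>\<^sub>o\<^bsub>C\<^esub> Q) (Ide C X \<otimes>\<^sub>m\<^bsub>C\<^esub> q) (Ide C X \<otimes>\<^sub>m\<^bsub>C\<^esub> f) (Ide C X \<otimes>\<^sub>m\<^bsub>C\<^esub> g))"


section \<open>Algebraic structures\<close>

record ('o, 'm) bialg_data =
  obj :: "'o"
  mul :: "'m"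
  unt :: "'m"
  comul :: "'m"
  counit :: "'m"
  braid :: "'m"

record ('o, 'm) lie_data =
  lie_obj :: "'o"
  lie_braid :: "'m"
  bracket :: "'m"

record ('o, 'm) colie_data =
  colie_obj :: "'o"
  colie_braid :: "'m"
  cobracket :: "'m"

text \<open>The constraints suppressed in the usual notation are inserted explicitly: endomorphisms of a
  triple tensor power live on \<open>(V \<otimes> V) \<otimes> V\<close>, quadruple tensors are \<open>(X \<otimes> Y) \<otimes> (Z \<otimes> W)\<close>, and
  morphisms such as \<open>\<eta> \<otimes> V : I \<otimes> V \<rightarrow> V \<otimes> V\<close> are turned into morphisms from \<open>V\<close> with the inverse
  unit constraint.\<close>

context
  fixes C :: "('o, 'm) addmon_data" (structure)
begin

definition left_strand :: "'o \<Rightarrow> 'm \<Rightarrow> 'm" where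
  "left_strand V c = c \<otimes>\<^sub>m \<one>\<^sub>m V"

definition right_strand :: "'o \<Rightarrow> 'm \<Rightarrow> 'm" where
  "right_strand V c = arr_inv C (Assoc C V V V) \<cdot> (\<one>\<^sub>m V \<otimes>\<^sub>m c) \<cdot> Assoc C V V V"

definition t_op :: "'o \<Rightarrow> 'm \<Rightarrow> 'm" where
  "t_op V c = left_strand V c \<cdot> right_strand V c"

definition w_op :: "'o \<Rightarrow> 'm \<Rightarrow> 'm" where
  "w_op V c = right_strand V c \<cdot> left_strand V c"

definition involutive_yb_operator :: "'o \<Rightarrow> 'm \<Rightarrow> bool" where
  "involutive_yb_operator V c \<longleftrightarrow>
     V \<in> Ob C \<and> c \<in> Hom C (V \<otimes>\<^sub>o V) (V \<otimes>\<^sub>o V) \<and>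
     c \<cdot> c = \<one>\<^sub>m (V \<otimes>\<^sub>o V) \<and>
     left_strand V c \<cdot> right_strand V c \<cdot> left_strand V c =
     right_strand V c \<cdot> left_strand V c \<cdot> right_strand V c"

definition is_algebra :: "'o \<Rightarrow> 'm \<Rightarrow> 'm \<Rightarrow> bool" where
  "is_algebra A \<mu> \<eta> \<longleftrightarrow>
     A \<in> Ob C \<and> \<mu> \<in> Hom C (A \<otimes>\<^sub>o A) A \<and> \<eta> \<in> Hom C (Unit C) A \<and>
     \<mu> \<cdot> (\<mu> \<otimes>\<^sub>m \<one>\<^sub>m A) = \<mu> \<cdot> (\<one>\<^sub>m A \<otimes>\<^sub>m \<mu>) \<cdot> Assoc C A A A \<and>
     \<mu> \<cdot> (\<eta> \<otimes>\<^sub>m \<one>\<^sub>m A) = Lunit C A \<and>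
     \<mu> \<cdot> (\<one>\<^sub>m A \<otimes>\<^sub>m \<eta>) = Runit C A"

definition is_coalgebra :: "'o \<Rightarrow> 'm \<Rightarrow> 'm \<Rightarrow> bool" where
  "is_coalgebra A \<Delta> \<epsilon> \<longleftrightarrow>
     A \<in> Ob C \<and> \<Delta> \<in> Hom C A (A \<otimes>\<^sub>o A) \<and> \<epsilon> \<in> Hom C A (Unit C) \<and>
     Assoc C A A A \<cdot> (\<Delta> \<otimes>\<^sub>m \<one>\<^sub>m A) \<cdot> \<Delta> = (\<one>\<^sub>m A \<otimes>\<^sub>m \<Delta>) \<cdot> \<Delta> \<and>
     Lunit C A \<cdot> (\<epsilon> \<otimes>\<^sub>m \<one>\<^sub>m A) \<cdot> \<Delta> = \<one>\<^sub>m A \<and>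
     Runit C A \<cdot> (\<one>\<^sub>m A \<otimes>\<^sub>m \<epsilon>) \<cdot> \<Delta> = \<one>\<^sub>m A"

definition left_unit_insert :: "'o \<Rightarrow> 'm \<Rightarrow> 'm" where
  "left_unit_insert A \<eta> = (\<eta> \<otimes>\<^sub>m \<one>\<^sub>m A) \<cdot> arr_inv C (Lunit C A)"

definition right_unit_insert :: "'o \<Rightarrow> 'm \<Rightarrow> 'm" where
  "right_unit_insert A \<eta> = (\<one>\<^sub>m A \<otimes>\<^sub>m \<eta>) \<cdot> arr_inv C (Runit C A)"

definition left_counit_apply :: "'o \<Rightarrow> 'm \<Rightarrow> 'm" where
  "left_counit_apply A \<epsilon> = Lunit C A \<cdot> (\<epsilon> \<otimes>\<^sub>m \<one>\<^sub>m A)"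

definition right_counit_apply :: "'o \<Rightarrow> 'm \<Rightarrow> 'm" where
  "right_counit_apply A \<epsilon> = Runit C A \<cdot> (\<one>\<^sub>m A \<otimes>\<^sub>m \<epsilon>)"

text \<open>\<open>V \<otimes> c \<otimes> V\<close> as an endomorphism of \<open>(V \<otimes> V) \<otimes> (V \<otimes> V)\<close>.\<close>

definition mid_strand :: "'o \<Rightarrow> 'm \<Rightarrow> 'm" where
  "mid_strand V c =
     arr_inv C (Assoc C V V (V \<otimes>\<^sub>o V)) \<cdot>
     (\<one>\<^sub>m V \<otimes>\<^sub>m (Assoc C V V V \<cdot> (c \<otimes>\<^sub>m \<one>\<^sub>m V) \<cdot> arr_inv C (Assoc C V V V))) \<cdot>
     Assoc C V V (V \<otimes>\<^sub>o V)"

definition braided_bialgebra :: "('o, 'm) bialg_data \<Rightarrow> bool" where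
  "braided_bialgebra B \<longleftrightarrow>
     (let H = obj B; \<mu> = mul B; \<eta> = unt B; \<Delta> = comul B; \<epsilon> = counit B; c = braid B;
          \<alpha> = Assoc C H H H
      in is_algebra H \<mu> \<eta> \<and>
         is_coalgebra H \<Delta> \<epsilon> \<and>
         involutive_yb_operator H c \<and>
         c \<cdot> (\<mu> \<otimes>\<^sub>m \<one>\<^sub>m H) = (\<one>\<^sub>m H \<otimes>\<^sub>m \<mu>) \<cdot> \<alpha> \<cdot> t_op H c \<and>
         c \<cdot> (\<one>\<^sub>m H \<otimes>\<^sub>m \<mu>) \<cdot> \<alpha> = (\<mu> \<otimes>\<^sub>m \<one>\<^sub>m H) \<cdot> w_op H c \<and>
         c \<cdot> left_unit_insert H \<eta> = right_unit_insert H \<eta> \<and>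
         c \<cdot> right_unit_insert H \<eta> = left_unit_insert H \<eta> \<and>
         arr_inv C \<alpha> \<cdot> (\<one>\<^sub>m H \<otimes>\<^sub>m \<Delta>) \<cdot> c = t_op H c \<cdot> (\<Delta> \<otimes>\<^sub>m \<one>\<^sub>m H) \<and>
         (\<Delta> \<otimes>\<^sub>m \<one>\<^sub>m H) \<cdot> c = w_op H c \<cdot> arr_inv C \<alpha> \<cdot> (\<one>\<^sub>m H \<otimes>\<^sub>m \<Delta>) \<and>
         left_counit_apply H \<epsilon> \<cdot> c = right_counit_apply H \<epsilon> \<and>
         right_counit_apply H \<epsilon> \<cdot> c = left_counit_apply H \<epsilon> \<and>
         \<epsilon> \<cdot> \<mu> = Lunit C (Unit C) \<cdot> (\<epsilon> \<otimes>\<^sub>m \<epsilon>) \<and>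
         \<epsilon> \<cdot> \<eta> = \<one>\<^sub>m (Unit C) \<and>
         \<Delta> \<cdot> \<eta> = (\<eta> \<otimes>\<^sub>m \<eta>) \<cdot> arr_inv C (Lunit C (Unit C)) \<and>
         (\<mu> \<otimes>\<^sub>m \<mu>) \<cdot> mid_strand H c \<cdot> (\<Delta> \<otimes>\<^sub>m \<Delta>) = \<Delta> \<cdot> \<mu>)"

text \<open>The iterated pairing \<open>(X \<otimes> X) \<otimes> (Y \<otimes> Y) \<rightarrow> I\<close>, which pairs the two inner factors first.\<close>

definition pairing2 :: "'o \<Rightarrow> 'o \<Rightarrow> 'm \<Rightarrow> 'm" where
  "pairing2 X Y p =
     p \<cdot> (\<one>\<^sub>m X \<otimes>\<^sub>m (Lunit C Y \<cdot> (p \<otimes>\<^sub>m \<one>\<^sub>m Y) \<cdot> arr_inv C (Assoc C X Y Y))) \<cdot>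
     Assoc C X X (Y \<otimes>\<^sub>o Y)"

definition takeuchi_pair :: "('o, 'm) bialg_data \<Rightarrow> ('o, 'm) bialg_data \<Rightarrow> 'm \<Rightarrow> bool" where
  "takeuchi_pair BH BK p \<longleftrightarrow>
     (let H = obj BH; K = obj BK; p2 = pairing2 H K p
      in braided_bialgebra BH \<and>
         braided_bialgebra BK \<and>
         p \<in> Hom C (H \<otimes>\<^sub>o K) (Unit C) \<and>
         p \<cdot> right_unit_insert H (unt BK) = counit BH \<and>
         p \<cdot> left_unit_insert K (unt BH) = counit BK \<and>
         p \<cdot> (mul BH \<otimes>\<^sub>m \<one>\<^sub>m K) = p2 \<cdot> (\<one>\<^sub>m (H \<otimes>\<^sub>o H) \<otimes>\<^sub>m comul BK) \<and>
         p \<cdot> (\<one>\<^sub>m H \<otimes>\<^sub>m mul BK) = p2 \<cdot> (comul BH \<otimes>\<^sub>m \<one>\<^sub>m (K \<otimes>\<^sub>o K)) \<and>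
         p2 \<cdot> (braid BH \<otimes>\<^sub>m \<one>\<^sub>m (K \<otimes>\<^sub>o K)) = p2 \<cdot> (\<one>\<^sub>m (H \<otimes>\<^sub>o H) \<otimes>\<^sub>m braid BK))"


section \<open>Primitives, indecomposables and the induced pairing\<close>

definition is_primitives :: "('o, 'm) bialg_data \<Rightarrow> 'o \<Rightarrow> 'm \<Rightarrow> bool" where
  "is_primitives B P e \<longleftrightarrow>
     is_equalizer C P e (comul B)
       (left_unit_insert (obj B) (unt B) \<oplus>\<^sub>m right_unit_insert (obj B) (unt B))"

definition prim_lie :: "('o, 'm) bialg_data \<Rightarrow> 'o \<Rightarrow> 'm \<Rightarrow> ('o, 'm) lie_data" where
  "prim_lie B P e =
     \<lparr>lie_obj = P,
      lie_braid = (THE l. l \<in> Hom C (P \<otimes>\<^sub>o P) (P \<otimes>\<^sub>o P) \<and>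
        (e \<otimes>\<^sub>m e) \<cdot> l = braid B \<cdot> (e \<otimes>\<^sub>m e)),
      bracket = (THE b. b \<in> Hom C (P \<otimes>\<^sub>o P) P \<and>
        e \<cdot> b = mul B \<cdot> (\<one>\<^sub>m (obj B \<otimes>\<^sub>o obj B) \<ominus>\<^sub>m braid B) \<cdot> (e \<otimes>\<^sub>m e))\<rparr>"

definition is_indecomposables :: "('o, 'm) bialg_data \<Rightarrow> 'o \<Rightarrow> 'm \<Rightarrow> bool" where
  "is_indecomposables B Q q \<longleftrightarrow>
     is_coequalizer C Q q (mul B)
       (left_counit_apply (obj B) (counit B) \<oplus>\<^sub>m right_counit_apply (obj B) (counit B))"

definition indec_colie :: "('o, 'm) bialg_data \<Rightarrow> 'o \<Rightarrow> 'm \<Rightarrow> ('o, 'm) colie_data" where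
  "indec_colie B Q q =
     \<lparr>colie_obj = Q,
      colie_braid = (THE l. l \<in> Hom C (Q \<otimes>\<^sub>o Q) (Q \<otimes>\<^sub>o Q) \<and>
        l \<cdot> (q \<otimes>\<^sub>m q) = (q \<otimes>\<^sub>m q) \<cdot> braid B),
      cobracket = (THE b. b \<in> Hom C Q (Q \<otimes>\<^sub>o Q) \<and>
        b \<cdot> q = (q \<otimes>\<^sub>m q) \<cdot> (\<one>\<^sub>m (obj B \<otimes>\<^sub>o obj B) \<ominus>\<^sub>m braid B) \<cdot> comul B)\<rparr>"

definition ev_pairing ::
  "('o, 'm) bialg_data \<Rightarrow> 'm \<Rightarrow> 'o \<Rightarrow> 'm \<Rightarrow> 'o \<Rightarrow> 'm \<Rightarrow> 'm" where
  "ev_pairing BK p P e Q q =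
     (THE v. v \<in> Hom C (P \<otimes>\<^sub>o Q) (Unit C) \<and> v \<cdot> (\<one>\<^sub>m P \<otimes>\<^sub>m q) = p \<cdot> (e \<otimes>\<^sub>m \<one>\<^sub>m (obj BK)))"


section \<open>Categories of (Lie) (co)modules\<close>

definition is_module :: "('o, 'm) bialg_data \<Rightarrow> 'o \<times> 'm \<Rightarrow> bool" where
  "is_module B = (\<lambda>(M, r).
     M \<in> Ob C \<and> r \<in> Hom C (obj B \<otimes>\<^sub>o M) M \<and>
     r \<cdot> (mul B \<otimes>\<^sub>m \<one>\<^sub>m M) = r \<cdot> (\<one>\<^sub>m (obj B) \<otimes>\<^sub>m r) \<cdot> Assoc C (obj B) (obj B) M \<and>
     r \<cdot> left_unit_insert M (unt B) = \<one>\<^sub>m M)"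

definition is_comodule :: "('o, 'm) bialg_data \<Rightarrow> 'o \<times> 'm \<Rightarrow> bool" where
  "is_comodule B = (\<lambda>(M, d).
     M \<in> Ob C \<and> d \<in> Hom C M (obj B \<otimes>\<^sub>o M) \<and>
     Assoc C (obj B) (obj B) M \<cdot> (comul B \<otimes>\<^sub>m \<one>\<^sub>m M) \<cdot> d = (\<one>\<^sub>m (obj B) \<otimes>\<^sub>m d) \<cdot> d \<and>
     left_counit_apply M (counit B) \<cdot> d = \<one>\<^sub>m M)"

definition is_lie_module :: "('o, 'm) lie_data \<Rightarrow> 'o \<times> 'm \<Rightarrow> bool" where
  "is_lie_module LL = (\<lambda>(X, r).
     (let L = lie_obj LL; rr = r \<cdot> (\<one>\<^sub>m L \<otimes>\<^sub>m r) \<cdot> Assoc C L L X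
      in X \<in> Ob C \<and> r \<in> Hom C (L \<otimes>\<^sub>o X) X \<and>
         rr \<ominus>\<^sub>m rr \<cdot> (lie_braid LL \<otimes>\<^sub>m \<one>\<^sub>m X) \<ominus>\<^sub>m r \<cdot> (bracket LL \<otimes>\<^sub>m \<one>\<^sub>m X) =
         Zero C ((L \<otimes>\<^sub>o L) \<otimes>\<^sub>o X) X))"

definition is_lie_comodule :: "('o, 'm) colie_data \<Rightarrow> 'o \<times> 'm \<Rightarrow> bool" where
  "is_lie_comodule DD = (\<lambda>(X, d).
     (let D = colie_obj DD; dd = arr_inv C (Assoc C D D X) \<cdot> (\<one>\<^sub>m D \<otimes>\<^sub>m d)
      in X \<in> Ob C \<and> d \<in> Hom C X (D \<otimes>\<^sub>o X) \<and>
         (dd \<ominus>\<^sub>m (colie_braid DD \<otimes>\<^sub>m \<one>\<^sub>m X) \<cdot> dd \<ominus>\<^sub>m (cobracket DD \<otimes>\<^sub>m \<one>\<^sub>m X)) \<cdot> d =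
         Zero C X ((D \<otimes>\<^sub>o D) \<otimes>\<^sub>o X)))"

definition action_morphism :: "'o \<Rightarrow> 'o \<times> 'm \<Rightarrow> 'o \<times> 'm \<Rightarrow> 'm \<Rightarrow> bool" where
  "action_morphism A M N f \<longleftrightarrow> f \<cdot> snd M = snd N \<cdot> (\<one>\<^sub>m A \<otimes>\<^sub>m f)"

definition coaction_morphism :: "'o \<Rightarrow> 'o \<times> 'm \<Rightarrow> 'o \<times> 'm \<Rightarrow> 'm \<Rightarrow> bool" where
  "coaction_morphism A M N f \<longleftrightarrow> snd N \<cdot> f = (\<one>\<^sub>m A \<otimes>\<^sub>m f) \<cdot> snd M"

text \<open>The category of pairs (object, structure map) satisfying \<open>S\<close>. An arrow is a triple
  (source, target, underlying morphism of \<open>C\<close>), so that it determines its source and target.\<close>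

definition structured_category ::
  "('o \<times> 'm \<Rightarrow> bool) \<Rightarrow> ('o \<times> 'm \<Rightarrow> 'o \<times> 'm \<Rightarrow> 'm \<Rightarrow> bool)
    \<Rightarrow> ('o \<times> 'm, ('o \<times> 'm) \<times> ('o \<times> 'm) \<times> 'm) category_data" where
  "structured_category S R =
     \<lparr>Ob = {M. S M},
      Arr = {(M, N, f). S M \<and> S N \<and> f \<in> Hom C (fst M) (fst N) \<and> R M N f},
      Dom = (\<lambda>(M, N, f). M),
      Cod = (\<lambda>(M, N, f). N),
      Ide = (\<lambda>M. (M, M, \<one>\<^sub>m (fst M))),
      Comp = (\<lambda>(N, N', g) (M, M', f). (M, N', g \<cdot> f))\<rparr>"

definition Mod where
  "Mod B = structured_category (is_module B) (action_morphism (obj B))"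

definition CoMod where
  "CoMod B = structured_category (is_comodule B) (coaction_morphism (obj B))"

definition LieMod where
  "LieMod L = structured_category (is_lie_module L) (action_morphism (lie_obj L))"

definition LieCoMod where
  "LieCoMod D = structured_category (is_lie_comodule D) (coaction_morphism (colie_obj D))"


section \<open>The four functors\<close>

text \<open>The functor which acts by \<open>\<phi>\<close> on objects and by the identity on underlying morphisms.\<close>

definition structure_functor ::
  "('o \<times> 'm \<Rightarrow> 'o \<times> 'm)
    \<Rightarrow> ('o \<times> 'm, ('o \<times> 'm) \<times> ('o \<times> 'm) \<times> 'm,
        'o \<times> 'm, ('o \<times> 'm) \<times> ('o \<times> 'm) \<times> 'm) functor_data" where
  "structure_functor \<phi> = \<lparr>fobj = \<phi>, farr = (\<lambda>(M, N, f). (\<phi> M, \<phi> N, f))\<rparr>"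

text \<open>For \<open>p : X \<otimes> Y \<rightarrow> I\<close> and a coaction \<open>d : M \<rightarrow> Y \<otimes> M\<close>, the action \<open>(p \<otimes> M) (X \<otimes> d)\<close>.\<close>

definition pairing_action :: "'o \<Rightarrow> 'o \<Rightarrow> 'm \<Rightarrow> 'o \<times> 'm \<Rightarrow> 'o \<times> 'm" where
  "pairing_action X Y p = (\<lambda>(M, d).
     (M, Lunit C M \<cdot> (p \<otimes>\<^sub>m \<one>\<^sub>m M) \<cdot> arr_inv C (Assoc C X Y M) \<cdot> (\<one>\<^sub>m X \<otimes>\<^sub>m d)))"

definition functor_F where
  "functor_F BH BK p = structure_functor (pairing_action (obj BH) (obj BK) p)"

definition functor_G where
  "functor_G e = structure_functor (\<lambda>(M, r). (M, r \<cdot> (e \<otimes>\<^sub>m \<one>\<^sub>m M)))"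

definition functor_G' where
  "functor_G' q = structure_functor (\<lambda>(M, d). (M, (q \<otimes>\<^sub>m \<one>\<^sub>m M) \<cdot> d))"

definition functor_F' where
  "functor_F' P Q v = structure_functor (pairing_action P Q v)"

end

end

theory Submission
  imports Defs
begin

text \<open>
  Everything rests on two calculi. Inserting a unit \<open>I \<rightarrow> H\<close> next to an object is natural and, by the
  triangle and Kelly's unit coherences, moves freely through associators; computing \<open>\<Delta>\<close> on
  \<open>\<lambda>(e \<otimes> e)\<close> and on \<open>\<mu>(1 - \<lambda>)(e \<otimes> e)\<close> then shows that both factor through the equalizer \<open>e\<close> of the
  primitives (the terms \<open>1 + \<lambda>\<close> in \<open>\<Delta>\<mu>(e \<otimes> e)\<close> cancel because \<open>\<lambda>\<^sup>2 = 1\<close>). The statements for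
  indecomposables are the same ones in the opposite category.

  Contracting \<open>X \<otimes> (Y \<otimes> M) \<rightarrow> M\<close> along a pairing \<open>X \<otimes> Y \<rightarrow> I\<close> is natural in \<open>M\<close> and dinatural in
  \<open>X\<close>, \<open>Y\<close>, and an action obtained in this way from a coaction \<open>d\<close> has as its square the contraction of
  \<open>(Y \<otimes> d) d\<close> along the iterated pairing. So the action axioms reduce to the identities relating the
  structure maps through the iterated pairings: these are the Takeuchi axioms for \<open>\<Diamond>\<close>, and for \<open>ev\<close>
  they follow by restricting along \<open>e\<close> and cancelling the epimorphism \<open>q \<otimes> q\<close>.
\<close>

section \<open>Categories and monoidal constraints\<close>

text \<open>The equation of functors is the short end of the argument: both composites contract one
  coaction along one pairing \<open>P \<otimes> K \<rightarrow> I\<close>, written in two ways by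
  the defining equation of \<open>ev\<close>. The labour lies in showing that the data exist and
  satisfy the axioms. The Lie structures and \<open>ev\<close> are definite descriptions, so nothing
  can be said about them before existence and uniqueness of the described arrow are established.
  Preservation of (co)equalizers by tensoring is what supplies this: \<open>e \<otimes> e\<close>
  and \<open>q \<otimes> q\<close> are treated as composites of two (co)equalizers, each tensored
  with an identity.

  The other obstacle is that the category is not strict. Every suppressed constraint is present, and
  a rewriting that is invisible on paper becomes a coherence problem. Unit insertions and
  contractions are therefore treated as units of their own with the constraints hidden inside.
  Differences are traded for sums wherever an axiom contains one, so that bilinearity and a single
  cancellation suffice.\<close>

lemma in_Hom_iff: "f \<in> Hom C X Y \<longleftrightarrow> f \<in> Arr C \<and> Dom C f = X \<and> Cod C f = Y"
  by (simp add: Hom_def)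

context category
begin

text \<open>Typing is computed rather than inferred: membership in a hom-set is broken into
  equations for \<open>Dom\<close> and \<open>Cod\<close>, so side conditions of later rules are
  discharged by rewriting.\<close>

lemmas [simp] = in_Hom_iff
lemmas [simp] = dom_ob cod_ob

lemma ide_arr [simp]:
  assumes "X \<in> Ob C"
  shows "\<one>\<^sub>m X \<in> Arr C" "Dom C (\<one>\<^sub>m X) = X" "Cod C (\<one>\<^sub>m X) = X"
  using ide_hom[OF assms] by auto

lemma comp_arr [simp]:
  assumes "f \<in> Arr C" "g \<in> Arr C" "Dom C g = Cod C f"
  shows "g \<cdot> f \<in> Arr C" "Dom C (g \<cdot> f) = Dom C f" "Cod C (g \<cdot> f) = Cod C g"
  using comp_hom[of f "Dom C f" "Cod C f" g "Cod C g"] assms by auto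

lemma comp_assoc' [simp]:
  assumes "f \<in> Arr C" "g \<in> Arr C" "h \<in> Arr C" "Dom C g = Cod C f" "Dom C h = Cod C g"
  shows "(h \<cdot> g) \<cdot> f = h \<cdot> (g \<cdot> f)"
  using comp_assoc[of f "Dom C f" "Cod C f" g "Cod C g" h "Cod C h"] assms by auto

lemma comp_ide [simp]:
  assumes "f \<in> Arr C"
  shows "Cod C f = X \<Longrightarrow> \<one>\<^sub>m X \<cdot> f = f" "Dom C f = X \<Longrightarrow> f \<cdot> \<one>\<^sub>m X = f"
  using ide_left[of f] ide_right[of f] assms by auto

lemma is_inverseD:
  assumes "is_inverse C f g"
  shows "f \<in> Arr C" "g \<in> Arr C" "Dom C g = Cod C f" "Cod C g = Dom C f"
    "g \<cdot> f = \<one>\<^sub>m (Dom C f)" "f \<cdot> g = \<one>\<^sub>m (Cod C f)"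
  using assms by (auto simp: is_inverse_def)

lemma is_inverse_unique:
  assumes f: "is_inverse C f g" and g: "is_inverse C f h"
  shows "h = g"
proof -
  note [simp] = is_inverseD[OF f] is_inverseD[OF g]
  have "h \<cdot> (f \<cdot> g) = (h \<cdot> f) \<cdot> g"
    by (subst comp_assoc') simp_all
  then show ?thesis
    by (simp del: comp_assoc')
qed

lemma arr_inv_eqI: "is_inverse C f g \<Longrightarrow> arr_inv C f = g"
  unfolding arr_inv_def by (rule the_equality) (auto intro: is_inverse_unique)

lemma arr_inv_is_inverse: "is_iso C f \<Longrightarrow> is_inverse C f (arr_inv C f)"
  unfolding is_iso_def by (auto simp: arr_inv_eqI)

lemma is_inverse_sym: "is_inverse C f g \<Longrightarrow> is_inverse C g f"
  by (auto simp: is_inverse_def)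

lemma arr_inv_arr_inv: "is_iso C f \<Longrightarrow> arr_inv C (arr_inv C f) = f"
  by (rule arr_inv_eqI[OF is_inverse_sym[OF arr_inv_is_inverse]])

lemma arr_inv_simps:
  assumes "is_iso C f"
  shows "arr_inv C f \<in> Arr C" "Dom C (arr_inv C f) = Cod C f" "Cod C (arr_inv C f) = Dom C f"
    "arr_inv C f \<cdot> f = \<one>\<^sub>m (Dom C f)" "f \<cdot> arr_inv C f = \<one>\<^sub>m (Cod C f)"
  using is_inverseD[OF arr_inv_is_inverse[OF assms]] by auto

text \<open>Composites are normalized to nest to the right, so an equation between two-fold
  composites does not match inside a longer one. This prolongs such an equation by a trailing
  factor; many primed rules below are instances of it or of \<open>comp_extend1\<close>.\<close>

lemma comp_extend:
  assumes "f \<cdot> g = h \<cdot> k" "f \<in> Arr C" "g \<in> Arr C" "h \<in> Arr C" "k \<in> Arr C"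
    "Dom C f = Cod C g" "Dom C h = Cod C k"  "x \<in> Arr C" "Cod C x = Dom C g" "Cod C x = Dom C k"
  shows "f \<cdot> g \<cdot> x = h \<cdot> k \<cdot> x"
  using assms comp_assoc'[of x g f] comp_assoc'[of x k h] by metis

lemma comp_extend1:
  assumes "f \<cdot> g = h" "f \<in> Arr C" "g \<in> Arr C"
    "Dom C f = Cod C g" "x \<in> Arr C" "Cod C x = Dom C g"
  shows "f \<cdot> g \<cdot> x = h \<cdot> x"
  using assms comp_assoc'[of x g f] by metis

lemma iso_comp:
  assumes "is_iso C f" "is_iso C g" "Dom C g = Cod C f"
  shows "is_iso C (g \<cdot> f)"
proof -
  note f = is_inverseD[OF arr_inv_is_inverse[OF assms(1)]]
  note g = is_inverseD[OF arr_inv_is_inverse[OF assms(2)]]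
  have "is_inverse C (g \<cdot> f) (arr_inv C f \<cdot> arr_inv C g)"
    using f g assms(3) comp_extend1[OF g(5)] comp_extend1[OF f(6)] by (simp add: is_inverse_def)
  then show ?thesis unfolding is_iso_def by blast
qed

lemma iso_cancel_left:
  assumes "f \<cdot> g = f \<cdot> h" "is_iso C f" "g \<in> Arr C" "h \<in> Arr C" "Cod C g = Dom C f" "Cod C h = Dom C f"
  shows "g = h"
proof -
  note f = is_inverseD[OF arr_inv_is_inverse[OF assms(2)]]
  have *: "arr_inv C f \<cdot> f \<cdot> x = x" if "x \<in> Arr C" "Cod C x = Dom C f" for x
    using comp_extend1[OF f(5)] f that by simp
  show ?thesis using *[of g] *[of h] assms by metis
qed

lemma iso_cancel_right:
  assumes "g \<cdot> f = h \<cdot> f" "is_iso C f" "g \<in> Arr C" "h \<in> Arr C" "Dom C g = Cod C f" "Dom C h = Cod C f"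
  shows "g = h"
proof -
  note f = is_inverseD[OF arr_inv_is_inverse[OF assms(2)]]
  have *: "(x \<cdot> f) \<cdot> arr_inv C f = x" if "x \<in> Arr C" "Dom C x = Cod C f" for x
    using f that by simp
  show ?thesis using *[of g] *[of h] assms by metis
qed

end

section \<open>Interchange, and naturality of the constraints and their inverses\<close>

context monoidal_category
begin

abbreviation Ainv where "Ainv X Y Z \<equiv> arr_inv C (Assoc C X Y Z)"
abbreviation Linv where "Linv X \<equiv> arr_inv C (Lunit C X)"
abbreviation Rinv where "Rinv X \<equiv> arr_inv C (Runit C X)"
abbreviation I where "I \<equiv> Unit C"

lemmas [simp] = unit_ob tens_ob

lemma tens_arr [simp]:
  assumes "f \<in> Arr C" "g \<in> Arr C"
  shows "f \<otimes>\<^sub>m g \<in> Arr C" "Dom C (f \<otimes>\<^sub>m g) = Dom C f \<otimes>\<^sub>o Dom C g"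
    "Cod C (f \<otimes>\<^sub>m g) = Cod C f \<otimes>\<^sub>o Cod C g"
  using tens_hom[of f "Dom C f" "Cod C f" g "Dom C g" "Cod C g"] assms by auto

lemmas [simp] = tens_ide

text \<open>Interchange is oriented towards fusing, so that two tensor expressions differing only in
  the order in which independent factors act receive the same normal form.\<close>

lemma tens_merge [simp]:
  assumes "f \<in> Arr C" "g \<in> Arr C" "f' \<in> Arr C" "g' \<in> Arr C" "Dom C g = Cod C f" "Dom C g' = Cod C f'"
  shows "(g \<otimes>\<^sub>m g') \<cdot> (f \<otimes>\<^sub>m f') = (g \<cdot> f) \<otimes>\<^sub>m (g' \<cdot> f')"
  using tens_comp[of f "Dom C f" "Cod C f" g "Cod C g" f' "Dom C f'" "Cod C f'" g' "Cod C g'"] assms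
  by auto

lemma tens_merge' [simp]:
  assumes "f \<in> Arr C" "g \<in> Arr C" "f' \<in> Arr C" "g' \<in> Arr C" "Dom C g = Cod C f" "Dom C g' = Cod C f'"
    "h \<in> Arr C" "Cod C h = Dom C f \<otimes>\<^sub>o Dom C f'"
  shows "(g \<otimes>\<^sub>m g') \<cdot> (f \<otimes>\<^sub>m f') \<cdot> h = ((g \<cdot> f) \<otimes>\<^sub>m (g' \<cdot> f')) \<cdot> h"
  by (rule comp_extend1) (use assms in auto)

lemma constraint_arr [simp]:
  "X \<in> Ob C \<Longrightarrow> Lunit C X \<in> Arr C" "X \<in> Ob C \<Longrightarrow> Dom C (Lunit C X) = I \<otimes>\<^sub>o X"
  "X \<in> Ob C \<Longrightarrow> Cod C (Lunit C X) = X"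
  "X \<in> Ob C \<Longrightarrow> Runit C X \<in> Arr C" "X \<in> Ob C \<Longrightarrow> Dom C (Runit C X) = X \<otimes>\<^sub>o I"
  "X \<in> Ob C \<Longrightarrow> Cod C (Runit C X) = X"
  "\<lbrakk>X \<in> Ob C; Y \<in> Ob C; Z \<in> Ob C\<rbrakk> \<Longrightarrow> Assoc C X Y Z \<in> Arr C"
  "\<lbrakk>X \<in> Ob C; Y \<in> Ob C; Z \<in> Ob C\<rbrakk> \<Longrightarrow> Dom C (Assoc C X Y Z) = (X \<otimes>\<^sub>o Y) \<otimes>\<^sub>o Z"
  "\<lbrakk>X \<in> Ob C; Y \<in> Ob C; Z \<in> Ob C\<rbrakk> \<Longrightarrow> Cod C (Assoc C X Y Z) = X \<otimes>\<^sub>o (Y \<otimes>\<^sub>o Z)"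
  using lunit_hom[of X] runit_hom[of X] assoc_hom[of X Y Z] by auto

lemmas [simp] = lunit_iso runit_iso assoc_iso

lemma constraint_inv [simp]:
  assumes "X \<in> Ob C"
  shows "Linv X \<in> Arr C" "Dom C (Linv X) = X" "Cod C (Linv X) = I \<otimes>\<^sub>o X"
    "Rinv X \<in> Arr C" "Dom C (Rinv X) = X" "Cod C (Rinv X) = X \<otimes>\<^sub>o I"
    "Lunit C X \<cdot> Linv X = \<one>\<^sub>m X" "Linv X \<cdot> Lunit C X = \<one>\<^sub>m (I \<otimes>\<^sub>o X)"
    "Runit C X \<cdot> Rinv X = \<one>\<^sub>m X" "Rinv X \<cdot> Runit C X = \<one>\<^sub>m (X \<otimes>\<^sub>o I)"
  using assms arr_inv_simps[of "Lunit C X"] arr_inv_simps[of "Runit C X"] by auto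

lemma assoc_inv [simp]:
  assumes "X \<in> Ob C" "Y \<in> Ob C" "Z \<in> Ob C"
  shows "Ainv X Y Z \<in> Arr C" "Dom C (Ainv X Y Z) = X \<otimes>\<^sub>o (Y \<otimes>\<^sub>o Z)"
    "Cod C (Ainv X Y Z) = (X \<otimes>\<^sub>o Y) \<otimes>\<^sub>o Z"
    "Assoc C X Y Z \<cdot> Ainv X Y Z = \<one>\<^sub>m (X \<otimes>\<^sub>o (Y \<otimes>\<^sub>o Z))"
    "Ainv X Y Z \<cdot> Assoc C X Y Z = \<one>\<^sub>m ((X \<otimes>\<^sub>o Y) \<otimes>\<^sub>o Z)"
  using assms arr_inv_simps[of "Assoc C X Y Z"] by auto

lemma constraint_inv_cancel [simp]:
  assumes "f \<in> Arr C" "X \<in> Ob C"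
  shows "Cod C f = X \<Longrightarrow> Lunit C X \<cdot> Linv X \<cdot> f = f"
    "Cod C f = I \<otimes>\<^sub>o X \<Longrightarrow> Linv X \<cdot> Lunit C X \<cdot> f = f"
    "Cod C f = X \<Longrightarrow> Runit C X \<cdot> Rinv X \<cdot> f = f"
    "Cod C f = X \<otimes>\<^sub>o I \<Longrightarrow> Rinv X \<cdot> Runit C X \<cdot> f = f"
  using assms
  by (simp_all add: comp_extend1[OF constraint_inv(7)] comp_extend1[OF constraint_inv(8)]
      comp_extend1[OF constraint_inv(9)] comp_extend1[OF constraint_inv(10)])

lemma assoc_inv_cancel [simp]:
  assumes "f \<in> Arr C" "X \<in> Ob C" "Y \<in> Ob C" "Z \<in> Ob C"
  shows "Cod C f = X \<otimes>\<^sub>o (Y \<otimes>\<^sub>o Z) \<Longrightarrow> Assoc C X Y Z \<cdot> Ainv X Y Z \<cdot> f = f"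
    "Cod C f = (X \<otimes>\<^sub>o Y) \<otimes>\<^sub>o Z \<Longrightarrow> Ainv X Y Z \<cdot> Assoc C X Y Z \<cdot> f = f"
  using assms by (simp_all add: comp_extend1[OF assoc_inv(4)] comp_extend1[OF assoc_inv(5)])

text \<open>The codomains are variables tied down by premises, so the rule matches an associator
  whose indices are not syntactically of the form \<open>Cod C f\<close>. It is kept out of the
  simpset: fusing hides the triple tensor, and proofs exhibit it where the rule should act.\<close>

lemma assoc_nat:
  assumes "f \<in> Arr C" "g \<in> Arr C" "h \<in> Arr C" "Cod C f = X" "Cod C g = Y" "Cod C h = Z"
  shows "Assoc C X Y Z \<cdot> ((f \<otimes>\<^sub>m g) \<otimes>\<^sub>m h) =
      (f \<otimes>\<^sub>m (g \<otimes>\<^sub>m h)) \<cdot> Assoc C (Dom C f) (Dom C g) (Dom C h)"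
  using assoc_natural[of f "Dom C f" X g "Dom C g" Y h "Dom C h" Z] assms by auto

lemma assoc_nat':
  assumes "f \<in> Arr C" "g \<in> Arr C" "h \<in> Arr C" "Cod C f = X" "Cod C g = Y" "Cod C h = Z"
    "k \<in> Arr C" "Cod C k = (Dom C f \<otimes>\<^sub>o Dom C g) \<otimes>\<^sub>o Dom C h"
  shows "Assoc C X Y Z \<cdot> ((f \<otimes>\<^sub>m g) \<otimes>\<^sub>m h) \<cdot> k =
      (f \<otimes>\<^sub>m (g \<otimes>\<^sub>m h)) \<cdot> Assoc C (Dom C f) (Dom C g) (Dom C h) \<cdot> k"
  by (rule comp_extend[OF assoc_nat]) (use assms in auto)

lemma assoc_inv_nat:
  assumes "f \<in> Arr C" "g \<in> Arr C" "h \<in> Arr C" "Cod C f = X" "Cod C g = Y" "Cod C h = Z"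
  shows "Ainv X Y Z \<cdot> (f \<otimes>\<^sub>m (g \<otimes>\<^sub>m h)) =
      ((f \<otimes>\<^sub>m g) \<otimes>\<^sub>m h) \<cdot> Ainv (Dom C f) (Dom C g) (Dom C h)"
proof -
  have [simp]: "X \<in> Ob C" "Y \<in> Ob C" "Z \<in> Ob C" using assms by auto
  show ?thesis
    by (rule iso_cancel_left[of "Assoc C X Y Z"]) (use assms in \<open>auto simp: assoc_nat'\<close>)
qed

lemma assoc_inv_nat':
  assumes "f \<in> Arr C" "g \<in> Arr C" "h \<in> Arr C" "Cod C f = X" "Cod C g = Y" "Cod C h = Z"
    "k \<in> Arr C" "Cod C k = Dom C f \<otimes>\<^sub>o (Dom C g \<otimes>\<^sub>o Dom C h)"
  shows "Ainv X Y Z \<cdot> (f \<otimes>\<^sub>m (g \<otimes>\<^sub>m h)) \<cdot> k =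
      ((f \<otimes>\<^sub>m g) \<otimes>\<^sub>m h) \<cdot> Ainv (Dom C f) (Dom C g) (Dom C h) \<cdot> k"
  by (rule comp_extend[OF assoc_inv_nat]) (use assms in auto)

lemma lunit_nat: "f \<in> Arr C \<Longrightarrow> Cod C f = X \<Longrightarrow> Lunit C X \<cdot> (\<one>\<^sub>m I \<otimes>\<^sub>m f) = f \<cdot> Lunit C (Dom C f)"
  using lunit_natural[of f] by simp

lemma runit_nat: "f \<in> Arr C \<Longrightarrow> Cod C f = X \<Longrightarrow> Runit C X \<cdot> (f \<otimes>\<^sub>m \<one>\<^sub>m I) = f \<cdot> Runit C (Dom C f)"
  using runit_natural[of f] by simp

lemma lunit_nat':
  assumes "f \<in> Arr C" "Cod C f = X" "k \<in> Arr C" "Cod C k = I \<otimes>\<^sub>o Dom C f"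
  shows "Lunit C X \<cdot> (\<one>\<^sub>m I \<otimes>\<^sub>m f) \<cdot> k = f \<cdot> Lunit C (Dom C f) \<cdot> k"
  by (rule comp_extend[OF lunit_nat]) (use assms in auto)

lemma lunit_inv_nat:
  assumes "f \<in> Arr C" "Cod C f = X"
  shows "Linv X \<cdot> f = (\<one>\<^sub>m I \<otimes>\<^sub>m f) \<cdot> Linv (Dom C f)"
proof -
  have [simp]: "X \<in> Ob C" using assms by auto
  show ?thesis
    by (rule iso_cancel_left[of "Lunit C X"]) (use assms in \<open>auto simp: lunit_nat'\<close>)
qed

lemma runit_nat':
  assumes "f \<in> Arr C" "Cod C f = X" "k \<in> Arr C" "Cod C k = Dom C f \<otimes>\<^sub>o I"
  shows "Runit C X \<cdot> (f \<otimes>\<^sub>m \<one>\<^sub>m I) \<cdot> k = f \<cdot> Runit C (Dom C f) \<cdot> k"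
  by (rule comp_extend[OF runit_nat]) (use assms in auto)

lemma runit_inv_nat:
  assumes "f \<in> Arr C" "Cod C f = X"
  shows "Rinv X \<cdot> f = (f \<otimes>\<^sub>m \<one>\<^sub>m I) \<cdot> Rinv (Dom C f)"
proof -
  have [simp]: "X \<in> Ob C" using assms by auto
  show ?thesis
    by (rule iso_cancel_left[of "Runit C X"]) (use assms in \<open>auto simp: runit_nat'\<close>)
qed

text \<open>Tensoring with \<open>I\<close> is naturally isomorphic to the identity functor, hence
  faithful. Kelly's arguments rest on this: an equation may be tensored with \<open>I\<close> to
  make room for the pentagon and the triangle.\<close>

lemma unit_tens_faithful:
  assumes "f \<in> Arr C" "g \<in> Arr C" "Dom C f = Dom C g" "Cod C f = Cod C g"
  shows "\<one>\<^sub>m I \<otimes>\<^sub>m f = \<one>\<^sub>m I \<otimes>\<^sub>m g \<Longrightarrow> f = g" "f \<otimes>\<^sub>m \<one>\<^sub>m I = g \<otimes>\<^sub>m \<one>\<^sub>m I \<Longrightarrow> f = g"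
proof -
  show "f = g" if "\<one>\<^sub>m I \<otimes>\<^sub>m f = \<one>\<^sub>m I \<otimes>\<^sub>m g"
  proof (rule iso_cancel_right[of _ "Lunit C (Dom C g)"])
    show "f \<cdot> Lunit C (Dom C g) = g \<cdot> Lunit C (Dom C g)"
      using that lunit_nat[of f] lunit_nat[of g] assms by metis
  qed (use assms in simp_all)
  show "f = g" if "f \<otimes>\<^sub>m \<one>\<^sub>m I = g \<otimes>\<^sub>m \<one>\<^sub>m I"
  proof (rule iso_cancel_right[of _ "Runit C (Dom C g)"])
    show "f \<cdot> Runit C (Dom C g) = g \<cdot> Runit C (Dom C g)"
      using that runit_nat[of f] runit_nat[of g] assms by metis
  qed (use assms in simp_all)
qed

lemma iso_tens:
  assumes "is_iso C f" "X \<in> Ob C"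
  shows "is_iso C (f \<otimes>\<^sub>m \<one>\<^sub>m X)" "is_iso C (\<one>\<^sub>m X \<otimes>\<^sub>m f)"
proof -
  note [simp] = arr_inv_simps[OF assms(1)] is_inverseD(1)[OF arr_inv_is_inverse[OF assms(1)]]
  have "is_inverse C (f \<otimes>\<^sub>m \<one>\<^sub>m X) (arr_inv C f \<otimes>\<^sub>m \<one>\<^sub>m X)"
    "is_inverse C (\<one>\<^sub>m X \<otimes>\<^sub>m f) (\<one>\<^sub>m X \<otimes>\<^sub>m arr_inv C f)"
    using assms(2) by (simp_all add: is_inverse_def)
  then show "is_iso C (f \<otimes>\<^sub>m \<one>\<^sub>m X)" "is_iso C (\<one>\<^sub>m X \<otimes>\<^sub>m f)" unfolding is_iso_def by blast+
qed

end

section \<open>Coherence for unit constraints\<close>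

context monoidal_category
begin

text \<open>Kelly's argument. With a spare factor \<open>I\<close> on the left, the pentagon and two
  instances of the triangle carry one side into the other, up to the isomorphism
  \<open>?u \<cdot> ?v\<close>, which is cancelled.\<close>

lemma lunit_tens:
  assumes [simp]: "X \<in> Ob C" "Y \<in> Ob C"
  shows "Lunit C (X \<otimes>\<^sub>o Y) \<cdot> Assoc C I X Y = Lunit C X \<otimes>\<^sub>m \<one>\<^sub>m Y"
proof (rule unit_tens_faithful(1))
  let ?u = "Assoc C I (I \<otimes>\<^sub>o X) Y" and ?v = "Assoc C I I X \<otimes>\<^sub>m \<one>\<^sub>m Y"
  have "(\<one>\<^sub>m I \<otimes>\<^sub>m (Lunit C (X \<otimes>\<^sub>o Y) \<cdot> Assoc C I X Y)) \<cdot> ?u \<cdot> ?v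
      = (\<one>\<^sub>m I \<otimes>\<^sub>m Lunit C (X \<otimes>\<^sub>o Y)) \<cdot> Assoc C I I (X \<otimes>\<^sub>o Y) \<cdot> Assoc C (I \<otimes>\<^sub>o I) X Y"
    using pentagon[of I I X Y] by simp
  also have "\<dots> = (Runit C I \<otimes>\<^sub>m \<one>\<^sub>m (X \<otimes>\<^sub>o Y)) \<cdot> Assoc C (I \<otimes>\<^sub>o I) X Y"
    by (rule comp_extend1[OF triangle]) simp_all
  also have "\<dots> = Assoc C I X Y \<cdot> ((Runit C I \<otimes>\<^sub>m \<one>\<^sub>m X) \<otimes>\<^sub>m \<one>\<^sub>m Y)"
    using assoc_nat[of "Runit C I" "\<one>\<^sub>m X" "\<one>\<^sub>m Y"] by simp
  also have "(Runit C I \<otimes>\<^sub>m \<one>\<^sub>m X) \<otimes>\<^sub>m \<one>\<^sub>m Y = ((\<one>\<^sub>m I \<otimes>\<^sub>m Lunit C X) \<otimes>\<^sub>m \<one>\<^sub>m Y) \<cdot> ?v"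
    by (simp add: triangle)
  also have "Assoc C I X Y \<cdot> \<dots> = (\<one>\<^sub>m I \<otimes>\<^sub>m (Lunit C X \<otimes>\<^sub>m \<one>\<^sub>m Y)) \<cdot> ?u \<cdot> ?v"
    by (subst assoc_nat') simp_all
  finally show "\<one>\<^sub>m I \<otimes>\<^sub>m (Lunit C (X \<otimes>\<^sub>o Y) \<cdot> Assoc C I X Y)
      = \<one>\<^sub>m I \<otimes>\<^sub>m (Lunit C X \<otimes>\<^sub>m \<one>\<^sub>m Y)"
    by (rule iso_cancel_right) (simp_all add: iso_comp iso_tens)
qed simp_all

text \<open>The mirror image of \<open>lunit_tens\<close>, with the spare factor \<open>I\<close> on
  the right.\<close>

lemma runit_tens:
  assumes [simp]: "X \<in> Ob C" "Y \<in> Ob C"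
  shows "(\<one>\<^sub>m X \<otimes>\<^sub>m Runit C Y) \<cdot> Assoc C X Y I = Runit C (X \<otimes>\<^sub>o Y)"
proof (rule unit_tens_faithful(2), goal_cases)
  case 5
  let ?v = "Assoc C X Y I \<otimes>\<^sub>m \<one>\<^sub>m I"
  have "Assoc C X Y I \<cdot> (Runit C (X \<otimes>\<^sub>o Y) \<otimes>\<^sub>m \<one>\<^sub>m I)
      = Assoc C X Y I \<cdot> ((\<one>\<^sub>m X \<otimes>\<^sub>m \<one>\<^sub>m Y) \<otimes>\<^sub>m Lunit C I) \<cdot> Assoc C (X \<otimes>\<^sub>o Y) I I"
    by (simp add: triangle)
  also have "\<dots> = (\<one>\<^sub>m X \<otimes>\<^sub>m (\<one>\<^sub>m Y \<otimes>\<^sub>m Lunit C I)) \<cdot> Assoc C X Y (I \<otimes>\<^sub>o I) \<cdot> Assoc C (X \<otimes>\<^sub>o Y) I I"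
    by (subst assoc_nat') simp_all
  also have "\<dots> = (\<one>\<^sub>m X \<otimes>\<^sub>m ((\<one>\<^sub>m Y \<otimes>\<^sub>m Lunit C I) \<cdot> Assoc C Y I I)) \<cdot> Assoc C X (Y \<otimes>\<^sub>o I) I \<cdot> ?v"
    using pentagon[of X Y I I] by simp
  also have "\<dots> = (\<one>\<^sub>m X \<otimes>\<^sub>m (Runit C Y \<otimes>\<^sub>m \<one>\<^sub>m I)) \<cdot> Assoc C X (Y \<otimes>\<^sub>o I) I \<cdot> ?v"
    by (simp add: triangle)
  also have "\<dots> = Assoc C X Y I \<cdot> ((\<one>\<^sub>m X \<otimes>\<^sub>m Runit C Y) \<otimes>\<^sub>m \<one>\<^sub>m I) \<cdot> ?v"
    by (subst assoc_nat') simp_all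
  also have "\<dots> = Assoc C X Y I \<cdot> (((\<one>\<^sub>m X \<otimes>\<^sub>m Runit C Y) \<cdot> Assoc C X Y I) \<otimes>\<^sub>m \<one>\<^sub>m I)"
    by simp
  finally show ?case
    by (rule iso_cancel_left[symmetric]) simp_all
qed simp_all

text \<open>Naturality of the left unit constraint at its own component at \<open>I\<close> gives
  \<open>Lunit C (I \<otimes>\<^sub>o I) = \<one>\<^sub>m I \<otimes>\<^sub>m Lunit C I\<close>.
  With this, \<open>lunit_tens\<close> and the triangle have the same left side, and their right
  sides are the two constraints tensored with \<open>I\<close>.\<close>

lemma lunit_eq_runit: "Lunit C I = Runit C I"
proof (rule unit_tens_faithful(2), goal_cases)
  case 5
  have "Lunit C (I \<otimes>\<^sub>o I) = \<one>\<^sub>m I \<otimes>\<^sub>m Lunit C I"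
    using lunit_nat[of "Lunit C I" I] by - (rule iso_cancel_left[of "Lunit C I"], simp_all)
  then show ?case
    using lunit_tens[of I I] triangle[of I I] by simp
qed simp_all

text \<open>This and the next two lemmas are the unit coherences solved for inverse constraints, the
  form in which a freshly inserted unit meets an associator.\<close>

lemma assoc_lunit_inv:
  assumes [simp]: "X \<in> Ob C" "Y \<in> Ob C"
  shows "Assoc C I X Y \<cdot> (Linv X \<otimes>\<^sub>m \<one>\<^sub>m Y) = Linv (X \<otimes>\<^sub>o Y)"
proof (rule iso_cancel_left[of "Lunit C (X \<otimes>\<^sub>o Y)"], goal_cases)
  case 1
  show ?case
    using comp_extend1[OF lunit_tens, of X Y "Linv X \<otimes>\<^sub>m \<one>\<^sub>m Y"] by simp
qed simp_all

lemma assoc_runit_inv: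
  assumes [simp]: "X \<in> Ob C" "Y \<in> Ob C"
  shows "Assoc C X Y I \<cdot> Rinv (X \<otimes>\<^sub>o Y) = \<one>\<^sub>m X \<otimes>\<^sub>m Rinv Y"
proof (rule iso_cancel_left[of "\<one>\<^sub>m X \<otimes>\<^sub>m Runit C Y"], goal_cases)
  case 1
  show ?case
    using comp_extend1[OF runit_tens, of X Y "Rinv (X \<otimes>\<^sub>o Y)"] by simp
qed (simp_all add: iso_tens)

lemma assoc_triangle_inv:
  assumes [simp]: "X \<in> Ob C" "Y \<in> Ob C"
  shows "Assoc C X I Y \<cdot> (Rinv X \<otimes>\<^sub>m \<one>\<^sub>m Y) = \<one>\<^sub>m X \<otimes>\<^sub>m Linv Y"
proof (rule iso_cancel_left[of "\<one>\<^sub>m X \<otimes>\<^sub>m Lunit C Y"], goal_cases)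
  case 1
  show ?case
    using comp_extend1[OF triangle[of X Y], of "Rinv X \<otimes>\<^sub>m \<one>\<^sub>m Y"] by simp
qed (simp_all add: iso_tens)

text \<open>This is the pentagon of the opposite category, whose associators are the inverse
  ones.\<close>

lemma pentagon_inv:
  assumes [simp]: "W \<in> Ob C" "X \<in> Ob C" "Y \<in> Ob C" "Z \<in> Ob C"
  shows "Ainv (W \<otimes>\<^sub>o X) Y Z \<cdot> Ainv W X (Y \<otimes>\<^sub>o Z) =
      (Ainv W X Y \<otimes>\<^sub>m \<one>\<^sub>m Z) \<cdot> Ainv W (X \<otimes>\<^sub>o Y) Z \<cdot> (\<one>\<^sub>m W \<otimes>\<^sub>m Ainv X Y Z)"
proof (rule iso_cancel_left[of "Assoc C (W \<otimes>\<^sub>o X) Y Z"], goal_cases)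
  case 1
  show ?case
  proof (rule iso_cancel_left[of "Assoc C W X (Y \<otimes>\<^sub>o Z)"], goal_cases)
    case 1
    show ?case
      using comp_extend1[OF pentagon[of W X Y Z],
          of "(Ainv W X Y \<otimes>\<^sub>m \<one>\<^sub>m Z) \<cdot> Ainv W (X \<otimes>\<^sub>o Y) Z \<cdot> (\<one>\<^sub>m W \<otimes>\<^sub>m Ainv X Y Z)"]
      by simp
  qed simp_all
qed simp_all

section \<open>Inserting a unit next to an object\<close>

lemma lui_arr [simp]:
  assumes "\<eta> \<in> Arr C" "Dom C \<eta> = I" "X \<in> Ob C"
  shows "left_unit_insert C X \<eta> \<in> Arr C" "Dom C (left_unit_insert C X \<eta>) = X"
    "Cod C (left_unit_insert C X \<eta>) = Cod C \<eta> \<otimes>\<^sub>o X"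
    "right_unit_insert C X \<eta> \<in> Arr C" "Dom C (right_unit_insert C X \<eta>) = X"
    "Cod C (right_unit_insert C X \<eta>) = X \<otimes>\<^sub>o Cod C \<eta>"
  using assms by (simp_all add: left_unit_insert_def right_unit_insert_def)

lemma lui_nat:
  assumes "\<eta> \<in> Arr C" "Dom C \<eta> = I" "f \<in> Arr C" "Cod C f = X"
  shows "left_unit_insert C X \<eta> \<cdot> f = (\<one>\<^sub>m (Cod C \<eta>) \<otimes>\<^sub>m f) \<cdot> left_unit_insert C (Dom C f) \<eta>"
    "right_unit_insert C X \<eta> \<cdot> f = (f \<otimes>\<^sub>m \<one>\<^sub>m (Cod C \<eta>)) \<cdot> right_unit_insert C (Dom C f) \<eta>"
proof -
  have [simp]: "X \<in> Ob C" using assms by auto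
  show "left_unit_insert C X \<eta> \<cdot> f = (\<one>\<^sub>m (Cod C \<eta>) \<otimes>\<^sub>m f) \<cdot> left_unit_insert C (Dom C f) \<eta>"
    "right_unit_insert C X \<eta> \<cdot> f = (f \<otimes>\<^sub>m \<one>\<^sub>m (Cod C \<eta>)) \<cdot> right_unit_insert C (Dom C f) \<eta>"
    using assms
    by (simp_all add: left_unit_insert_def right_unit_insert_def lunit_inv_nat runit_inv_nat)
qed

lemma lui_nat':
  assumes "\<eta> \<in> Arr C" "Dom C \<eta> = I" "f \<in> Arr C" "Cod C f = X" "k \<in> Arr C" "Cod C k = Dom C f"
  shows "left_unit_insert C X \<eta> \<cdot> f \<cdot> k = (\<one>\<^sub>m (Cod C \<eta>) \<otimes>\<^sub>m f) \<cdot> left_unit_insert C (Dom C f) \<eta> \<cdot> k"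
    "right_unit_insert C X \<eta> \<cdot> f \<cdot> k = (f \<otimes>\<^sub>m \<one>\<^sub>m (Cod C \<eta>)) \<cdot> right_unit_insert C (Dom C f) \<eta> \<cdot> k"
  by (rule comp_extend[OF lui_nat(1)], use assms in auto)
     (rule comp_extend[OF lui_nat(2)], use assms in auto)

text \<open>The new factor may stand to the left of \<open>X\<close> and \<open>Y\<close>, between
  them, or to their right. The three cases reduce, in this order, to \<open>lunit_tens\<close>, the
  triangle and \<open>runit_tens\<close> in inverse form.\<close>

lemma assoc_lui:
  assumes "\<eta> \<in> Arr C" "Dom C \<eta> = I" "Cod C \<eta> = H" and [simp]: "X \<in> Ob C" "Y \<in> Ob C"
  shows "Assoc C H X Y \<cdot> (left_unit_insert C X \<eta> \<otimes>\<^sub>m \<one>\<^sub>m Y) = left_unit_insert C (X \<otimes>\<^sub>o Y) \<eta>"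
    "Assoc C X H Y \<cdot> (right_unit_insert C X \<eta> \<otimes>\<^sub>m \<one>\<^sub>m Y) = \<one>\<^sub>m X \<otimes>\<^sub>m left_unit_insert C Y \<eta>"
    "Assoc C X Y H \<cdot> right_unit_insert C (X \<otimes>\<^sub>o Y) \<eta> = \<one>\<^sub>m X \<otimes>\<^sub>m right_unit_insert C Y \<eta>"
proof -
  note [simp] = assms(1,2)
  have [simp]: "H \<in> Ob C" using assms by auto
  have "Assoc C H X Y \<cdot> (left_unit_insert C X \<eta> \<otimes>\<^sub>m \<one>\<^sub>m Y)
      = Assoc C H X Y \<cdot> ((\<eta> \<otimes>\<^sub>m \<one>\<^sub>m X) \<otimes>\<^sub>m \<one>\<^sub>m Y) \<cdot> (Linv X \<otimes>\<^sub>m \<one>\<^sub>m Y)"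
    by (simp add: left_unit_insert_def)
  also have "\<dots> = (\<eta> \<otimes>\<^sub>m (\<one>\<^sub>m X \<otimes>\<^sub>m \<one>\<^sub>m Y)) \<cdot> Assoc C I X Y \<cdot> (Linv X \<otimes>\<^sub>m \<one>\<^sub>m Y)"
    by (subst assoc_nat') (simp_all add: assms)
  finally show "Assoc C H X Y \<cdot> (left_unit_insert C X \<eta> \<otimes>\<^sub>m \<one>\<^sub>m Y) = left_unit_insert C (X \<otimes>\<^sub>o Y) \<eta>"
    by (simp add: assoc_lunit_inv left_unit_insert_def)
  have "Assoc C X H Y \<cdot> (right_unit_insert C X \<eta> \<otimes>\<^sub>m \<one>\<^sub>m Y)
      = Assoc C X H Y \<cdot> ((\<one>\<^sub>m X \<otimes>\<^sub>m \<eta>) \<otimes>\<^sub>m \<one>\<^sub>m Y) \<cdot> (Rinv X \<otimes>\<^sub>m \<one>\<^sub>m Y)"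
    by (simp add: right_unit_insert_def)
  also have "\<dots> = (\<one>\<^sub>m X \<otimes>\<^sub>m (\<eta> \<otimes>\<^sub>m \<one>\<^sub>m Y)) \<cdot> Assoc C X I Y \<cdot> (Rinv X \<otimes>\<^sub>m \<one>\<^sub>m Y)"
    by (subst assoc_nat') (simp_all add: assms)
  finally show "Assoc C X H Y \<cdot> (right_unit_insert C X \<eta> \<otimes>\<^sub>m \<one>\<^sub>m Y) = \<one>\<^sub>m X \<otimes>\<^sub>m left_unit_insert C Y \<eta>"
    by (simp add: assoc_triangle_inv left_unit_insert_def)
  have "Assoc C X Y H \<cdot> right_unit_insert C (X \<otimes>\<^sub>o Y) \<eta>
      = Assoc C X Y H \<cdot> ((\<one>\<^sub>m X \<otimes>\<^sub>m \<one>\<^sub>m Y) \<otimes>\<^sub>m \<eta>) \<cdot> Rinv (X \<otimes>\<^sub>o Y)"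
    by (simp add: right_unit_insert_def)
  also have "\<dots> = (\<one>\<^sub>m X \<otimes>\<^sub>m (\<one>\<^sub>m Y \<otimes>\<^sub>m \<eta>)) \<cdot> Assoc C X Y I \<cdot> Rinv (X \<otimes>\<^sub>o Y)"
    by (subst assoc_nat') (simp_all add: assms)
  finally show "Assoc C X Y H \<cdot> right_unit_insert C (X \<otimes>\<^sub>o Y) \<eta> = \<one>\<^sub>m X \<otimes>\<^sub>m right_unit_insert C Y \<eta>"
    by (simp add: assoc_runit_inv right_unit_insert_def)
qed

lemma assoc_lui':
  assumes "\<eta> \<in> Arr C" "Dom C \<eta> = I" "Cod C \<eta> = H" "X \<in> Ob C" "Y \<in> Ob C"
    "k \<in> Arr C" "Cod C k = X \<otimes>\<^sub>o Y"
  shows "Assoc C H X Y \<cdot> (left_unit_insert C X \<eta> \<otimes>\<^sub>m \<one>\<^sub>m Y) \<cdot> k = left_unit_insert C (X \<otimes>\<^sub>o Y) \<eta> \<cdot> k"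
    "Assoc C X H Y \<cdot> (right_unit_insert C X \<eta> \<otimes>\<^sub>m \<one>\<^sub>m Y) \<cdot> k = (\<one>\<^sub>m X \<otimes>\<^sub>m left_unit_insert C Y \<eta>) \<cdot> k"
    "Assoc C X Y H \<cdot> right_unit_insert C (X \<otimes>\<^sub>o Y) \<eta> \<cdot> k = (\<one>\<^sub>m X \<otimes>\<^sub>m right_unit_insert C Y \<eta>) \<cdot> k"
proof -
  have [simp]: "H \<in> Ob C" using assms by auto
  show "Assoc C H X Y \<cdot> (left_unit_insert C X \<eta> \<otimes>\<^sub>m \<one>\<^sub>m Y) \<cdot> k = left_unit_insert C (X \<otimes>\<^sub>o Y) \<eta> \<cdot> k"
    by (rule comp_extend1[OF assoc_lui(1)]) (simp_all add: assms)
  show "Assoc C X H Y \<cdot> (right_unit_insert C X \<eta> \<otimes>\<^sub>m \<one>\<^sub>m Y) \<cdot> k = (\<one>\<^sub>m X \<otimes>\<^sub>m left_unit_insert C Y \<eta>) \<cdot> k"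
    by (rule comp_extend1[OF assoc_lui(2)]) (simp_all add: assms)
  show "Assoc C X Y H \<cdot> right_unit_insert C (X \<otimes>\<^sub>o Y) \<eta> \<cdot> k = (\<one>\<^sub>m X \<otimes>\<^sub>m right_unit_insert C Y \<eta>) \<cdot> k"
    by (rule comp_extend1[OF assoc_lui(3)]) (simp_all add: assms)
qed

lemma assoc_inv_lui:
  assumes "\<eta> \<in> Arr C" "Dom C \<eta> = I" "Cod C \<eta> = H" "X \<in> Ob C" "Y \<in> Ob C"
  shows "Ainv H X Y \<cdot> left_unit_insert C (X \<otimes>\<^sub>o Y) \<eta> = left_unit_insert C X \<eta> \<otimes>\<^sub>m \<one>\<^sub>m Y"
    "Ainv X H Y \<cdot> (\<one>\<^sub>m X \<otimes>\<^sub>m left_unit_insert C Y \<eta>) = right_unit_insert C X \<eta> \<otimes>\<^sub>m \<one>\<^sub>m Y"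
    "Ainv X Y H \<cdot> (\<one>\<^sub>m X \<otimes>\<^sub>m right_unit_insert C Y \<eta>) = right_unit_insert C (X \<otimes>\<^sub>o Y) \<eta>"
proof -
  have [simp]: "H \<in> Ob C" using assms by auto
  show "Ainv H X Y \<cdot> left_unit_insert C (X \<otimes>\<^sub>o Y) \<eta> = left_unit_insert C X \<eta> \<otimes>\<^sub>m \<one>\<^sub>m Y"
    unfolding assoc_lui(1)[OF assms, symmetric] by (simp add: assms)
  show "Ainv X H Y \<cdot> (\<one>\<^sub>m X \<otimes>\<^sub>m left_unit_insert C Y \<eta>) = right_unit_insert C X \<eta> \<otimes>\<^sub>m \<one>\<^sub>m Y"
    unfolding assoc_lui(2)[OF assms, symmetric] by (simp add: assms)
  show "Ainv X Y H \<cdot> (\<one>\<^sub>m X \<otimes>\<^sub>m right_unit_insert C Y \<eta>) = right_unit_insert C (X \<otimes>\<^sub>o Y) \<eta>"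
    unfolding assoc_lui(3)[OF assms, symmetric] by (simp add: assms)
qed

lemma assoc_inv_lui':
  assumes "\<eta> \<in> Arr C" "Dom C \<eta> = I" "Cod C \<eta> = H" "X \<in> Ob C" "Y \<in> Ob C"
    "k \<in> Arr C" "Cod C k = X \<otimes>\<^sub>o Y"
  shows "Ainv H X Y \<cdot> left_unit_insert C (X \<otimes>\<^sub>o Y) \<eta> \<cdot> k = (left_unit_insert C X \<eta> \<otimes>\<^sub>m \<one>\<^sub>m Y) \<cdot> k"
    "Ainv X H Y \<cdot> (\<one>\<^sub>m X \<otimes>\<^sub>m left_unit_insert C Y \<eta>) \<cdot> k = (right_unit_insert C X \<eta> \<otimes>\<^sub>m \<one>\<^sub>m Y) \<cdot> k"
    "Ainv X Y H \<cdot> (\<one>\<^sub>m X \<otimes>\<^sub>m right_unit_insert C Y \<eta>) \<cdot> k = right_unit_insert C (X \<otimes>\<^sub>o Y) \<eta> \<cdot> k"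
proof -
  have [simp]: "H \<in> Ob C" using assms by auto
  show "Ainv H X Y \<cdot> left_unit_insert C (X \<otimes>\<^sub>o Y) \<eta> \<cdot> k = (left_unit_insert C X \<eta> \<otimes>\<^sub>m \<one>\<^sub>m Y) \<cdot> k"
    by (rule comp_extend1[OF assoc_inv_lui(1)]) (simp_all add: assms)
  show "Ainv X H Y \<cdot> (\<one>\<^sub>m X \<otimes>\<^sub>m left_unit_insert C Y \<eta>) \<cdot> k = (right_unit_insert C X \<eta> \<otimes>\<^sub>m \<one>\<^sub>m Y) \<cdot> k"
    by (rule comp_extend1[OF assoc_inv_lui(2)]) (simp_all add: assms)
  show "Ainv X Y H \<cdot> (\<one>\<^sub>m X \<otimes>\<^sub>m right_unit_insert C Y \<eta>) \<cdot> k = right_unit_insert C (X \<otimes>\<^sub>o Y) \<eta> \<cdot> k"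
    by (rule comp_extend1[OF assoc_inv_lui(3)]) (simp_all add: assms)
qed

text \<open>The orientation opposite to \<open>lui_nat\<close>: the insertion moves to the left and
  is performed last.\<close>

lemma tens_lui:
  assumes "\<eta> \<in> Arr C" "Dom C \<eta> = I" "f \<in> Arr C" "Cod C \<eta> = H" "Dom C f = X"
  shows "(\<one>\<^sub>m H \<otimes>\<^sub>m f) \<cdot> left_unit_insert C X \<eta> = left_unit_insert C (Cod C f) \<eta> \<cdot> f"
    "(f \<otimes>\<^sub>m \<one>\<^sub>m H) \<cdot> right_unit_insert C X \<eta> = right_unit_insert C (Cod C f) \<eta> \<cdot> f"
  using lui_nat[of \<eta> f "Cod C f"] assms by simp_all

lemma tens_lui':
  assumes "\<eta> \<in> Arr C" "Dom C \<eta> = I" "f \<in> Arr C" "Cod C \<eta> = H" "Dom C f = X" "k \<in> Arr C" "Cod C k = X"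
  shows "(\<one>\<^sub>m H \<otimes>\<^sub>m f) \<cdot> left_unit_insert C X \<eta> \<cdot> k = left_unit_insert C (Cod C f) \<eta> \<cdot> f \<cdot> k"
    "(f \<otimes>\<^sub>m \<one>\<^sub>m H) \<cdot> right_unit_insert C X \<eta> \<cdot> k = right_unit_insert C (Cod C f) \<eta> \<cdot> f \<cdot> k"
  using lui_nat'[of \<eta> f "Cod C f"] assms by simp_all

end

section \<open>Equalizers and additivity\<close>

context category
begin

lemma is_equalizerD:
  assumes "is_equalizer C E e f g"
  shows "e \<in> Arr C" "Dom C e = E" "E \<in> Ob C" "f \<in> Arr C" "Dom C f = Cod C e"
    "g \<in> Arr C" "Dom C g = Cod C e" "Cod C g = Cod C f" "f \<cdot> e = g \<cdot> e"
  using assms unfolding is_equalizer_def in_Hom_iff by auto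

lemma equalizer_universal:
  assumes "is_equalizer C E e f g" "h \<in> Arr C" "Cod C h = Cod C e" "f \<cdot> h = g \<cdot> h"
  shows "\<exists>!k. k \<in> Hom C (Dom C h) E \<and> e \<cdot> k = h"
proof -
  obtain X where X: "e \<in> Hom C E X" and univ: "\<forall>Z\<in>Ob C. \<forall>h\<in>Hom C Z X. f \<cdot> h = g \<cdot> h \<longrightarrow>
      (\<exists>!k. k \<in> Hom C Z E \<and> e \<cdot> k = h)"
    using assms(1) unfolding is_equalizer_def by blast
  have "Dom C h \<in> Ob C" "h \<in> Hom C (Dom C h) X" using assms X by auto
  then show ?thesis using univ assms(4) by blast
qed

lemma equalizer_mono:
  assumes "is_equalizer C E e f g" "h \<in> Hom C Z E" "k \<in> Hom C Z E" "e \<cdot> h = e \<cdot> k"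
  shows "h = k"
proof -
  note e = is_equalizerD[OF assms(1)]
  have "f \<cdot> e \<cdot> h = g \<cdot> e \<cdot> h"
    by (rule comp_extend) (use e assms in simp_all)
  moreover have eh: "e \<cdot> h \<in> Arr C" "Cod C (e \<cdot> h) = Cod C e" "Dom C (e \<cdot> h) = Z"
    using assms(2) e by simp_all
  ultimately have "\<exists>!k. k \<in> Hom C Z E \<and> e \<cdot> k = e \<cdot> h"
    using equalizer_universal[OF assms(1) eh(1,2)] by simp
  then show ?thesis using assms(2-4) by metis
qed

end

text \<open>With \<open>X\<close> the codomain of \<open>e\<close>, \<open>e \<otimes> e\<close> is
  the composite of \<open>X \<otimes> e\<close> after \<open>e \<otimes> E\<close>, and both factors
  are equalizers by preservation. So \<open>h\<close> is lifted through one after the other. The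
  intermediate lift satisfies the equation required by the second equalizer because this can be
  tested after the monomorphism \<open>Y \<otimes> e\<close>, where it becomes the assumption on
  \<open>h\<close>.\<close>

lemma (in monoidal_category) tensor_square_equalizer:
  assumes pres: "tensor_preserves_equalizers C" and eq: "is_equalizer C E e f g"
    and h: "h \<in> Hom C Z (Cod C e \<otimes>\<^sub>o Cod C e)"
    and l: "(f \<otimes>\<^sub>m \<one>\<^sub>m (Cod C e)) \<cdot> h = (g \<otimes>\<^sub>m \<one>\<^sub>m (Cod C e)) \<cdot> h"
    and r: "(\<one>\<^sub>m (Cod C e) \<otimes>\<^sub>m f) \<cdot> h = (\<one>\<^sub>m (Cod C e) \<otimes>\<^sub>m g) \<cdot> h"
  shows "\<exists>!k. k \<in> Hom C Z (E \<otimes>\<^sub>o E) \<and> (e \<otimes>\<^sub>m e) \<cdot> k = h"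
proof -
  note [simp] = is_equalizerD(1-8)[OF eq]
  define X where "X = Cod C e"
  define Y where "Y = Cod C f"
  note defs [simp] = X_def [symmetric] Y_def [symmetric]
  have [simp]: "X \<in> Ob C" "Y \<in> Ob C"
    using cod_ob[of e] cod_ob[of f] by (simp_all del: cod_ob)
  have eqL: "is_equalizer C (E \<otimes>\<^sub>o W) (e \<otimes>\<^sub>m \<one>\<^sub>m W) (f \<otimes>\<^sub>m \<one>\<^sub>m W) (g \<otimes>\<^sub>m \<one>\<^sub>m W)"
    and eqR: "is_equalizer C (W \<otimes>\<^sub>o E) (\<one>\<^sub>m W \<otimes>\<^sub>m e) (\<one>\<^sub>m W \<otimes>\<^sub>m f) (\<one>\<^sub>m W \<otimes>\<^sub>m g)"
    if "W \<in> Ob C" for W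
    using pres eq that unfolding tensor_preserves_equalizers_def by blast+
  have h' [simp]: "h \<in> Arr C" "Dom C h = Z" "Cod C h = X \<otimes>\<^sub>o X" using h by simp_all
  have [simp]: "Z \<in> Ob C" using dom_ob[OF h'(1)] by simp
  obtain k1 where k1 [simp]: "k1 \<in> Arr C" "Dom C k1 = Z" "Cod C k1 = X \<otimes>\<^sub>o E"
    and k1h: "(\<one>\<^sub>m X \<otimes>\<^sub>m e) \<cdot> k1 = h"
    using ex1_implies_ex[OF equalizer_universal[OF eqR[of X], of h]] r by auto
  have "(\<one>\<^sub>m Y \<otimes>\<^sub>m e) \<cdot> (f \<otimes>\<^sub>m \<one>\<^sub>m E) \<cdot> k1 = (f \<otimes>\<^sub>m \<one>\<^sub>m X) \<cdot> (\<one>\<^sub>m X \<otimes>\<^sub>m e) \<cdot> k1"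
    by simp
  also have "\<dots> = (g \<otimes>\<^sub>m \<one>\<^sub>m X) \<cdot> (\<one>\<^sub>m X \<otimes>\<^sub>m e) \<cdot> k1"
    unfolding k1h using l by simp
  also have "\<dots> = (\<one>\<^sub>m Y \<otimes>\<^sub>m e) \<cdot> (g \<otimes>\<^sub>m \<one>\<^sub>m E) \<cdot> k1"
    by simp
  finally have "(f \<otimes>\<^sub>m \<one>\<^sub>m E) \<cdot> k1 = (g \<otimes>\<^sub>m \<one>\<^sub>m E) \<cdot> k1"
    by - (rule equalizer_mono[OF eqR[of Y], of _ Z], simp_all)
  then obtain k2 where k2 [simp]: "k2 \<in> Arr C" "Dom C k2 = Z" "Cod C k2 = E \<otimes>\<^sub>o E"
    and k2k1: "(e \<otimes>\<^sub>m \<one>\<^sub>m E) \<cdot> k2 = k1"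
    using ex1_implies_ex[OF equalizer_universal[OF eqL[of E], of k1]] by auto
  have split: "(e \<otimes>\<^sub>m e) \<cdot> k = (\<one>\<^sub>m X \<otimes>\<^sub>m e) \<cdot> (e \<otimes>\<^sub>m \<one>\<^sub>m E) \<cdot> k" if "k \<in> Hom C Z (E \<otimes>\<^sub>o E)" for k
    using that by simp
  show ?thesis
  proof (rule ex1I[of _ k2])
    show "k2 \<in> Hom C Z (E \<otimes>\<^sub>o E) \<and> (e \<otimes>\<^sub>m e) \<cdot> k2 = h"
      using split[of k2] by (simp only: k2k1 k1h) simp
    fix k assume k: "k \<in> Hom C Z (E \<otimes>\<^sub>o E) \<and> (e \<otimes>\<^sub>m e) \<cdot> k = h"
    then have "(\<one>\<^sub>m X \<otimes>\<^sub>m e) \<cdot> (e \<otimes>\<^sub>m \<one>\<^sub>m E) \<cdot> k = (\<one>\<^sub>m X \<otimes>\<^sub>m e) \<cdot> k1"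
      using split[of k] k1h by metis
    then have "(e \<otimes>\<^sub>m \<one>\<^sub>m E) \<cdot> k = k1"
      using k by - (rule equalizer_mono[OF eqR[of X], of _ Z], simp_all)
    then have "(e \<otimes>\<^sub>m \<one>\<^sub>m E) \<cdot> k = (e \<otimes>\<^sub>m \<one>\<^sub>m E) \<cdot> k2"
      using k2k1 by metis
    then show "k = k2"
      using k by - (rule equalizer_mono[OF eqL[of E], of _ Z], simp_all)
  qed
qed

section \<open>Addition and subtraction of arrows\<close>

context additive_category
begin

text \<open>Each hom-set is a group of its own in the sense of HOL-Algebra. Bundling the laws opens
  that group only once; the lemmas after it restate them with typing premises the simplifier can
  check.\<close>

lemma add_facts:
  assumes "f \<in> Hom C X Y" "g \<in> Hom C X Y" "h \<in> Hom C X Y"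
  shows "f \<oplus>\<^sub>m g \<in> Hom C X Y" "f \<oplus>\<^sub>m g = g \<oplus>\<^sub>m f" "(f \<oplus>\<^sub>m g) \<oplus>\<^sub>m h = f \<oplus>\<^sub>m (g \<oplus>\<^sub>m h)"
    "f \<oplus>\<^sub>m h = g \<oplus>\<^sub>m h \<Longrightarrow> f = g" "Zero C X Y \<in> Hom C X Y" "Zero C X Y \<oplus>\<^sub>m f = f"
    "f \<ominus>\<^sub>m g \<in> Hom C X Y" "(f \<ominus>\<^sub>m g) \<oplus>\<^sub>m g = f"
proof -
  have "X \<in> Ob C" "Y \<in> Ob C" using assms by auto
  then interpret G: comm_group "hom_group C X Y" by (rule hom_comm_group)
  have fgh: "f \<in> carrier (hom_group C X Y)" "g \<in> carrier (hom_group C X Y)" "h \<in> carrier (hom_group C X Y)"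
    using assms by (simp_all add: hom_group_def del: in_Hom_iff)
  have m: "f \<ominus>\<^sub>m g = f \<oplus>\<^sub>m m_inv (hom_group C X Y) g"
    using assms by (simp add: Minus_def)
  show "f \<oplus>\<^sub>m g \<in> Hom C X Y" "f \<oplus>\<^sub>m g = g \<oplus>\<^sub>m f" "(f \<oplus>\<^sub>m g) \<oplus>\<^sub>m h = f \<oplus>\<^sub>m (g \<oplus>\<^sub>m h)"
    "f \<oplus>\<^sub>m h = g \<oplus>\<^sub>m h \<Longrightarrow> f = g" "Zero C X Y \<in> Hom C X Y" "Zero C X Y \<oplus>\<^sub>m f = f"
    using fgh G.m_closed[of f g] G.m_comm[of f g] G.m_assoc[of f g h] G.right_cancel[of h f g] G.one_closed
      G.l_one[of f]
    by (simp_all add: hom_group_def del: in_Hom_iff)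
  show "f \<ominus>\<^sub>m g \<in> Hom C X Y" "(f \<ominus>\<^sub>m g) \<oplus>\<^sub>m g = f"
    unfolding m using fgh G.m_closed[of f "m_inv (hom_group C X Y) g"] G.inv_closed[of g]
      G.m_assoc[of f "m_inv (hom_group C X Y) g" g] G.l_inv[of g] G.r_one[of f]
    by (simp_all add: hom_group_def del: in_Hom_iff)
qed

lemma add_arr [simp]:
  assumes "f \<in> Arr C" "g \<in> Arr C" "Dom C f = Dom C g" "Cod C f = Cod C g"
  shows "f \<oplus>\<^sub>m g \<in> Arr C" "Dom C (f \<oplus>\<^sub>m g) = Dom C g" "Cod C (f \<oplus>\<^sub>m g) = Cod C g"
    "f \<ominus>\<^sub>m g \<in> Arr C" "Dom C (f \<ominus>\<^sub>m g) = Dom C g" "Cod C (f \<ominus>\<^sub>m g) = Cod C g"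
  using add_facts(1,7)[of f "Dom C g" "Cod C g" g f] assms
  by simp_all

lemma zero_arr [simp]:
  assumes "X \<in> Ob C" "Y \<in> Ob C"
  shows "Zero C X Y \<in> Arr C" "Dom C (Zero C X Y) = X" "Cod C (Zero C X Y) = Y"
proof -
  interpret G: comm_group "hom_group C X Y" using assms by (rule hom_comm_group)
  show "Zero C X Y \<in> Arr C" "Dom C (Zero C X Y) = X" "Cod C (Zero C X Y) = Y"
    using G.one_closed by (simp_all add: hom_group_def)
qed

lemma add_commute:
  assumes "f \<in> Arr C" "g \<in> Arr C" "Dom C f = Dom C g" "Cod C f = Cod C g"
  shows "f \<oplus>\<^sub>m g = g \<oplus>\<^sub>m f"
  using add_facts(2)[of f "Dom C g" "Cod C g" g f] assms by simp

lemma add_assoc: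
  assumes "f \<in> Arr C" "g \<in> Arr C" "h \<in> Arr C" "Dom C f = Dom C g" "Cod C f = Cod C g"
    "Dom C g = Dom C h" "Cod C g = Cod C h"
  shows "(f \<oplus>\<^sub>m g) \<oplus>\<^sub>m h = f \<oplus>\<^sub>m (g \<oplus>\<^sub>m h)"
  using add_facts(3)[of f "Dom C h" "Cod C h" g h] assms by simp

lemma add_left_commute:
  assumes "f \<in> Arr C" "g \<in> Arr C" "h \<in> Arr C" "Dom C f = Dom C g" "Cod C f = Cod C g"
    "Dom C g = Dom C h" "Cod C g = Cod C h"
  shows "f \<oplus>\<^sub>m (g \<oplus>\<^sub>m h) = g \<oplus>\<^sub>m (f \<oplus>\<^sub>m h)"
  using add_assoc[of f g h] add_assoc[of g f h] add_commute[of f g] assms by simp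

lemmas add_ac = add_assoc add_commute add_left_commute

lemma add_cancel:
  assumes "f \<oplus>\<^sub>m h = g \<oplus>\<^sub>m h" "f \<in> Arr C" "g \<in> Arr C" "h \<in> Arr C"
    "Dom C f = Dom C h" "Cod C f = Cod C h" "Dom C g = Dom C h" "Cod C g = Cod C h"
  shows "f = g"
  using add_facts(4)[of f "Dom C h" "Cod C h" g h] assms by simp

lemma zero_add:
  assumes "f \<in> Arr C" "Dom C f = X" "Cod C f = Y"
  shows "Zero C X Y \<oplus>\<^sub>m f = f"
  using add_facts(6)[of f X Y f f] assms by simp

lemma minus_add:
  assumes "f \<in> Arr C" "g \<in> Arr C" "Dom C f = Dom C g" "Cod C f = Cod C g"
  shows "(f \<ominus>\<^sub>m g) \<oplus>\<^sub>m g = f"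
  using add_facts(8)[of f "Dom C g" "Cod C g" g f] assms by simp

text \<open>The bridge by which differences are turned into sums; linearity of composition and
  tensor for differences is derived from linearity for sums through it.\<close>

lemma minus_eq_iff:
  assumes "f \<in> Arr C" "g \<in> Arr C" "Dom C f = Dom C g" "Cod C f = Cod C g"
    "h \<in> Arr C" "Dom C h = Dom C g" "Cod C h = Cod C g"
  shows "f \<ominus>\<^sub>m g = h \<longleftrightarrow> f = h \<oplus>\<^sub>m g"
proof
  assume "f = h \<oplus>\<^sub>m g"
  then show "f \<ominus>\<^sub>m g = h"
    using minus_add[of f g] assms by (intro add_cancel[of "f \<ominus>\<^sub>m g" g h]) simp_all
qed (use minus_add[of f g] assms in simp)

lemma comp_add:
  assumes "f \<in> Arr C" "g \<in> Arr C" "h \<in> Arr C" "Dom C g = Dom C h" "Cod C g = Cod C h"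
  shows "Dom C g = Cod C f \<Longrightarrow> (g \<oplus>\<^sub>m h) \<cdot> f = (g \<cdot> f) \<oplus>\<^sub>m (h \<cdot> f)"
    "Dom C f = Cod C g \<Longrightarrow> f \<cdot> (g \<oplus>\<^sub>m h) = (f \<cdot> g) \<oplus>\<^sub>m (f \<cdot> h)"
  using comp_add_left[of f "Dom C f" "Dom C g" g "Cod C g" h]
    comp_add_right[of g "Dom C g" "Cod C g" h f "Cod C f"] assms
  by simp_all

lemma comp_minus:
  assumes "f \<in> Arr C" "g \<in> Arr C" "h \<in> Arr C" "Dom C g = Dom C h" "Cod C g = Cod C h"
  shows "Dom C g = Cod C f \<Longrightarrow> (g \<ominus>\<^sub>m h) \<cdot> f = (g \<cdot> f) \<ominus>\<^sub>m (h \<cdot> f)"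
    "Dom C f = Cod C g \<Longrightarrow> f \<cdot> (g \<ominus>\<^sub>m h) = (f \<cdot> g) \<ominus>\<^sub>m (f \<cdot> h)"
proof -
  show "(g \<ominus>\<^sub>m h) \<cdot> f = (g \<cdot> f) \<ominus>\<^sub>m (h \<cdot> f)" if "Dom C g = Cod C f"
  proof -
    have "((g \<ominus>\<^sub>m h) \<oplus>\<^sub>m h) \<cdot> f = ((g \<ominus>\<^sub>m h) \<cdot> f) \<oplus>\<^sub>m (h \<cdot> f)"
      using assms that by (intro comp_add) simp_all
    then show ?thesis using assms that by (intro minus_eq_iff[THEN iffD2, symmetric]) (simp_all add: minus_add)
  qed
  show "f \<cdot> (g \<ominus>\<^sub>m h) = (f \<cdot> g) \<ominus>\<^sub>m (f \<cdot> h)" if "Dom C f = Cod C g"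
  proof -
    have "f \<cdot> ((g \<ominus>\<^sub>m h) \<oplus>\<^sub>m h) = (f \<cdot> (g \<ominus>\<^sub>m h)) \<oplus>\<^sub>m (f \<cdot> h)"
      using assms that by (intro comp_add) simp_all
    then show ?thesis using assms that by (intro minus_eq_iff[THEN iffD2, symmetric]) (simp_all add: minus_add)
  qed
qed

end

context additive_monoidal_category
begin

lemma tens_add:
  assumes "f \<in> Arr C" "g \<in> Arr C" "h \<in> Arr C" "Dom C g = Dom C h" "Cod C g = Cod C h"
  shows "(g \<oplus>\<^sub>m h) \<otimes>\<^sub>m f = (g \<otimes>\<^sub>m f) \<oplus>\<^sub>m (h \<otimes>\<^sub>m f)" "f \<otimes>\<^sub>m (g \<oplus>\<^sub>m h) = (f \<otimes>\<^sub>m g) \<oplus>\<^sub>m (f \<otimes>\<^sub>m h)"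
  using tens_add_left[of g "Dom C g" "Cod C g" h f "Dom C f" "Cod C f"]
    tens_add_right[of g "Dom C g" "Cod C g" h f "Dom C f" "Cod C f"] assms
  by simp_all

end

section \<open>Primitive elements\<close>

locale braided_bialg = additive_monoidal_category C for C :: "('o, 'm) addmon_data" (structure) +
  fixes B :: "('o, 'm) bialg_data"
  assumes bialg: "braided_bialgebra C B"
begin

abbreviation "H \<equiv> obj B"
abbreviation "\<mu> \<equiv> mul B"
abbreviation "\<eta> \<equiv> unt B"
abbreviation "\<Delta> \<equiv> comul B"
abbreviation "\<epsilon> \<equiv> counit B"
abbreviation "\<tau> \<equiv> braid B"
abbreviation "lui X \<equiv> left_unit_insert C X \<eta>"
abbreviation "rui X \<equiv> right_unit_insert C X \<eta>"

lemma bialg_arr [simp]: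
  "H \<in> Ob C" "\<mu> \<in> Arr C" "Dom C \<mu> = H \<otimes>\<^sub>o H" "Cod C \<mu> = H"
  "\<eta> \<in> Arr C" "Dom C \<eta> = I" "Cod C \<eta> = H"
  "\<Delta> \<in> Arr C" "Dom C \<Delta> = H" "Cod C \<Delta> = H \<otimes>\<^sub>o H"
  "\<epsilon> \<in> Arr C" "Dom C \<epsilon> = H" "Cod C \<epsilon> = I"
  "\<tau> \<in> Arr C" "Dom C \<tau> = H \<otimes>\<^sub>o H" "Cod C \<tau> = H \<otimes>\<^sub>o H"
  using bialg
  by (simp_all add: braided_bialgebra_def Let_def is_algebra_def is_coalgebra_def
      involutive_yb_operator_def)

lemma bialg_eqs:
  "\<mu> \<cdot> (\<eta> \<otimes>\<^sub>m \<one>\<^sub>m H) = Lunit C H" "\<mu> \<cdot> (\<one>\<^sub>m H \<otimes>\<^sub>m \<eta>) = Runit C H"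
  "\<tau> \<cdot> \<tau> = \<one>\<^sub>m (H \<otimes>\<^sub>o H)"
  "\<tau> \<cdot> lui H = rui H" "\<tau> \<cdot> rui H = lui H"
  "Ainv H H H \<cdot> (\<one>\<^sub>m H \<otimes>\<^sub>m \<Delta>) \<cdot> \<tau> = t_op C H \<tau> \<cdot> (\<Delta> \<otimes>\<^sub>m \<one>\<^sub>m H)"
  "(\<Delta> \<otimes>\<^sub>m \<one>\<^sub>m H) \<cdot> \<tau> = w_op C H \<tau> \<cdot> Ainv H H H \<cdot> (\<one>\<^sub>m H \<otimes>\<^sub>m \<Delta>)"
  "(\<mu> \<otimes>\<^sub>m \<mu>) \<cdot> mid_strand C H \<tau> \<cdot> (\<Delta> \<otimes>\<^sub>m \<Delta>) = \<Delta> \<cdot> \<mu>"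
  using bialg
  by (auto simp only: braided_bialgebra_def Let_def is_algebra_def involutive_yb_operator_def)

lemma mul_lui: "\<mu> \<cdot> lui H = \<one>\<^sub>m H" "\<mu> \<cdot> rui H = \<one>\<^sub>m H"
  using comp_extend1[OF bialg_eqs(1), of "Linv H"] comp_extend1[OF bialg_eqs(2), of "Rinv H"]
  by (simp_all add: left_unit_insert_def right_unit_insert_def)

text \<open>Rewriting with these lets an inserted unit travel to the left through strands and
  associators until the braiding or the multiplication absorbs it.\<close>

lemmas insert_simps = assoc_lui assoc_lui' assoc_inv_lui assoc_inv_lui' tens_lui tens_lui'

text \<open>Of the two crossings in \<open>t_op\<close>, one moves the inserted unit past an element
  and is absorbed by the unit axiom of the braiding; the other remains as \<open>\<tau>\<close>. The
  same happens for \<open>w_op\<close> in the next lemma.\<close>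

lemma t_op_lui:
  "Assoc C H H H \<cdot> t_op C H \<tau> \<cdot> (lui H \<otimes>\<^sub>m \<one>\<^sub>m H) = (\<one>\<^sub>m H \<otimes>\<^sub>m lui H) \<cdot> \<tau>"
  "Assoc C H H H \<cdot> t_op C H \<tau> \<cdot> (rui H \<otimes>\<^sub>m \<one>\<^sub>m H) = (\<one>\<^sub>m H \<otimes>\<^sub>m rui H) \<cdot> \<tau>"
  by (simp_all add: t_op_def left_strand_def right_strand_def insert_simps bialg_eqs)

lemma w_op_lui:
  "w_op C H \<tau> \<cdot> Ainv H H H \<cdot> (\<one>\<^sub>m H \<otimes>\<^sub>m lui H) = (lui H \<otimes>\<^sub>m \<one>\<^sub>m H) \<cdot> \<tau>"
  "w_op C H \<tau> \<cdot> Ainv H H H \<cdot> (\<one>\<^sub>m H \<otimes>\<^sub>m rui H) = (rui H \<otimes>\<^sub>m \<one>\<^sub>m H) \<cdot> \<tau>"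
  by (simp_all add: w_op_def left_strand_def right_strand_def insert_simps bialg_eqs)

lemma strand_arr [simp]:
  "t_op C H \<tau> \<in> Arr C" "Dom C (t_op C H \<tau>) = (H \<otimes>\<^sub>o H) \<otimes>\<^sub>o H" "Cod C (t_op C H \<tau>) = (H \<otimes>\<^sub>o H) \<otimes>\<^sub>o H"
  "w_op C H \<tau> \<in> Arr C" "Dom C (w_op C H \<tau>) = (H \<otimes>\<^sub>o H) \<otimes>\<^sub>o H" "Cod C (w_op C H \<tau>) = (H \<otimes>\<^sub>o H) \<otimes>\<^sub>o H"
  "mid_strand C H \<tau> \<in> Arr C" "Dom C (mid_strand C H \<tau>) = (H \<otimes>\<^sub>o H) \<otimes>\<^sub>o (H \<otimes>\<^sub>o H)"
  "Cod C (mid_strand C H \<tau>) = (H \<otimes>\<^sub>o H) \<otimes>\<^sub>o (H \<otimes>\<^sub>o H)"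
  by (simp_all add: w_op_def t_op_def mid_strand_def left_strand_def right_strand_def)

text \<open>A unit in the outer slot of the left pair is not touched by the middle crossing, which
  goes on braiding the two neighbours. In \<open>mid_strand_rui\<close> the unit sits in the inner
  slot: there the crossing disappears and the unit passes into the right pair.\<close>

lemma mid_strand_lui:
  "mid_strand C H \<tau> \<cdot> (lui H \<otimes>\<^sub>m \<one>\<^sub>m (H \<otimes>\<^sub>o H))
    = (lui H \<otimes>\<^sub>m \<one>\<^sub>m (H \<otimes>\<^sub>o H)) \<cdot> Assoc C H H H \<cdot> (\<tau> \<otimes>\<^sub>m \<one>\<^sub>m H) \<cdot> Ainv H H H"
proof -
  have "mid_strand C H \<tau> \<cdot> (lui H \<otimes>\<^sub>m \<one>\<^sub>m (H \<otimes>\<^sub>o H)) =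
    Ainv H H (H \<otimes>\<^sub>o H) \<cdot> lui (H \<otimes>\<^sub>o H \<otimes>\<^sub>o H) \<cdot> Assoc C H H H \<cdot> (\<tau> \<otimes>\<^sub>m \<one>\<^sub>m H) \<cdot> Ainv H H H"
    by (simp add: mid_strand_def insert_simps)
  also have "\<dots> = (lui H \<otimes>\<^sub>m \<one>\<^sub>m (H \<otimes>\<^sub>o H)) \<cdot> Assoc C H H H \<cdot> (\<tau> \<otimes>\<^sub>m \<one>\<^sub>m H) \<cdot> Ainv H H H"
    by (simp add: insert_simps)
  finally show ?thesis .
qed

lemma mid_strand_rui:
  "mid_strand C H \<tau> \<cdot> (rui H \<otimes>\<^sub>m \<one>\<^sub>m (H \<otimes>\<^sub>o H)) = (\<one>\<^sub>m (H \<otimes>\<^sub>o H) \<otimes>\<^sub>m lui H) \<cdot> Ainv H H H"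
proof -
  have "mid_strand C H \<tau> \<cdot> (rui H \<otimes>\<^sub>m \<one>\<^sub>m (H \<otimes>\<^sub>o H)) =
    Ainv H H (H \<otimes>\<^sub>o H) \<cdot> (\<one>\<^sub>m H \<otimes>\<^sub>m (\<one>\<^sub>m H \<otimes>\<^sub>m lui H))"
    by (simp add: mid_strand_def insert_simps bialg_eqs)
  also have "\<dots> = (\<one>\<^sub>m (H \<otimes>\<^sub>o H) \<otimes>\<^sub>m lui H) \<cdot> Ainv H H H"
    by (subst assoc_inv_nat) simp_all
  finally show ?thesis .
qed

text \<open>In the braided tensor square of \<open>H\<close> these are the products of
  \<open>1 \<otimes> x\<close> or \<open>x \<otimes> 1\<close> with \<open>1 \<otimes> y\<close> or
  \<open>y \<otimes> 1\<close>: in this order \<open>1 \<otimes> xy\<close>,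
  \<open>\<tau>(x \<otimes> y)\<close>, \<open>x \<otimes> y\<close> and
  \<open>xy \<otimes> 1\<close>.\<close>

lemma mul_mid_strand:
  "(\<mu> \<otimes>\<^sub>m \<mu>) \<cdot> mid_strand C H \<tau> \<cdot> (lui H \<otimes>\<^sub>m lui H) = lui H \<cdot> \<mu>"
  "(\<mu> \<otimes>\<^sub>m \<mu>) \<cdot> mid_strand C H \<tau> \<cdot> (lui H \<otimes>\<^sub>m rui H) = \<tau>"
  "(\<mu> \<otimes>\<^sub>m \<mu>) \<cdot> mid_strand C H \<tau> \<cdot> (rui H \<otimes>\<^sub>m lui H) = \<one>\<^sub>m (H \<otimes>\<^sub>o H)"
  "(\<mu> \<otimes>\<^sub>m \<mu>) \<cdot> mid_strand C H \<tau> \<cdot> (rui H \<otimes>\<^sub>m rui H) = rui H \<cdot> \<mu>"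
proof -
  \<comment> \<open>The second insertion is split off as a trailing factor, so that the two
    preceding lemmas, stated with an identity in that place, apply.\<close>
  have L: "mid_strand C H \<tau> \<cdot> (lui H \<otimes>\<^sub>m f) = (lui H \<otimes>\<^sub>m \<one>\<^sub>m (H \<otimes>\<^sub>o H)) \<cdot> Assoc C H H H \<cdot> (\<tau> \<otimes>\<^sub>m \<one>\<^sub>m H) \<cdot> Ainv H H H \<cdot> (\<one>\<^sub>m H \<otimes>\<^sub>m f)"
    and R: "mid_strand C H \<tau> \<cdot> (rui H \<otimes>\<^sub>m f) = (\<one>\<^sub>m (H \<otimes>\<^sub>o H) \<otimes>\<^sub>m lui H) \<cdot> Ainv H H H \<cdot> (\<one>\<^sub>m H \<otimes>\<^sub>m f)"
    if "f \<in> Hom C H (H \<otimes>\<^sub>o H)" for f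
    using that comp_extend1[OF mid_strand_lui, of "\<one>\<^sub>m H \<otimes>\<^sub>m f"]
      comp_extend1[OF mid_strand_rui, of "\<one>\<^sub>m H \<otimes>\<^sub>m f"] by simp_all
  show "(\<mu> \<otimes>\<^sub>m \<mu>) \<cdot> mid_strand C H \<tau> \<cdot> (lui H \<otimes>\<^sub>m lui H) = lui H \<cdot> \<mu>"
    "(\<mu> \<otimes>\<^sub>m \<mu>) \<cdot> mid_strand C H \<tau> \<cdot> (lui H \<otimes>\<^sub>m rui H) = \<tau>"
    "(\<mu> \<otimes>\<^sub>m \<mu>) \<cdot> mid_strand C H \<tau> \<cdot> (rui H \<otimes>\<^sub>m lui H) = \<one>\<^sub>m (H \<otimes>\<^sub>o H)"
    "(\<mu> \<otimes>\<^sub>m \<mu>) \<cdot> mid_strand C H \<tau> \<cdot> (rui H \<otimes>\<^sub>m rui H) = rui H \<cdot> \<mu>"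
    by (simp_all add: L R insert_simps bialg_eqs mul_lui)
qed

end

locale primitives = braided_bialg +
  fixes P :: 'a and e :: 'b
  assumes prim: "is_primitives C B P e"
    and pres: "tensor_preserves_equalizers C"
begin

lemma prim_arr [simp]:
  "e \<in> Arr C" "Dom C e = P" "Cod C e = H" "P \<in> Ob C"
  using is_equalizerD[OF prim[unfolded is_primitives_def]] by simp_all

lemma comul_prim: "\<Delta> \<cdot> e = (lui H \<cdot> e) \<oplus>\<^sub>m (rui H \<cdot> e)"
  using is_equalizerD(9)[OF prim[unfolded is_primitives_def]] by (simp add: comp_add)

text \<open>Compatibility of \<open>\<tau>\<close> with \<open>\<Delta>\<close> turns a
  comultiplication of one leg after \<open>\<tau>\<close> into a comultiplication of the other leg
  before it. There it meets \<open>e\<close> and splits into two insertions, which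
  \<open>w_op_lui\<close> and \<open>t_op_lui\<close> carry back to the original leg.\<close>

lemma ex1_lie_braid:
  "\<exists>!l. l \<in> Hom C (P \<otimes>\<^sub>o P) (P \<otimes>\<^sub>o P) \<and> (e \<otimes>\<^sub>m e) \<cdot> l = \<tau> \<cdot> (e \<otimes>\<^sub>m e)"
proof (rule tensor_square_equalizer[OF pres prim[unfolded is_primitives_def]])
  show "(\<Delta> \<otimes>\<^sub>m \<one>\<^sub>m (Cod C e)) \<cdot> \<tau> \<cdot> (e \<otimes>\<^sub>m e) = ((lui H \<oplus>\<^sub>m rui H) \<otimes>\<^sub>m \<one>\<^sub>m (Cod C e)) \<cdot> \<tau> \<cdot> (e \<otimes>\<^sub>m e)"
  proof -
    have "(\<Delta> \<otimes>\<^sub>m \<one>\<^sub>m H) \<cdot> \<tau> \<cdot> (e \<otimes>\<^sub>m e) = ((\<Delta> \<otimes>\<^sub>m \<one>\<^sub>m H) \<cdot> \<tau>) \<cdot> (e \<otimes>\<^sub>m e)"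
      by simp
    also have "\<dots> = (w_op C H \<tau> \<cdot> Ainv H H H \<cdot> (\<one>\<^sub>m H \<otimes>\<^sub>m \<Delta>)) \<cdot> (e \<otimes>\<^sub>m e)"
      unfolding bialg_eqs(7) ..
    also have "\<dots> = w_op C H \<tau> \<cdot> Ainv H H H \<cdot> (e \<otimes>\<^sub>m (lui H \<cdot> e)) \<oplus>\<^sub>m w_op C H \<tau> \<cdot> Ainv H H H \<cdot> (e \<otimes>\<^sub>m (rui H \<cdot> e))"
      by (simp add: comul_prim tens_add comp_add)
    also have "\<dots> = (w_op C H \<tau> \<cdot> Ainv H H H \<cdot> (\<one>\<^sub>m H \<otimes>\<^sub>m lui H)) \<cdot> (e \<otimes>\<^sub>m e)
        \<oplus>\<^sub>m (w_op C H \<tau> \<cdot> Ainv H H H \<cdot> (\<one>\<^sub>m H \<otimes>\<^sub>m rui H)) \<cdot> (e \<otimes>\<^sub>m e)"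
      by simp
    also have "\<dots> = ((lui H \<oplus>\<^sub>m rui H) \<otimes>\<^sub>m \<one>\<^sub>m H) \<cdot> \<tau> \<cdot> (e \<otimes>\<^sub>m e)"
      unfolding w_op_lui by (simp add: tens_add comp_add)
    finally show ?thesis by simp
  qed
  show "(\<one>\<^sub>m (Cod C e) \<otimes>\<^sub>m \<Delta>) \<cdot> \<tau> \<cdot> (e \<otimes>\<^sub>m e) = (\<one>\<^sub>m (Cod C e) \<otimes>\<^sub>m (lui H \<oplus>\<^sub>m rui H)) \<cdot> \<tau> \<cdot> (e \<otimes>\<^sub>m e)"
  proof -
    have "(\<one>\<^sub>m H \<otimes>\<^sub>m \<Delta>) \<cdot> \<tau> \<cdot> (e \<otimes>\<^sub>m e)
        = Assoc C H H H \<cdot> (Ainv H H H \<cdot> (\<one>\<^sub>m H \<otimes>\<^sub>m \<Delta>) \<cdot> \<tau>) \<cdot> (e \<otimes>\<^sub>m e)"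
      by simp
    also have "\<dots> = Assoc C H H H \<cdot> (t_op C H \<tau> \<cdot> (\<Delta> \<otimes>\<^sub>m \<one>\<^sub>m H)) \<cdot> (e \<otimes>\<^sub>m e)"
      unfolding bialg_eqs(6) ..
    also have "\<dots> = Assoc C H H H \<cdot> t_op C H \<tau> \<cdot> ((lui H \<cdot> e) \<otimes>\<^sub>m e) \<oplus>\<^sub>m Assoc C H H H \<cdot> t_op C H \<tau> \<cdot> ((rui H \<cdot> e) \<otimes>\<^sub>m e)"
      by (simp add: comul_prim tens_add comp_add)
    also have "\<dots> = (Assoc C H H H \<cdot> t_op C H \<tau> \<cdot> (lui H \<otimes>\<^sub>m \<one>\<^sub>m H)) \<cdot> (e \<otimes>\<^sub>m e)
        \<oplus>\<^sub>m (Assoc C H H H \<cdot> t_op C H \<tau> \<cdot> (rui H \<otimes>\<^sub>m \<one>\<^sub>m H)) \<cdot> (e \<otimes>\<^sub>m e)"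
      by simp
    also have "\<dots> = (\<one>\<^sub>m H \<otimes>\<^sub>m (lui H \<oplus>\<^sub>m rui H)) \<cdot> \<tau> \<cdot> (e \<otimes>\<^sub>m e)"
      unfolding t_op_lui by (simp add: tens_add comp_add)
    finally show ?thesis by simp
  qed
qed simp

text \<open>The identity \<open>\<Delta>(xy) = 1 \<otimes> xy + xy \<otimes> 1 + x \<otimes> y +
  \<tau>(x \<otimes> y)\<close> for primitive \<open>x\<close> and \<open>y\<close>. The last two
  terms measure how far the product is from being primitive.\<close>

lemma comul_mul_prim:
  "\<Delta> \<cdot> \<mu> \<cdot> (e \<otimes>\<^sub>m e) = (lui H \<oplus>\<^sub>m rui H) \<cdot> \<mu> \<cdot> (e \<otimes>\<^sub>m e) \<oplus>\<^sub>m ((e \<otimes>\<^sub>m e) \<oplus>\<^sub>m \<tau> \<cdot> (e \<otimes>\<^sub>m e))"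
proof -
  let ?M = "\<lambda>f g. ((\<mu> \<otimes>\<^sub>m \<mu>) \<cdot> mid_strand C H \<tau> \<cdot> (f \<otimes>\<^sub>m g)) \<cdot> (e \<otimes>\<^sub>m e)"
  have "\<Delta> \<cdot> \<mu> \<cdot> (e \<otimes>\<^sub>m e) = (\<Delta> \<cdot> \<mu>) \<cdot> (e \<otimes>\<^sub>m e)"
    by simp
  also have "\<dots> = ?M \<Delta> \<Delta>"
    unfolding bialg_eqs(8) ..
  also have "\<dots> = (?M (lui H) (lui H) \<oplus>\<^sub>m ?M (lui H) (rui H)) \<oplus>\<^sub>m (?M (rui H) (lui H) \<oplus>\<^sub>m ?M (rui H) (rui H))"
    by (simp add: comul_prim tens_add comp_add add_ac)
  also have "\<dots> = (lui H \<oplus>\<^sub>m rui H) \<cdot> \<mu> \<cdot> (e \<otimes>\<^sub>m e) \<oplus>\<^sub>m ((e \<otimes>\<^sub>m e) \<oplus>\<^sub>m \<tau> \<cdot> (e \<otimes>\<^sub>m e))"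
    unfolding mul_mid_strand by (simp add: comp_add add_ac)
  finally show ?thesis .
qed

lemma ex1_bracket:
  "\<exists>!b. b \<in> Hom C (P \<otimes>\<^sub>o P) P \<and>
    e \<cdot> b = \<mu> \<cdot> (\<one>\<^sub>m (H \<otimes>\<^sub>o H) \<ominus>\<^sub>m \<tau>) \<cdot> (e \<otimes>\<^sub>m e)"
proof -
  obtain l where l [simp]: "l \<in> Arr C" "Dom C l = P \<otimes>\<^sub>o P" "Cod C l = P \<otimes>\<^sub>o P"
    and el: "(e \<otimes>\<^sub>m e) \<cdot> l = \<tau> \<cdot> (e \<otimes>\<^sub>m e)"
    using ex1_lie_braid by auto
  define k where "k = \<mu> \<cdot> (\<one>\<^sub>m (H \<otimes>\<^sub>o H) \<ominus>\<^sub>m \<tau>) \<cdot> (e \<otimes>\<^sub>m e)"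
  let ?u = "lui H \<oplus>\<^sub>m rui H" and ?m = "\<mu> \<cdot> (e \<otimes>\<^sub>m e)" and ?s = "(e \<otimes>\<^sub>m e) \<oplus>\<^sub>m \<tau> \<cdot> (e \<otimes>\<^sub>m e)"
  have k [simp]: "k \<in> Arr C" "Dom C k = P \<otimes>\<^sub>o P" "Cod C k = H"
    by (simp_all add: k_def)
  \<comment> \<open>An additive description of \<open>k\<close>: since \<open>?m \<cdot> l\<close>
    is the multiplication after the braiding, what follows deals with sums only.\<close>
  have km: "k \<oplus>\<^sub>m ?m \<cdot> l = ?m"
    by (simp add: k_def el comp_minus minus_add)
  have ttE: "\<tau> \<cdot> \<tau> \<cdot> (e \<otimes>\<^sub>m e) = e \<otimes>\<^sub>m e"
    using comp_extend1[OF bialg_eqs(3), of "e \<otimes>\<^sub>m e"] by simp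
  \<comment> \<open>Precomposing with \<open>l\<close> exchanges the two summands of the defect
    \<open>?s\<close>, so \<open>?m\<close> and \<open>?m \<cdot> l\<close> fail to be primitive by
    the same amount.\<close>
  have "?s \<cdot> l = (e \<otimes>\<^sub>m e) \<cdot> l \<oplus>\<^sub>m \<tau> \<cdot> (e \<otimes>\<^sub>m e) \<cdot> l"
    by (simp add: comp_add)
  also have "\<dots> = ?s"
    unfolding el ttE by (simp add: add_commute)
  finally have sl: "?s \<cdot> l = ?s" .
  have Dl: "\<Delta> \<cdot> ?m \<cdot> l = ?u \<cdot> ?m \<cdot> l \<oplus>\<^sub>m ?s"
  proof -
    have "\<Delta> \<cdot> ?m \<cdot> l = (\<Delta> \<cdot> ?m) \<cdot> l"
      by simp
    also have "\<dots> = ?u \<cdot> ?m \<cdot> l \<oplus>\<^sub>m ?s \<cdot> l"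
      unfolding comul_mul_prim by (subst comp_add) simp_all
    finally show ?thesis unfolding sl .
  qed
  \<comment> \<open>The two sides of the equalizer condition on \<open>k\<close> are compared after
    adding \<open>\<Delta> \<cdot> ?m \<cdot> l\<close>, which \<open>Dl\<close> recognizes on the
    right as well; it is cancelled at the end.\<close>
  have "\<Delta> \<cdot> k \<oplus>\<^sub>m \<Delta> \<cdot> ?m \<cdot> l = \<Delta> \<cdot> (k \<oplus>\<^sub>m ?m \<cdot> l)"
    by (rule comp_add(2)[symmetric]) simp_all
  also have "\<dots> = ?u \<cdot> (k \<oplus>\<^sub>m ?m \<cdot> l) \<oplus>\<^sub>m ?s"
    unfolding km comul_mul_prim ..
  also have "?u \<cdot> (k \<oplus>\<^sub>m ?m \<cdot> l) = ?u \<cdot> k \<oplus>\<^sub>m ?u \<cdot> ?m \<cdot> l"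
    by (rule comp_add(2)) simp_all
  also have "(?u \<cdot> k \<oplus>\<^sub>m ?u \<cdot> ?m \<cdot> l) \<oplus>\<^sub>m ?s = ?u \<cdot> k \<oplus>\<^sub>m \<Delta> \<cdot> ?m \<cdot> l"
    unfolding Dl by (rule add_assoc) simp_all
  finally have "\<Delta> \<cdot> k = ?u \<cdot> k"
    by (rule add_cancel) simp_all
  then show ?thesis
    using equalizer_universal[OF prim[unfolded is_primitives_def], of k] by (simp add: k_def)
qed

end

section \<open>The opposite category and indecomposables\<close>

text \<open>The order of tensor factors is kept and only arrows are reversed, so left and right
  insertions do not change sides. The constraints then point the wrong way and are replaced by their
  inverses.\<close>

definition op_cat :: "('o, 'm) addmon_data \<Rightarrow> ('o, 'm) addmon_data" where
  "op_cat C = \<lparr>Ob = Ob C, Arr = Arr C, Dom = Cod C, Cod = Dom C, Ide = Ide C,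
     Comp = (\<lambda>g f. Comp C f g), Zero = (\<lambda>X Y. Zero C Y X), Add = Add C, TensOb = TensOb C,
     TensArr = TensArr C, Unit = Unit C, Assoc = (\<lambda>X Y Z. arr_inv C (Assoc C X Y Z)),
     Lunit = (\<lambda>X. arr_inv C (Lunit C X)), Runit = (\<lambda>X. arr_inv C (Runit C X))\<rparr>"

text \<open>The axioms of a braided bialgebra are self-dual: the braiding stays, and the algebra and
  coalgebra halves change places.\<close>

definition op_bialg :: "('o, 'm) bialg_data \<Rightarrow> ('o, 'm) bialg_data" where
  "op_bialg B = \<lparr>obj = obj B, mul = comul B, unt = counit B, comul = mul B, counit = unt B,
     braid = braid B\<rparr>"

lemma op_cat_simps [simp]:
  "Ob (op_cat C) = Ob C" "Arr (op_cat C) = Arr C" "Dom (op_cat C) = Cod C" "Cod (op_cat C) = Dom C"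
  "Ide (op_cat C) = Ide C" "Comp (op_cat C) g f = Comp C f g" "Zero (op_cat C) X Y = Zero C Y X"
  "Add (op_cat C) = Add C" "TensOb (op_cat C) = TensOb C" "TensArr (op_cat C) = TensArr C"
  "Unit (op_cat C) = Unit C" "Assoc (op_cat C) X Y Z = arr_inv C (Assoc C X Y Z)"
  "Lunit (op_cat C) X = arr_inv C (Lunit C X)" "Runit (op_cat C) X = arr_inv C (Runit C X)"
  by (simp_all add: op_cat_def)

lemma op_bialg_simps [simp]:
  "obj (op_bialg B) = obj B" "mul (op_bialg B) = comul B" "unt (op_bialg B) = counit B"
  "comul (op_bialg B) = mul B" "counit (op_bialg B) = unt B" "braid (op_bialg B) = braid B"
  by (simp_all add: op_bialg_def)

lemma op_Hom [simp]: "Hom (op_cat C) X Y = Hom C Y X"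
  by (auto simp: Hom_def)

lemma op_is_inverse [simp]: "is_inverse (op_cat C) f g = is_inverse C f g"
  by (auto simp: is_inverse_def)

lemma op_arr_inv [simp]: "is_iso (op_cat C) f = is_iso C f" "arr_inv (op_cat C) f = arr_inv C f"
  by (simp_all add: is_iso_def arr_inv_def)

lemma op_hom_group [simp]: "hom_group (op_cat C) X Y = hom_group C Y X"
  by (simp add: hom_group_def)

lemma op_Minus [simp]: "Minus (op_cat C) f g = Minus C f g"
  by (simp add: Minus_def)

lemma op_is_equalizer: "is_equalizer (op_cat C) E e f g = is_coequalizer C E e f g"
  unfolding is_equalizer_def is_coequalizer_def op_cat_simps op_Hom by blast

lemma op_tensor_preserves_equalizers:
  "tensor_preserves_equalizers (op_cat C) = tensor_preserves_coequalizers C"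
  by (simp add: tensor_preserves_equalizers_def tensor_preserves_coequalizers_def op_is_equalizer)

lemma (in category) iso_arr_inv: "is_iso C f \<Longrightarrow> is_iso C (arr_inv C f)"
  unfolding is_iso_def[of C "arr_inv C f"] using is_inverse_sym[OF arr_inv_is_inverse] by blast

lemma (in monoidal_category) assoc_inv_triangle:
  assumes "X \<in> Ob C" "Y \<in> Ob C"
  shows "Ainv X I Y \<cdot> (\<one>\<^sub>m X \<otimes>\<^sub>m Linv Y) = Rinv X \<otimes>\<^sub>m \<one>\<^sub>m Y"
  using assms by (simp add: assoc_triangle_inv[symmetric])

lemma (in additive_monoidal_category) additive_monoidal_category_op:
  "additive_monoidal_category (op_cat C)"
proof -
  have "category (op_cat C)"
    by unfold_locales auto
  moreover have "additive_category_axioms (op_cat C)"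
  proof (rule additive_category_axioms.intro)
    show "comm_group (hom_group (op_cat C) X Y)"
      if "X \<in> Ob (op_cat C)" "Y \<in> Ob (op_cat C)" for X Y
      using that hom_comm_group by simp
    show "\<exists>N\<in>Ob (op_cat C). \<forall>X\<in>Ob (op_cat C).
        (\<exists>!f. f \<in> Hom (op_cat C) N X) \<and> (\<exists>!f. f \<in> Hom (op_cat C) X N)"
      unfolding op_cat_simps op_Hom using zero_object by meson
    fix X Y assume XY: "X \<in> Ob (op_cat C)" "Y \<in> Ob (op_cat C)"
    \<comment> \<open>On reversing arrows, the injections and projections of a biproduct exchange
      their roles; the witnesses are supplied below in that order.\<close>
    obtain B i j p q where B: "B \<in> Ob C" "i \<in> Hom C X B" "j \<in> Hom C Y B" "p \<in> Hom C B X" "q \<in> Hom C B Y"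
      "p \<cdot> i = \<one>\<^sub>m X" "q \<cdot> j = \<one>\<^sub>m Y" "p \<cdot> j = Zero C Y X" "q \<cdot> i = Zero C X Y"
      "(i \<cdot> p) \<oplus>\<^sub>m (j \<cdot> q) = \<one>\<^sub>m B"
      using biproducts[of X Y] XY unfolding op_cat_simps by metis
    show "\<exists>B\<in>Ob (op_cat C). \<exists>i\<in>Hom (op_cat C) X B. \<exists>j\<in>Hom (op_cat C) Y B.
        \<exists>p\<in>Hom (op_cat C) B X. \<exists>q\<in>Hom (op_cat C) B Y.
        Comp (op_cat C) p i = Ide (op_cat C) X \<and> Comp (op_cat C) q j = Ide (op_cat C) Y \<and>
        Comp (op_cat C) p j = Zero (op_cat C) Y X \<and> Comp (op_cat C) q i = Zero (op_cat C) X Y \<and>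
        Add (op_cat C) (Comp (op_cat C) i p) (Comp (op_cat C) j q) = Ide (op_cat C) B"
      unfolding op_cat_simps op_Hom
      by (rule bexI[OF _ B(1)], rule bexI[OF _ B(4)], rule bexI[OF _ B(5)],
          rule bexI[OF _ B(2)], rule bexI[OF _ B(3)]) (use B in simp)
  qed (simp_all add: comp_add)
  moreover have "monoidal_category_axioms (op_cat C)"
    by (rule monoidal_category_axioms.intro)
      (auto simp: iso_arr_inv assoc_inv_nat lunit_inv_nat runit_inv_nat pentagon_inv assoc_inv_triangle)
  moreover have "additive_monoidal_category_axioms (op_cat C)"
    by (rule additive_monoidal_category_axioms.intro) (simp_all add: tens_add)
  ultimately show ?thesis
    unfolding additive_monoidal_category_def additive_category_def monoidal_category_def by blast
qed

context braided_bialg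
begin

text \<open>A single crossing at a fixed place is self-dual, because an associator conjugating it is
  swapped with its inverse. Composites of the two crossings are reversed, which exchanges
  \<open>t_op\<close> and \<open>w_op\<close>.\<close>

lemma op_strand:
  "left_strand (op_cat C) H \<tau> = left_strand C H \<tau>" "right_strand (op_cat C) H \<tau> = right_strand C H \<tau>"
  "t_op (op_cat C) H \<tau> = w_op C H \<tau>" "w_op (op_cat C) H \<tau> = t_op C H \<tau>"
  "mid_strand (op_cat C) H \<tau> = mid_strand C H \<tau>"
proof -
  show "left_strand (op_cat C) H \<tau> = left_strand C H \<tau>"
    and r: "right_strand (op_cat C) H \<tau> = right_strand C H \<tau>"
    by (simp_all add: left_strand_def right_strand_def arr_inv_arr_inv)
  then show "t_op (op_cat C) H \<tau> = w_op C H \<tau>" "w_op (op_cat C) H \<tau> = t_op C H \<tau>"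
    by (simp_all add: t_op_def w_op_def)
  show "mid_strand (op_cat C) H \<tau> = mid_strand C H \<tau>"
    by (simp add: mid_strand_def arr_inv_arr_inv)
qed

lemma op_insert:
  "left_unit_insert (op_cat C) X \<epsilon> = left_counit_apply C X \<epsilon>"
  "right_unit_insert (op_cat C) X \<epsilon> = right_counit_apply C X \<epsilon>" if "X \<in> Ob C"
  using that
  by (simp_all add: left_unit_insert_def right_unit_insert_def left_counit_apply_def
      right_counit_apply_def arr_inv_arr_inv)

lemma op_apply:
  "left_counit_apply (op_cat C) X f = left_unit_insert C X f"
  "right_counit_apply (op_cat C) X f = right_unit_insert C X f"
  by (simp_all add: left_unit_insert_def right_unit_insert_def left_counit_apply_def
      right_counit_apply_def)

lemma strand_arr' [simp]:
  "left_strand C H \<tau> \<in> Arr C" "Dom C (left_strand C H \<tau>) = (H \<otimes>\<^sub>o H) \<otimes>\<^sub>o H" "Cod C (left_strand C H \<tau>) = (H \<otimes>\<^sub>o H) \<otimes>\<^sub>o H"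
  "right_strand C H \<tau> \<in> Arr C" "Dom C (right_strand C H \<tau>) = (H \<otimes>\<^sub>o H) \<otimes>\<^sub>o H"
  "Cod C (right_strand C H \<tau>) = (H \<otimes>\<^sub>o H) \<otimes>\<^sub>o H"
  by (simp_all add: left_strand_def right_strand_def)

text \<open>Without constraints each axiom would be carried literally to another one. Here the
  mirror of an axiom may have a constraint on the other side of the equation or a different
  bracketing, and the local facts make up for this.\<close>

lemma braided_bialgebra_op: "braided_bialgebra (op_cat C) (op_bialg B)"
proof -
  have alg: "is_algebra C H \<mu> \<eta>" and coalg: "is_coalgebra C H \<Delta> \<epsilon>"
    and yb: "involutive_yb_operator C H \<tau>"
    and br: "\<tau> \<cdot> (\<mu> \<otimes>\<^sub>m \<one>\<^sub>m H) = (\<one>\<^sub>m H \<otimes>\<^sub>m \<mu>) \<cdot> Assoc C H H H \<cdot> t_op C H \<tau>"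
      "\<tau> \<cdot> (\<one>\<^sub>m H \<otimes>\<^sub>m \<mu>) \<cdot> Assoc C H H H = (\<mu> \<otimes>\<^sub>m \<one>\<^sub>m H) \<cdot> w_op C H \<tau>"
      "left_counit_apply C H \<epsilon> \<cdot> \<tau> = right_counit_apply C H \<epsilon>"
      "right_counit_apply C H \<epsilon> \<cdot> \<tau> = left_counit_apply C H \<epsilon>"
      "\<epsilon> \<cdot> \<mu> = Lunit C I \<cdot> (\<epsilon> \<otimes>\<^sub>m \<epsilon>)" "\<epsilon> \<cdot> \<eta> = \<one>\<^sub>m I" "\<Delta> \<cdot> \<eta> = (\<eta> \<otimes>\<^sub>m \<eta>) \<cdot> Linv I"
    using bialg by (auto simp only: braided_bialgebra_def Let_def)
  have alg': "is_algebra (op_cat C) H \<Delta> \<epsilon>"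
  proof -
    have "(\<Delta> \<otimes>\<^sub>m \<one>\<^sub>m H) \<cdot> \<Delta> = Ainv H H H \<cdot> (\<one>\<^sub>m H \<otimes>\<^sub>m \<Delta>) \<cdot> \<Delta>"
    proof (rule iso_cancel_left[of "Assoc C H H H"])
    qed (use coalg in \<open>simp_all add: is_coalgebra_def\<close>)
    moreover have "(\<epsilon> \<otimes>\<^sub>m \<one>\<^sub>m H) \<cdot> \<Delta> = Linv H"
    proof (rule iso_cancel_left[of "Lunit C H"])
    qed (use coalg in \<open>simp_all add: is_coalgebra_def\<close>)
    moreover have "(\<one>\<^sub>m H \<otimes>\<^sub>m \<epsilon>) \<cdot> \<Delta> = Rinv H"
    proof (rule iso_cancel_left[of "Runit C H"])
    qed (use coalg in \<open>simp_all add: is_coalgebra_def\<close>)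
    ultimately show ?thesis by (simp add: is_algebra_def)
  qed
  have coalg': "is_coalgebra (op_cat C) H \<mu> \<eta>"
  proof -
    have "\<mu> \<cdot> (\<mu> \<otimes>\<^sub>m \<one>\<^sub>m H) \<cdot> Ainv H H H = (\<mu> \<cdot> (\<mu> \<otimes>\<^sub>m \<one>\<^sub>m H)) \<cdot> Ainv H H H"
      by simp
    also have "\<dots> = \<mu> \<cdot> (\<one>\<^sub>m H \<otimes>\<^sub>m \<mu>)"
      using alg unfolding is_algebra_def by (simp del: comp_assoc') simp
    finally have "\<mu> \<cdot> (\<mu> \<otimes>\<^sub>m \<one>\<^sub>m H) \<cdot> Ainv H H H = \<mu> \<cdot> (\<one>\<^sub>m H \<otimes>\<^sub>m \<mu>)" .
    then show ?thesis
      using mul_lui by (simp add: is_coalgebra_def left_unit_insert_def right_unit_insert_def)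
  qed
  have yb': "involutive_yb_operator (op_cat C) H \<tau>"
    using yb unfolding involutive_yb_operator_def op_strand by simp
  \<comment> \<open>These are the compatibilities with exactly the bracketing that reversal of
    composition produces; the final simplification must match them without reassociating.\<close>
  have br': "(\<Delta> \<otimes>\<^sub>m \<one>\<^sub>m H) \<cdot> \<tau> = (w_op C H \<tau> \<cdot> Ainv H H H) \<cdot> (\<one>\<^sub>m H \<otimes>\<^sub>m \<Delta>)"
    "(Ainv H H H \<cdot> (\<one>\<^sub>m H \<otimes>\<^sub>m \<Delta>)) \<cdot> \<tau> = t_op C H \<tau> \<cdot> (\<Delta> \<otimes>\<^sub>m \<one>\<^sub>m H)"
    "(\<tau> \<cdot> (\<one>\<^sub>m H \<otimes>\<^sub>m \<mu>)) \<cdot> Assoc C H H H = (\<mu> \<otimes>\<^sub>m \<one>\<^sub>m H) \<cdot> w_op C H \<tau>"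
    "\<tau> \<cdot> (\<mu> \<otimes>\<^sub>m \<one>\<^sub>m H) = ((\<one>\<^sub>m H \<otimes>\<^sub>m \<mu>) \<cdot> Assoc C H H H) \<cdot> t_op C H \<tau>"
    "((\<mu> \<otimes>\<^sub>m \<mu>) \<cdot> mid_strand C H \<tau>) \<cdot> (\<Delta> \<otimes>\<^sub>m \<Delta>) = \<Delta> \<cdot> \<mu>"
    by (simp_all add: bialg_eqs br)
  show ?thesis
    unfolding braided_bialgebra_def Let_def op_bialg_simps op_cat_simps op_strand op_arr_inv
      op_apply op_insert[OF bialg_arr(1)]
    using alg' coalg' yb' br' br bialg_eqs(4,5) by (simp only: arr_inv_arr_inv assoc_iso lunit_iso bialg_arr unit_ob simp_thms)
qed

end

locale indecomposables = braided_bialg +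
  fixes Q :: 'a and q :: 'b
  assumes indec: "is_indecomposables C B Q q"
    and pres_coeq: "tensor_preserves_coequalizers C"
begin

lemma primitives_op: "primitives (op_cat C) (op_bialg B) Q q"
proof -
  interpret op: additive_monoidal_category "op_cat C"
    by (rule additive_monoidal_category_op)
  show ?thesis
    by unfold_locales
      (use braided_bialgebra_op indec pres_coeq in
        \<open>simp_all add: op_tensor_preserves_equalizers is_primitives_def is_indecomposables_def
          op_is_equalizer op_insert\<close>)
qed

interpretation op: primitives "op_cat C" "op_bialg B" Q q
  by (rule primitives_op)

lemma indec_arr [simp]: "q \<in> Arr C" "Dom C q = H" "Cod C q = Q" "Q \<in> Ob C"
  using op.prim_arr by simp_all

lemma ex1_colie_braid:
  "\<exists>!l. l \<in> Hom C (Q \<otimes>\<^sub>o Q) (Q \<otimes>\<^sub>o Q) \<and> l \<cdot> (q \<otimes>\<^sub>m q) = (q \<otimes>\<^sub>m q) \<cdot> \<tau>"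
  using op.ex1_lie_braid by simp

lemma ex1_cobracket:
  "\<exists>!b. b \<in> Hom C Q (Q \<otimes>\<^sub>o Q) \<and> b \<cdot> q = (q \<otimes>\<^sub>m q) \<cdot> (\<one>\<^sub>m (H \<otimes>\<^sub>o H) \<ominus>\<^sub>m \<tau>) \<cdot> \<Delta>"
  using op.ex1_bracket by simp

end

section \<open>Contraction along a pairing\<close>

context monoidal_category
begin

text \<open>The pentagon solved for the mixture of associators and inverses that remains after two
  nested contractions.\<close>

lemma pentagon_mixed:
  assumes [simp]: "W \<in> Ob C" "X \<in> Ob C" "Y \<in> Ob C" "Z \<in> Ob C"
  shows "Ainv W (X \<otimes>\<^sub>o Y) Z \<cdot> (\<one>\<^sub>m W \<otimes>\<^sub>m Ainv X Y Z) \<cdot> Assoc C W X (Y \<otimes>\<^sub>o Z) =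
    (Assoc C W X Y \<otimes>\<^sub>m \<one>\<^sub>m Z) \<cdot> Ainv (W \<otimes>\<^sub>o X) Y Z"
proof (rule iso_cancel_right[of _ "Assoc C (W \<otimes>\<^sub>o X) Y Z"])
  show "(Ainv W (X \<otimes>\<^sub>o Y) Z \<cdot> (\<one>\<^sub>m W \<otimes>\<^sub>m Ainv X Y Z) \<cdot> Assoc C W X (Y \<otimes>\<^sub>o Z)) \<cdot> Assoc C (W \<otimes>\<^sub>o X) Y Z =
    ((Assoc C W X Y \<otimes>\<^sub>m \<one>\<^sub>m Z) \<cdot> Ainv (W \<otimes>\<^sub>o X) Y Z) \<cdot> Assoc C (W \<otimes>\<^sub>o X) Y Z"
    by (simp add: pentagon)
qed simp_all

text \<open>The common core of \<open>pairing_action\<close> and \<open>pairing2\<close>. Once it is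
  isolated, its naturality does the work that suppressed constraints do on paper.\<close>

definition contract :: "'o \<Rightarrow> 'o \<Rightarrow> 'm \<Rightarrow> 'o \<Rightarrow> 'm" where
  "contract X Y p Z = Lunit C Z \<cdot> (p \<otimes>\<^sub>m \<one>\<^sub>m Z) \<cdot> Ainv X Y Z"

lemma contract_arr [simp]:
  assumes "p \<in> Arr C" "Dom C p = X \<otimes>\<^sub>o Y" "Cod C p = I" "X \<in> Ob C" "Y \<in> Ob C" "Z \<in> Ob C"
  shows "contract X Y p Z \<in> Arr C" "Dom C (contract X Y p Z) = X \<otimes>\<^sub>o (Y \<otimes>\<^sub>o Z)"
    "Cod C (contract X Y p Z) = Z"
  using assms by (simp_all add: contract_def)

lemma contract_nat:
  assumes p [simp]: "p \<in> Arr C" "Dom C p = X \<otimes>\<^sub>o Y" "Cod C p = I" "X \<in> Ob C" "Y \<in> Ob C"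
    and f [simp]: "f \<in> Arr C"
  shows "contract X Y p (Cod C f) \<cdot> (\<one>\<^sub>m X \<otimes>\<^sub>m (\<one>\<^sub>m Y \<otimes>\<^sub>m f)) = f \<cdot> contract X Y p (Dom C f)"
proof -
  have "contract X Y p (Cod C f) \<cdot> (\<one>\<^sub>m X \<otimes>\<^sub>m (\<one>\<^sub>m Y \<otimes>\<^sub>m f))
      = Lunit C (Cod C f) \<cdot> (\<one>\<^sub>m I \<otimes>\<^sub>m f) \<cdot> (p \<otimes>\<^sub>m \<one>\<^sub>m (Dom C f)) \<cdot> Ainv X Y (Dom C f)"
    by (simp add: contract_def assoc_inv_nat)
  also have "\<dots> = f \<cdot> contract X Y p (Dom C f)"
    by (subst lunit_nat') (simp_all add: contract_def)
  finally show ?thesis .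
qed

text \<open>If one pairing is written in two ways, with a map on its left or with a map on its
  right, using this for both exchanges a map on one side for its adjoint on the other.\<close>

lemma contract_dinat:
  assumes p [simp]: "p \<in> Arr C" "Dom C p = Cod C f \<otimes>\<^sub>o Cod C g" "Cod C p = I"
    and fg [simp]: "f \<in> Arr C" "g \<in> Arr C" "Z \<in> Ob C"
  shows "contract (Dom C f) (Dom C g) (p \<cdot> (f \<otimes>\<^sub>m g)) Z
    = contract (Cod C f) (Cod C g) p Z \<cdot> (f \<otimes>\<^sub>m (g \<otimes>\<^sub>m \<one>\<^sub>m Z))"
proof -
  have "contract (Cod C f) (Cod C g) p Z \<cdot> (f \<otimes>\<^sub>m (g \<otimes>\<^sub>m \<one>\<^sub>m Z))
     = Lunit C Z \<cdot> (p \<otimes>\<^sub>m \<one>\<^sub>m Z) \<cdot> Ainv (Cod C f) (Cod C g) Z \<cdot> (f \<otimes>\<^sub>m (g \<otimes>\<^sub>m \<one>\<^sub>m Z))"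
    by (simp add: contract_def)
  also have "\<dots> = Lunit C Z \<cdot> (p \<otimes>\<^sub>m \<one>\<^sub>m Z) \<cdot> ((f \<otimes>\<^sub>m g) \<otimes>\<^sub>m \<one>\<^sub>m Z) \<cdot> Ainv (Dom C f) (Dom C g) Z"
    by (subst assoc_inv_nat) simp_all
  finally show ?thesis by (simp add: contract_def)
qed

text \<open>The factor \<open>W\<close> is a bystander. Rebracketed from
  \<open>((X \<otimes> Y) \<otimes> Z) \<otimes> W\<close>, the left side becomes by the pentagon an
  application of \<open>p\<close> to the factor \<open>X \<otimes> Y\<close>, and what remains is
  \<open>lunit_tens\<close>.\<close>

lemma contract_tens:
  assumes p [simp]: "p \<in> Arr C" "Dom C p = X \<otimes>\<^sub>o Y" "Cod C p = I" "X \<in> Ob C" "Y \<in> Ob C"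
    and [simp]: "Z \<in> Ob C" "W \<in> Ob C"
  shows "contract X Y p (Z \<otimes>\<^sub>o W) \<cdot> (\<one>\<^sub>m X \<otimes>\<^sub>m Assoc C Y Z W)
    = (contract X Y p Z \<otimes>\<^sub>m \<one>\<^sub>m W) \<cdot> Ainv X (Y \<otimes>\<^sub>o Z) W"
proof (rule iso_cancel_right[of _ "Assoc C X (Y \<otimes>\<^sub>o Z) W \<cdot> (Assoc C X Y Z \<otimes>\<^sub>m \<one>\<^sub>m W)"])
  have "(contract X Y p (Z \<otimes>\<^sub>o W) \<cdot> (\<one>\<^sub>m X \<otimes>\<^sub>m Assoc C Y Z W))
      \<cdot> Assoc C X (Y \<otimes>\<^sub>o Z) W \<cdot> (Assoc C X Y Z \<otimes>\<^sub>m \<one>\<^sub>m W)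
    = contract X Y p (Z \<otimes>\<^sub>o W) \<cdot> Assoc C X Y (Z \<otimes>\<^sub>o W) \<cdot> Assoc C (X \<otimes>\<^sub>o Y) Z W"
    by (simp add: pentagon)
  also have "\<dots> = Lunit C (Z \<otimes>\<^sub>o W) \<cdot> (p \<otimes>\<^sub>m (\<one>\<^sub>m Z \<otimes>\<^sub>m \<one>\<^sub>m W)) \<cdot> Assoc C (X \<otimes>\<^sub>o Y) Z W"
    by (simp add: contract_def)
  also have "\<dots> = Lunit C (Z \<otimes>\<^sub>o W) \<cdot> Assoc C I Z W \<cdot> ((p \<otimes>\<^sub>m \<one>\<^sub>m Z) \<otimes>\<^sub>m \<one>\<^sub>m W)"
    using assoc_nat[of p "\<one>\<^sub>m Z" "\<one>\<^sub>m W"] by simp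
  also have "\<dots> = (Lunit C Z \<otimes>\<^sub>m \<one>\<^sub>m W) \<cdot> ((p \<otimes>\<^sub>m \<one>\<^sub>m Z) \<otimes>\<^sub>m \<one>\<^sub>m W)"
    by (rule comp_extend1[OF lunit_tens]) simp_all
  also have "\<dots> = ((contract X Y p Z \<otimes>\<^sub>m \<one>\<^sub>m W) \<cdot> Ainv X (Y \<otimes>\<^sub>o Z) W)
      \<cdot> Assoc C X (Y \<otimes>\<^sub>o Z) W \<cdot> (Assoc C X Y Z \<otimes>\<^sub>m \<one>\<^sub>m W)"
    by (simp add: contract_def)
  finally show "(contract X Y p (Z \<otimes>\<^sub>o W) \<cdot> (\<one>\<^sub>m X \<otimes>\<^sub>m Assoc C Y Z W))
      \<cdot> Assoc C X (Y \<otimes>\<^sub>o Z) W \<cdot> (Assoc C X Y Z \<otimes>\<^sub>m \<one>\<^sub>m W)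
    = ((contract X Y p Z \<otimes>\<^sub>m \<one>\<^sub>m W) \<cdot> Ainv X (Y \<otimes>\<^sub>o Z) W)
      \<cdot> Assoc C X (Y \<otimes>\<^sub>o Z) W \<cdot> (Assoc C X Y Z \<otimes>\<^sub>m \<one>\<^sub>m W)" .
qed (simp_all add: iso_comp iso_tens)

lemma pairing2_contract:
  "pairing2 C X Y p = p \<cdot> (\<one>\<^sub>m X \<otimes>\<^sub>m contract X Y p Y) \<cdot> Assoc C X X (Y \<otimes>\<^sub>o Y)"
  by (simp add: pairing2_def contract_def)

lemma pairing2_arr [simp]:
  assumes "p \<in> Arr C" "Dom C p = X \<otimes>\<^sub>o Y" "Cod C p = I" "X \<in> Ob C" "Y \<in> Ob C"
  shows "pairing2 C X Y p \<in> Arr C" "Dom C (pairing2 C X Y p) = (X \<otimes>\<^sub>o X) \<otimes>\<^sub>o (Y \<otimes>\<^sub>o Y)"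
    "Cod C (pairing2 C X Y p) = I"
  using assms by (simp_all add: pairing2_contract)

text \<open>The iterated pairing is itself one contraction followed by \<open>p\<close>.
  \<open>contract_tens\<close> lets the inner contraction ignore \<open>M\<close>, and
  \<open>pentagon_mixed\<close> collects the associators.\<close>

lemma contract_pairing2:
  assumes p [simp]: "p \<in> Arr C" "Dom C p = X \<otimes>\<^sub>o Y" "Cod C p = I" "X \<in> Ob C" "Y \<in> Ob C"
    and [simp]: "M \<in> Ob C"
  shows "contract (X \<otimes>\<^sub>o X) (Y \<otimes>\<^sub>o Y) (pairing2 C X Y p) M
    = contract X Y p M \<cdot> (\<one>\<^sub>m X \<otimes>\<^sub>m contract X Y p (Y \<otimes>\<^sub>o M)) \<cdot> Assoc C X X (Y \<otimes>\<^sub>o Y \<otimes>\<^sub>o M)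
      \<cdot> (\<one>\<^sub>m (X \<otimes>\<^sub>o X) \<otimes>\<^sub>m Assoc C Y Y M)"
proof -
  have "contract X Y p M \<cdot> (\<one>\<^sub>m X \<otimes>\<^sub>m contract X Y p (Y \<otimes>\<^sub>o M)) \<cdot> Assoc C X X (Y \<otimes>\<^sub>o Y \<otimes>\<^sub>o M)
      \<cdot> (\<one>\<^sub>m (X \<otimes>\<^sub>o X) \<otimes>\<^sub>m Assoc C Y Y M)
    = contract X Y p M \<cdot> (\<one>\<^sub>m X \<otimes>\<^sub>m (contract X Y p (Y \<otimes>\<^sub>o M) \<cdot> (\<one>\<^sub>m X \<otimes>\<^sub>m Assoc C Y Y M)))
      \<cdot> Assoc C X X ((Y \<otimes>\<^sub>o Y) \<otimes>\<^sub>o M)"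
    using assoc_nat[of "\<one>\<^sub>m X" "\<one>\<^sub>m X" "Assoc C Y Y M" X X "Y \<otimes>\<^sub>o Y \<otimes>\<^sub>o M"] by simp
  also have "\<dots> = Lunit C M \<cdot> (p \<otimes>\<^sub>m \<one>\<^sub>m M) \<cdot> Ainv X Y M \<cdot> (\<one>\<^sub>m X \<otimes>\<^sub>m (contract X Y p Y \<otimes>\<^sub>m \<one>\<^sub>m M))
      \<cdot> (\<one>\<^sub>m X \<otimes>\<^sub>m Ainv X (Y \<otimes>\<^sub>o Y) M) \<cdot> Assoc C X X ((Y \<otimes>\<^sub>o Y) \<otimes>\<^sub>o M)"
    unfolding contract_tens[OF assms(1-5,5,6)] by (simp add: contract_def[of _ _ _ M])
  also have "\<dots> = Lunit C M \<cdot> (p \<otimes>\<^sub>m \<one>\<^sub>m M) \<cdot> ((\<one>\<^sub>m X \<otimes>\<^sub>m contract X Y p Y) \<otimes>\<^sub>m \<one>\<^sub>m M)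
      \<cdot> Ainv X (X \<otimes>\<^sub>o Y \<otimes>\<^sub>o Y) M
      \<cdot> (\<one>\<^sub>m X \<otimes>\<^sub>m Ainv X (Y \<otimes>\<^sub>o Y) M) \<cdot> Assoc C X X ((Y \<otimes>\<^sub>o Y) \<otimes>\<^sub>o M)"
    by (subst assoc_inv_nat') simp_all
  also have "\<dots> = contract (X \<otimes>\<^sub>o X) (Y \<otimes>\<^sub>o Y) (pairing2 C X Y p) M"
    by (simp add: pentagon_mixed pairing2_contract contract_def[of "X \<otimes>\<^sub>o X"])
  finally show ?thesis ..
qed

lemma pairing_action_contract:
  assumes "p \<in> Arr C" "Dom C p = X \<otimes>\<^sub>o Y" "Cod C p = I" "X \<in> Ob C" "Y \<in> Ob C"
    "d \<in> Hom C M (Y \<otimes>\<^sub>o M)"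
  shows "pairing_action C X Y p (M, d) = (M, contract X Y p M \<cdot> (\<one>\<^sub>m X \<otimes>\<^sub>m d))"
proof -
  have "M \<in> Ob C" using assms(6) by auto
  then show ?thesis using assms by (simp add: pairing_action_def contract_def)
qed

text \<open>Restricting the induced action along \<open>f\<close> amounts to restricting the
  pairing. It serves for the multiplication, the bracket, the braiding and the inclusion
  \<open>e\<close> alike.\<close>

lemma contract_action_comp:
  assumes p [simp]: "p \<in> Arr C" "Dom C p = Cod C f \<otimes>\<^sub>o Y" "Cod C p = I" "Y \<in> Ob C"
    and [simp]: "f \<in> Arr C" "d \<in> Arr C" "Dom C d = M" "Cod C d = Y \<otimes>\<^sub>o M" "M \<in> Ob C"
  shows "(contract (Cod C f) Y p M \<cdot> (\<one>\<^sub>m (Cod C f) \<otimes>\<^sub>m d)) \<cdot> (f \<otimes>\<^sub>m \<one>\<^sub>m M)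
    = contract (Dom C f) Y (p \<cdot> (f \<otimes>\<^sub>m \<one>\<^sub>m Y)) M \<cdot> (\<one>\<^sub>m (Dom C f) \<otimes>\<^sub>m d)"
  using contract_dinat[of p f "\<one>\<^sub>m Y" M] by simp

lemma contract_action_twice:
  assumes p [simp]: "p \<in> Arr C" "Dom C p = X \<otimes>\<^sub>o Y" "Cod C p = I" "X \<in> Ob C" "Y \<in> Ob C"
    and d [simp]: "d \<in> Arr C" "Dom C d = M" "Cod C d = Y \<otimes>\<^sub>o M" "M \<in> Ob C"
    and r_def: "r = contract X Y p M \<cdot> (\<one>\<^sub>m X \<otimes>\<^sub>m d)"
  shows "r \<cdot> (\<one>\<^sub>m X \<otimes>\<^sub>m r) \<cdot> Assoc C X X M
    = contract (X \<otimes>\<^sub>o X) (Y \<otimes>\<^sub>o Y) (pairing2 C X Y p) M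
      \<cdot> (\<one>\<^sub>m (X \<otimes>\<^sub>o X) \<otimes>\<^sub>m (Ainv Y Y M \<cdot> (\<one>\<^sub>m Y \<otimes>\<^sub>m d) \<cdot> d))"
proof -
  have "r \<cdot> (\<one>\<^sub>m X \<otimes>\<^sub>m r) \<cdot> Assoc C X X M
    = contract X Y p M \<cdot> (\<one>\<^sub>m X \<otimes>\<^sub>m ((d \<cdot> contract X Y p M) \<cdot> (\<one>\<^sub>m X \<otimes>\<^sub>m d))) \<cdot> Assoc C X X M"
    by (simp add: r_def)
  \<comment> \<open>By naturality the outer coaction slides under the inner contraction, so that
    both copies of \<open>d\<close> act before anything is contracted.\<close>
  also have "d \<cdot> contract X Y p M = contract X Y p (Y \<otimes>\<^sub>o M) \<cdot> (\<one>\<^sub>m X \<otimes>\<^sub>m (\<one>\<^sub>m Y \<otimes>\<^sub>m d))"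
    using contract_nat[of p X Y d] by simp
  also have "contract X Y p M \<cdot>
      (\<one>\<^sub>m X \<otimes>\<^sub>m ((contract X Y p (Y \<otimes>\<^sub>o M) \<cdot> (\<one>\<^sub>m X \<otimes>\<^sub>m (\<one>\<^sub>m Y \<otimes>\<^sub>m d))) \<cdot> (\<one>\<^sub>m X \<otimes>\<^sub>m d))) \<cdot> Assoc C X X M
    = contract X Y p M \<cdot> (\<one>\<^sub>m X \<otimes>\<^sub>m contract X Y p (Y \<otimes>\<^sub>o M)) \<cdot>
      (\<one>\<^sub>m X \<otimes>\<^sub>m (\<one>\<^sub>m X \<otimes>\<^sub>m ((\<one>\<^sub>m Y \<otimes>\<^sub>m d) \<cdot> d))) \<cdot> Assoc C X X M"
    by simp
  also have "\<dots> = contract X Y p M \<cdot> (\<one>\<^sub>m X \<otimes>\<^sub>m contract X Y p (Y \<otimes>\<^sub>o M)) \<cdot>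
      Assoc C X X (Y \<otimes>\<^sub>o Y \<otimes>\<^sub>o M) \<cdot> (\<one>\<^sub>m (X \<otimes>\<^sub>o X) \<otimes>\<^sub>m ((\<one>\<^sub>m Y \<otimes>\<^sub>m d) \<cdot> d))"
    using assoc_nat[of "\<one>\<^sub>m X" "\<one>\<^sub>m X" "(\<one>\<^sub>m Y \<otimes>\<^sub>m d) \<cdot> d" X X "Y \<otimes>\<^sub>o Y \<otimes>\<^sub>o M"] by simp
  also have "\<dots> = contract (X \<otimes>\<^sub>o X) (Y \<otimes>\<^sub>o Y) (pairing2 C X Y p) M
      \<cdot> (\<one>\<^sub>m (X \<otimes>\<^sub>o X) \<otimes>\<^sub>m (Ainv Y Y M \<cdot> (\<one>\<^sub>m Y \<otimes>\<^sub>m d) \<cdot> d))"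
    by (simp add: contract_pairing2)
  finally show ?thesis .
qed

lemma contract_morphism:
  assumes p [simp]: "p \<in> Arr C" "Dom C p = X \<otimes>\<^sub>o Y" "Cod C p = I" "X \<in> Ob C" "Y \<in> Ob C"
    and d [simp]: "d \<in> Arr C" "Dom C d = M" "Cod C d = Y \<otimes>\<^sub>o M" "d' \<in> Arr C" "Dom C d' = N" "Cod C d' = Y \<otimes>\<^sub>o N"
    and f [simp]: "f \<in> Arr C" "Dom C f = M" "Cod C f = N"
    and mor: "d' \<cdot> f = (\<one>\<^sub>m Y \<otimes>\<^sub>m f) \<cdot> d"
  shows "f \<cdot> contract X Y p M \<cdot> (\<one>\<^sub>m X \<otimes>\<^sub>m d) = (contract X Y p N \<cdot> (\<one>\<^sub>m X \<otimes>\<^sub>m d')) \<cdot> (\<one>\<^sub>m X \<otimes>\<^sub>m f)"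
proof -
  have [simp]: "M \<in> Ob C" "N \<in> Ob C" using dom_ob[OF f(1)] cod_ob[OF f(1)] by simp_all
  have "(contract X Y p N \<cdot> (\<one>\<^sub>m X \<otimes>\<^sub>m d')) \<cdot> (\<one>\<^sub>m X \<otimes>\<^sub>m f)
    = (contract X Y p N \<cdot> (\<one>\<^sub>m X \<otimes>\<^sub>m (\<one>\<^sub>m Y \<otimes>\<^sub>m f))) \<cdot> (\<one>\<^sub>m X \<otimes>\<^sub>m d)"
    by (simp add: mor)
  also have "contract X Y p N \<cdot> (\<one>\<^sub>m X \<otimes>\<^sub>m (\<one>\<^sub>m Y \<otimes>\<^sub>m f)) = f \<cdot> contract X Y p M"
    using contract_nat[of p X Y f] by simp
  finally show ?thesis by simp
qed

lemma contract_lui: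
  assumes p [simp]: "p \<in> Arr C" "Dom C p = X \<otimes>\<^sub>o Y" "Cod C p = I" "Y \<in> Ob C"
    and \<eta> [simp]: "\<eta> \<in> Arr C" "Dom C \<eta> = I" "Cod C \<eta> = X" and [simp]: "Z \<in> Ob C"
  shows "contract X Y p Z \<cdot> left_unit_insert C (Y \<otimes>\<^sub>o Z) \<eta>
    = left_counit_apply C Z (p \<cdot> left_unit_insert C Y \<eta>)"
proof -
  have [simp]: "X \<in> Ob C" using cod_ob[OF \<eta>(1)] by simp
  show ?thesis by (simp add: contract_def left_counit_apply_def assoc_inv_lui)
qed

text \<open>By naturality \<open>\<epsilon>\<close> may be applied before the contraction, which
  then ends in \<open>I\<close> and amounts to removing the trailing unit.\<close>

lemma comp_contract:
  assumes p [simp]: "p \<in> Arr C" "Dom C p = X \<otimes>\<^sub>o Y" "Cod C p = I" "X \<in> Ob C" "Y \<in> Ob C"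
    and \<epsilon> [simp]: "\<epsilon> \<in> Arr C" "Dom C \<epsilon> = Z" "Cod C \<epsilon> = I"
  shows "\<epsilon> \<cdot> contract X Y p Z = p \<cdot> (\<one>\<^sub>m X \<otimes>\<^sub>m right_counit_apply C Y \<epsilon>)"
proof -
  have [simp]: "Z \<in> Ob C" using dom_ob[OF \<epsilon>(1)] by simp
  have R: "\<one>\<^sub>m X \<otimes>\<^sub>m Runit C Y = Runit C (X \<otimes>\<^sub>o Y) \<cdot> Ainv X Y I"
    by (simp add: runit_tens[symmetric])
  have "\<epsilon> \<cdot> contract X Y p Z = contract X Y p I \<cdot> (\<one>\<^sub>m X \<otimes>\<^sub>m (\<one>\<^sub>m Y \<otimes>\<^sub>m \<epsilon>))"
    using contract_nat[of p X Y \<epsilon>] by simp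
  \<comment> \<open>The contraction removes the unit produced by \<open>p\<close>, the counit the
    one produced by \<open>\<epsilon>\<close>. Both constraints agree at \<open>I\<close>, so the
    removal may be switched to the right side.\<close>
  also have "\<dots> = (Runit C I \<cdot> (p \<otimes>\<^sub>m \<one>\<^sub>m I)) \<cdot> Ainv X Y I \<cdot> (\<one>\<^sub>m X \<otimes>\<^sub>m (\<one>\<^sub>m Y \<otimes>\<^sub>m \<epsilon>))"
    by (simp add: contract_def lunit_eq_runit)
  also have "\<dots> = p \<cdot> (Runit C (X \<otimes>\<^sub>o Y) \<cdot> Ainv X Y I) \<cdot> (\<one>\<^sub>m X \<otimes>\<^sub>m (\<one>\<^sub>m Y \<otimes>\<^sub>m \<epsilon>))"
    by (simp add: runit_nat)
  also have "\<dots> = p \<cdot> (\<one>\<^sub>m X \<otimes>\<^sub>m right_counit_apply C Y \<epsilon>)"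
    unfolding R[symmetric] by (simp add: right_counit_apply_def)
  finally show ?thesis .
qed

text \<open>The pairing is nested: the first \<open>X\<close> meets the second \<open>Y\<close> and
  the second \<open>X\<close> meets the first \<open>Y\<close>. A unit inserted on the left
  therefore acts as a functional on the right tensor factor, and conversely.\<close>

lemma pairing2_lui:
  assumes p [simp]: "p \<in> Arr C" "Dom C p = X \<otimes>\<^sub>o Y" "Cod C p = I" "X \<in> Ob C" "Y \<in> Ob C"
    and \<eta> [simp]: "\<eta> \<in> Arr C" "Dom C \<eta> = I" "Cod C \<eta> = X"
  shows "pairing2 C X Y p \<cdot> (left_unit_insert C X \<eta> \<otimes>\<^sub>m \<one>\<^sub>m (Y \<otimes>\<^sub>o Y))
      = p \<cdot> (\<one>\<^sub>m X \<otimes>\<^sub>m right_counit_apply C Y (p \<cdot> left_unit_insert C Y \<eta>))"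
    "pairing2 C X Y p \<cdot> (right_unit_insert C X \<eta> \<otimes>\<^sub>m \<one>\<^sub>m (Y \<otimes>\<^sub>o Y))
      = p \<cdot> (\<one>\<^sub>m X \<otimes>\<^sub>m left_counit_apply C Y (p \<cdot> left_unit_insert C Y \<eta>))"
proof -
  have "pairing2 C X Y p \<cdot> (left_unit_insert C X \<eta> \<otimes>\<^sub>m \<one>\<^sub>m (Y \<otimes>\<^sub>o Y))
    = (p \<cdot> left_unit_insert C Y \<eta>) \<cdot> contract X Y p Y"
    by (simp add: pairing2_contract assoc_lui tens_lui)
  also have "\<dots> = p \<cdot> (\<one>\<^sub>m X \<otimes>\<^sub>m right_counit_apply C Y (p \<cdot> left_unit_insert C Y \<eta>))"
    by (rule comp_contract) simp_all
  finally show "pairing2 C X Y p \<cdot> (left_unit_insert C X \<eta> \<otimes>\<^sub>m \<one>\<^sub>m (Y \<otimes>\<^sub>o Y))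
      = p \<cdot> (\<one>\<^sub>m X \<otimes>\<^sub>m right_counit_apply C Y (p \<cdot> left_unit_insert C Y \<eta>))" .
  show "pairing2 C X Y p \<cdot> (right_unit_insert C X \<eta> \<otimes>\<^sub>m \<one>\<^sub>m (Y \<otimes>\<^sub>o Y))
      = p \<cdot> (\<one>\<^sub>m X \<otimes>\<^sub>m left_counit_apply C Y (p \<cdot> left_unit_insert C Y \<eta>))"
    by (simp add: pairing2_contract assoc_lui contract_lui)
qed

text \<open>One \<open>q\<close> is absorbed by the inner contraction through dinaturality. The
  other slides through it by naturality and reaches the outer pairing, where the relation
  \<open>vq\<close> applies again.\<close>

lemma pairing2_restrict:
  assumes p [simp]: "p \<in> Arr C" "Dom C p = X \<otimes>\<^sub>o Y" "Cod C p = I" "X \<in> Ob C" "Y \<in> Ob C"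
    and v [simp]: "v \<in> Arr C" "Dom C v = P \<otimes>\<^sub>o Q" "Cod C v = I" "P \<in> Ob C" "Q \<in> Ob C"
    and e [simp]: "e \<in> Arr C" "Dom C e = P" "Cod C e = X"
    and q [simp]: "q \<in> Arr C" "Dom C q = Y" "Cod C q = Q"
    and vq: "v \<cdot> (\<one>\<^sub>m P \<otimes>\<^sub>m q) = p \<cdot> (e \<otimes>\<^sub>m \<one>\<^sub>m Y)"
  shows "pairing2 C P Q v \<cdot> (\<one>\<^sub>m (P \<otimes>\<^sub>o P) \<otimes>\<^sub>m (q \<otimes>\<^sub>m q))
    = pairing2 C X Y p \<cdot> ((e \<otimes>\<^sub>m e) \<otimes>\<^sub>m \<one>\<^sub>m (Y \<otimes>\<^sub>o Y))"
proof -
  have "contract P Q v Q \<cdot> (\<one>\<^sub>m P \<otimes>\<^sub>m (q \<otimes>\<^sub>m q)) = (contract P Q v Q \<cdot> (\<one>\<^sub>m P \<otimes>\<^sub>m (\<one>\<^sub>m Q \<otimes>\<^sub>m q))) \<cdot> (\<one>\<^sub>m P \<otimes>\<^sub>m (q \<otimes>\<^sub>m \<one>\<^sub>m Y))"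
    by simp
  also have "contract P Q v Q \<cdot> (\<one>\<^sub>m P \<otimes>\<^sub>m (\<one>\<^sub>m Q \<otimes>\<^sub>m q)) = q \<cdot> contract P Q v Y"
    using contract_nat[of v P Q q] by simp
  also have "(q \<cdot> contract P Q v Y) \<cdot> (\<one>\<^sub>m P \<otimes>\<^sub>m (q \<otimes>\<^sub>m \<one>\<^sub>m Y)) = q \<cdot> contract P Y (v \<cdot> (\<one>\<^sub>m P \<otimes>\<^sub>m q)) Y"
    using contract_dinat[of v "\<one>\<^sub>m P" q Y] by simp
  also have "\<dots> = q \<cdot> contract X Y p Y \<cdot> (e \<otimes>\<^sub>m \<one>\<^sub>m (Y \<otimes>\<^sub>o Y))"
    unfolding vq using contract_dinat[of p e "\<one>\<^sub>m Y" Y] by simp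
  finally have c: "contract P Q v Q \<cdot> (\<one>\<^sub>m P \<otimes>\<^sub>m (q \<otimes>\<^sub>m q)) = q \<cdot> contract X Y p Y \<cdot> (e \<otimes>\<^sub>m \<one>\<^sub>m (Y \<otimes>\<^sub>o Y))" .
  have "pairing2 C P Q v \<cdot> (\<one>\<^sub>m (P \<otimes>\<^sub>o P) \<otimes>\<^sub>m (q \<otimes>\<^sub>m q))
    = v \<cdot> (\<one>\<^sub>m P \<otimes>\<^sub>m (contract P Q v Q \<cdot> (\<one>\<^sub>m P \<otimes>\<^sub>m (q \<otimes>\<^sub>m q)))) \<cdot> Assoc C P P (Y \<otimes>\<^sub>o Y)"
    using assoc_nat[of "\<one>\<^sub>m P" "\<one>\<^sub>m P" "q \<otimes>\<^sub>m q" P P "Q \<otimes>\<^sub>o Q"] by (simp add: pairing2_contract)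
  also have "\<dots> = (v \<cdot> (\<one>\<^sub>m P \<otimes>\<^sub>m q)) \<cdot> (\<one>\<^sub>m P \<otimes>\<^sub>m (contract X Y p Y \<cdot> (e \<otimes>\<^sub>m \<one>\<^sub>m (Y \<otimes>\<^sub>o Y)))) \<cdot> Assoc C P P (Y \<otimes>\<^sub>o Y)"
    unfolding c by simp
  also have "\<dots> = p \<cdot> (\<one>\<^sub>m X \<otimes>\<^sub>m contract X Y p Y) \<cdot> (e \<otimes>\<^sub>m (e \<otimes>\<^sub>m \<one>\<^sub>m (Y \<otimes>\<^sub>o Y))) \<cdot> Assoc C P P (Y \<otimes>\<^sub>o Y)"
    unfolding vq by simp
  also have "\<dots> = pairing2 C X Y p \<cdot> ((e \<otimes>\<^sub>m e) \<otimes>\<^sub>m \<one>\<^sub>m (Y \<otimes>\<^sub>o Y))"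
    using assoc_nat[of e e "\<one>\<^sub>m (Y \<otimes>\<^sub>o Y)" X X "Y \<otimes>\<^sub>o Y"] by (simp add: pairing2_contract)
  finally show ?thesis .
qed

end

section \<open>Lie modules and Lie comodules\<close>

context additive_monoidal_category
begin

lemma coequalizer_universal:
  assumes "is_coequalizer C Q q f g" "h \<in> Arr C" "Dom C h = Dom C q" "h \<cdot> f = h \<cdot> g"
  shows "\<exists>!k. k \<in> Hom C Q (Cod C h) \<and> k \<cdot> q = h"
proof -
  interpret op: additive_monoidal_category "op_cat C"
    by (rule additive_monoidal_category_op)
  show ?thesis
    using op.equalizer_universal[of Q q f g h] assms by (simp add: op_is_equalizer)
qed

lemma coequalizer_epi:
  assumes "is_coequalizer C Q q f g" "h \<in> Hom C Q Z" "k \<in> Hom C Q Z" "h \<cdot> q = k \<cdot> q"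
  shows "h = k"
proof -
  interpret op: additive_monoidal_category "op_cat C"
    by (rule additive_monoidal_category_op)
  show ?thesis
    using op.equalizer_mono[of Q q f g h Z k] assms by (simp add: op_is_equalizer)
qed

lemma tens_minus:
  assumes "f \<in> Arr C" "g \<in> Arr C" "h \<in> Arr C" "Dom C g = Dom C h" "Cod C g = Cod C h"
  shows "(g \<ominus>\<^sub>m h) \<otimes>\<^sub>m f = (g \<otimes>\<^sub>m f) \<ominus>\<^sub>m (h \<otimes>\<^sub>m f)" "f \<otimes>\<^sub>m (g \<ominus>\<^sub>m h) = (f \<otimes>\<^sub>m g) \<ominus>\<^sub>m (f \<otimes>\<^sub>m h)"
proof -
  have "((g \<ominus>\<^sub>m h) \<oplus>\<^sub>m h) \<otimes>\<^sub>m f = ((g \<ominus>\<^sub>m h) \<otimes>\<^sub>m f) \<oplus>\<^sub>m (h \<otimes>\<^sub>m f)"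
    "f \<otimes>\<^sub>m ((g \<ominus>\<^sub>m h) \<oplus>\<^sub>m h) = (f \<otimes>\<^sub>m (g \<ominus>\<^sub>m h)) \<oplus>\<^sub>m (f \<otimes>\<^sub>m h)"
    using assms by (intro tens_add; simp)+
  then show "(g \<ominus>\<^sub>m h) \<otimes>\<^sub>m f = (g \<otimes>\<^sub>m f) \<ominus>\<^sub>m (h \<otimes>\<^sub>m f)" "f \<otimes>\<^sub>m (g \<ominus>\<^sub>m h) = (f \<otimes>\<^sub>m g) \<ominus>\<^sub>m (f \<otimes>\<^sub>m h)"
    using assms by (intro minus_eq_iff[THEN iffD2, symmetric]; simp add: minus_add)+
qed

text \<open>The axiom without subtraction, ready for comparing summands by bilinearity.\<close>

lemma is_lie_module_iff:
  assumes "lie_braid L \<in> Hom C (lie_obj L \<otimes>\<^sub>o lie_obj L) (lie_obj L \<otimes>\<^sub>o lie_obj L)"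
    "bracket L \<in> Hom C (lie_obj L \<otimes>\<^sub>o lie_obj L) (lie_obj L)" "lie_obj L \<in> Ob C"
    "X \<in> Ob C" "r \<in> Hom C (lie_obj L \<otimes>\<^sub>o X) X"
    "rr = r \<cdot> (\<one>\<^sub>m (lie_obj L) \<otimes>\<^sub>m r) \<cdot> Assoc C (lie_obj L) (lie_obj L) X"
  shows "is_lie_module C L (X, r) \<longleftrightarrow>
    rr = r \<cdot> (bracket L \<otimes>\<^sub>m \<one>\<^sub>m X) \<oplus>\<^sub>m rr \<cdot> (lie_braid L \<otimes>\<^sub>m \<one>\<^sub>m X)"
  using assms by (simp add: is_lie_module_def Let_def minus_eq_iff zero_add)

text \<open>Here \<open>dd\<close> includes the final \<open>d\<close>, whereas the definition
  composes with \<open>d\<close> only after subtracting; hence \<open>comp_minus\<close>.\<close>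

lemma is_lie_comodule_iff:
  assumes "colie_braid D \<in> Hom C (colie_obj D \<otimes>\<^sub>o colie_obj D) (colie_obj D \<otimes>\<^sub>o colie_obj D)"
    "cobracket D \<in> Hom C (colie_obj D) (colie_obj D \<otimes>\<^sub>o colie_obj D)" "colie_obj D \<in> Ob C"
    "X \<in> Ob C" "d \<in> Hom C X (colie_obj D \<otimes>\<^sub>o X)"
    "dd = Ainv (colie_obj D) (colie_obj D) X \<cdot> (\<one>\<^sub>m (colie_obj D) \<otimes>\<^sub>m d) \<cdot> d"
  shows "is_lie_comodule C D (X, d) \<longleftrightarrow>
    dd = (cobracket D \<otimes>\<^sub>m \<one>\<^sub>m X) \<cdot> d \<oplus>\<^sub>m (colie_braid D \<otimes>\<^sub>m \<one>\<^sub>m X) \<cdot> dd"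
  using assms by (simp add: is_lie_comodule_def Let_def comp_minus minus_eq_iff zero_add)

section \<open>Categories of structured objects and functors between them\<close>

lemma category_structured:
  assumes "\<And>M. S M \<Longrightarrow> fst M \<in> Ob C" "\<And>M. S M \<Longrightarrow> R M M (\<one>\<^sub>m (fst M))"
    "\<And>M N N' f g. \<lbrakk>S M; S N; S N'; f \<in> Hom C (fst M) (fst N); g \<in> Hom C (fst N) (fst N');
      R M N f; R N N' g\<rbrakk> \<Longrightarrow> R M N' (g \<cdot> f)"
  shows "category (structured_category C S R)"
  by unfold_locales (use assms in \<open>auto simp: structured_category_def Hom_def\<close>)

lemma category_action:
  assumes "A \<in> Ob C" "\<And>M r. S (M, r) \<Longrightarrow> M \<in> Ob C \<and> r \<in> Hom C (A \<otimes>\<^sub>o M) M"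
  shows "category (structured_category C S (action_morphism C A))"
proof (rule category_structured)
  show "action_morphism C A M M (\<one>\<^sub>m (fst M))" if "S M" for M
    using assms that by (cases M) (auto simp: action_morphism_def)
  show "fst M \<in> Ob C" if "S M" for M
    using assms(2) that by (cases M) auto
  fix M N N' f g assume S: "S M" "S N" "S N'" and
    fg: "f \<in> Hom C (fst M) (fst N)" "g \<in> Hom C (fst N) (fst N')"
    "action_morphism C A M N f" "action_morphism C A N N' g"
  obtain M0 r N0 s N0' t where eqs [simp]: "M = (M0, r)" "N = (N0, s)" "N' = (N0', t)"
    by (metis surj_pair)
  have [simp]: "M0 \<in> Ob C" "N0 \<in> Ob C" "N0' \<in> Ob C" "A \<in> Ob C"
    "r \<in> Arr C" "Dom C r = A \<otimes>\<^sub>o M0" "Cod C r = M0" "s \<in> Arr C" "Dom C s = A \<otimes>\<^sub>o N0" "Cod C s = N0"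
    "t \<in> Arr C" "Dom C t = A \<otimes>\<^sub>o N0'" "Cod C t = N0'"
    "f \<in> Arr C" "Dom C f = M0" "Cod C f = N0" "g \<in> Arr C" "Dom C g = N0" "Cod C g = N0'"
    using assms(2)[of M0 r] assms(2)[of N0 s] assms(2)[of N0' t] S fg assms(1) by auto
  have fr: "f \<cdot> r = s \<cdot> (\<one>\<^sub>m A \<otimes>\<^sub>m f)" and gs: "g \<cdot> s = t \<cdot> (\<one>\<^sub>m A \<otimes>\<^sub>m g)"
    using fg by (simp_all add: action_morphism_def)
  have "(g \<cdot> f) \<cdot> r = (g \<cdot> s) \<cdot> (\<one>\<^sub>m A \<otimes>\<^sub>m f)"
    by (simp add: fr)
  then show "action_morphism C A M N' (g \<cdot> f)"
    unfolding gs by (simp add: action_morphism_def)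
qed

lemma category_coaction:
  assumes "A \<in> Ob C" "\<And>M d. S (M, d) \<Longrightarrow> M \<in> Ob C \<and> d \<in> Hom C M (A \<otimes>\<^sub>o M)"
  shows "category (structured_category C S (coaction_morphism C A))"
proof (rule category_structured)
  show "coaction_morphism C A M M (\<one>\<^sub>m (fst M))" if "S M" for M
    using assms that by (cases M) (auto simp: coaction_morphism_def)
  show "fst M \<in> Ob C" if "S M" for M
    using assms(2) that by (cases M) auto
  fix M N N' f g assume S: "S M" "S N" "S N'" and
    fg: "f \<in> Hom C (fst M) (fst N)" "g \<in> Hom C (fst N) (fst N')"
    "coaction_morphism C A M N f" "coaction_morphism C A N N' g"
  obtain M0 r N0 s N0' t where eqs [simp]: "M = (M0, r)" "N = (N0, s)" "N' = (N0', t)"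
    by (metis surj_pair)
  have [simp]: "M0 \<in> Ob C" "N0 \<in> Ob C" "N0' \<in> Ob C" "A \<in> Ob C"
    "r \<in> Arr C" "Cod C r = A \<otimes>\<^sub>o M0" "Dom C r = M0" "s \<in> Arr C" "Cod C s = A \<otimes>\<^sub>o N0" "Dom C s = N0"
    "t \<in> Arr C" "Cod C t = A \<otimes>\<^sub>o N0'" "Dom C t = N0'"
    "f \<in> Arr C" "Dom C f = M0" "Cod C f = N0" "g \<in> Arr C" "Dom C g = N0" "Cod C g = N0'"
    using assms(2)[of M0 r] assms(2)[of N0 s] assms(2)[of N0' t] S fg assms(1) by auto
  have fr: "s \<cdot> f = (\<one>\<^sub>m A \<otimes>\<^sub>m f) \<cdot> r" and gs: "t \<cdot> g = (\<one>\<^sub>m A \<otimes>\<^sub>m g) \<cdot> s"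
    using fg by (simp_all add: coaction_morphism_def)
  have "(t \<cdot> g) \<cdot> f = (\<one>\<^sub>m A \<otimes>\<^sub>m g) \<cdot> (s \<cdot> f)"
    unfolding gs by simp
  then show "coaction_morphism C A M N' (g \<cdot> f)"
    unfolding fr by (simp add: coaction_morphism_def)
qed

end

text \<open>As \<open>structure_functor\<close> keeps the underlying arrow, identities and
  composites are preserved automatically; what remains is that the new structure map is valid and is
  respected by the same arrows.\<close>

lemma cat_functor_structure_functor:
  assumes "category (structured_category C S R)" "category (structured_category C S' R')"
    and "\<And>M. S M \<Longrightarrow> S' (\<phi> M)" "\<And>M. S M \<Longrightarrow> fst (\<phi> M) = fst M"
    and "\<And>M N f. \<lbrakk>S M; S N; f \<in> Hom C (fst M) (fst N); R M N f\<rbrakk> \<Longrightarrow> R' (\<phi> M) (\<phi> N) f"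
  shows "cat_functor (structured_category C S R) (structured_category C S' R') (structure_functor \<phi>)"
  using assms(1,2) unfolding cat_functor_def
  using assms(3-5) by (auto simp: structured_category_def structure_functor_def Hom_def)

section \<open>From modules to Lie modules over the primitives\<close>

context primitives
begin

abbreviation "\<sigma>P \<equiv> lie_braid (prim_lie C B P e)"
abbreviation "\<Lambda>P \<equiv> bracket (prim_lie C B P e)"

lemma lie_obj_prim_lie [simp]: "lie_obj (prim_lie C B P e) = P"
  by (simp add: prim_lie_def)

lemma lie_braid_prim:
  "\<sigma>P \<in> Arr C" "Dom C \<sigma>P = P \<otimes>\<^sub>o P" "Cod C \<sigma>P = P \<otimes>\<^sub>o P" "(e \<otimes>\<^sub>m e) \<cdot> \<sigma>P = \<tau> \<cdot> (e \<otimes>\<^sub>m e)"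
  using theI'[OF ex1_lie_braid] by (simp_all add: prim_lie_def)

lemma bracket_prim:
  "\<Lambda>P \<in> Arr C" "Dom C \<Lambda>P = P \<otimes>\<^sub>o P" "Cod C \<Lambda>P = P"
  "e \<cdot> \<Lambda>P = \<mu> \<cdot> (\<one>\<^sub>m (H \<otimes>\<^sub>o H) \<ominus>\<^sub>m \<tau>) \<cdot> (e \<otimes>\<^sub>m e)"
  using theI'[OF ex1_bracket] by (simp_all add: prim_lie_def)

lemmas [simp] = lie_braid_prim(1-3) bracket_prim(1-3)

lemma bracket_prim_add: "e \<cdot> \<Lambda>P \<oplus>\<^sub>m \<mu> \<cdot> \<tau> \<cdot> (e \<otimes>\<^sub>m e) = \<mu> \<cdot> (e \<otimes>\<^sub>m e)"
  by (simp add: bracket_prim(4) comp_minus minus_add)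

text \<open>By associativity, acting twice by primitives is acting by their product. The product is
  the bracket plus the product after braiding, and the second summand is \<open>rr\<close>
  precomposed with the braiding.\<close>

lemma restrict_lie_module:
  assumes "is_module C B (M, r)"
  shows "is_lie_module C (prim_lie C B P e) (M, r \<cdot> (e \<otimes>\<^sub>m \<one>\<^sub>m M))"
proof -
  have [simp]: "M \<in> Ob C" "r \<in> Arr C" "Dom C r = H \<otimes>\<^sub>o M" "Cod C r = M"
    and r: "r \<cdot> (\<mu> \<otimes>\<^sub>m \<one>\<^sub>m M) = r \<cdot> (\<one>\<^sub>m H \<otimes>\<^sub>m r) \<cdot> Assoc C H H M"
    using assms by (simp_all add: is_module_def)
  define r' where "r' = r \<cdot> (e \<otimes>\<^sub>m \<one>\<^sub>m M)"
  define rr where "rr = r' \<cdot> (\<one>\<^sub>m P \<otimes>\<^sub>m r') \<cdot> Assoc C P P M"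
  have [simp]: "r' \<in> Arr C" "Dom C r' = P \<otimes>\<^sub>o M" "Cod C r' = M"
    by (simp_all add: r'_def)
  have "rr = r \<cdot> (\<one>\<^sub>m H \<otimes>\<^sub>m r) \<cdot> (e \<otimes>\<^sub>m (e \<otimes>\<^sub>m \<one>\<^sub>m M)) \<cdot> Assoc C P P M"
    by (simp add: rr_def r'_def)
  also have "\<dots> = (r \<cdot> (\<one>\<^sub>m H \<otimes>\<^sub>m r) \<cdot> Assoc C H H M) \<cdot> ((e \<otimes>\<^sub>m e) \<otimes>\<^sub>m \<one>\<^sub>m M)"
    using assoc_nat[of e e "\<one>\<^sub>m M" H H M] by simp
  also have "\<dots> = r \<cdot> ((\<mu> \<cdot> (e \<otimes>\<^sub>m e)) \<otimes>\<^sub>m \<one>\<^sub>m M)"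
    unfolding r[symmetric] by simp
  finally have rr: "rr = r \<cdot> ((\<mu> \<cdot> (e \<otimes>\<^sub>m e)) \<otimes>\<^sub>m \<one>\<^sub>m M)" .
  also have "\<dots> = r' \<cdot> (\<Lambda>P \<otimes>\<^sub>m \<one>\<^sub>m M) \<oplus>\<^sub>m r \<cdot> ((\<mu> \<cdot> \<tau> \<cdot> (e \<otimes>\<^sub>m e)) \<otimes>\<^sub>m \<one>\<^sub>m M)"
    unfolding bracket_prim_add[symmetric] by (simp add: tens_add comp_add r'_def)
  also have "r \<cdot> ((\<mu> \<cdot> \<tau> \<cdot> (e \<otimes>\<^sub>m e)) \<otimes>\<^sub>m \<one>\<^sub>m M) = rr \<cdot> (\<sigma>P \<otimes>\<^sub>m \<one>\<^sub>m M)"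
    unfolding rr lie_braid_prim(4)[symmetric] by simp
  finally have "rr = r' \<cdot> (\<Lambda>P \<otimes>\<^sub>m \<one>\<^sub>m M) \<oplus>\<^sub>m rr \<cdot> (\<sigma>P \<otimes>\<^sub>m \<one>\<^sub>m M)" .
  then have "is_lie_module C (prim_lie C B P e) (M, r')"
    by (subst is_lie_module_iff[where rr = rr]) (simp_all add: rr_def [symmetric])
  then show ?thesis unfolding r'_def .
qed

end

section \<open>From comodules to Lie comodules over the indecomposables\<close>

context indecomposables
begin

abbreviation "\<gamma>Q \<equiv> colie_braid (indec_colie C B Q q)"
abbreviation "\<Upsilon>Q \<equiv> cobracket (indec_colie C B Q q)"

lemma colie_obj_indec_colie [simp]: "colie_obj (indec_colie C B Q q) = Q"
  by (simp add: indec_colie_def)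

lemma colie_braid_indec:
  "\<gamma>Q \<in> Arr C" "Dom C \<gamma>Q = Q \<otimes>\<^sub>o Q" "Cod C \<gamma>Q = Q \<otimes>\<^sub>o Q" "\<gamma>Q \<cdot> (q \<otimes>\<^sub>m q) = (q \<otimes>\<^sub>m q) \<cdot> \<tau>"
  using theI'[OF ex1_colie_braid] by (simp_all add: indec_colie_def)

lemma cobracket_indec:
  "\<Upsilon>Q \<in> Arr C" "Dom C \<Upsilon>Q = Q" "Cod C \<Upsilon>Q = Q \<otimes>\<^sub>o Q"
  "\<Upsilon>Q \<cdot> q = (q \<otimes>\<^sub>m q) \<cdot> (\<one>\<^sub>m (H \<otimes>\<^sub>o H) \<ominus>\<^sub>m \<tau>) \<cdot> \<Delta>"
  using theI'[OF ex1_cobracket] by (simp_all add: indec_colie_def)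

lemmas [simp] = colie_braid_indec(1-3) cobracket_indec(1-3)

lemma cobracket_indec_add: "\<Upsilon>Q \<cdot> q \<oplus>\<^sub>m (q \<otimes>\<^sub>m q) \<cdot> \<tau> \<cdot> \<Delta> = (q \<otimes>\<^sub>m q) \<cdot> \<Delta>"
  by (simp add: cobracket_indec(4) comp_minus minus_add)

text \<open>The mirror of \<open>restrict_lie_module\<close>: coassociativity expresses the iterated
  coaction through \<open>\<Delta>\<close>, and \<open>cobracket_indec_add\<close> splits the
  result.\<close>

lemma corestrict_lie_comodule:
  assumes "is_comodule C B (M, d)"
  shows "is_lie_comodule C (indec_colie C B Q q) (M, (q \<otimes>\<^sub>m \<one>\<^sub>m M) \<cdot> d)"
proof -
  have [simp]: "M \<in> Ob C" "d \<in> Arr C" "Dom C d = M" "Cod C d = H \<otimes>\<^sub>o M"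
    and d: "Assoc C H H M \<cdot> (\<Delta> \<otimes>\<^sub>m \<one>\<^sub>m M) \<cdot> d = (\<one>\<^sub>m H \<otimes>\<^sub>m d) \<cdot> d"
    using assms by (simp_all add: is_comodule_def)
  define d' where "d' = (q \<otimes>\<^sub>m \<one>\<^sub>m M) \<cdot> d"
  define dd where "dd = Ainv Q Q M \<cdot> (\<one>\<^sub>m Q \<otimes>\<^sub>m d') \<cdot> d'"
  have [simp]: "d' \<in> Arr C" "Dom C d' = M" "Cod C d' = Q \<otimes>\<^sub>o M"
    by (simp_all add: d'_def)
  have "dd = Ainv Q Q M \<cdot> (q \<otimes>\<^sub>m (q \<otimes>\<^sub>m \<one>\<^sub>m M)) \<cdot> ((\<one>\<^sub>m H \<otimes>\<^sub>m d) \<cdot> d)"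
    by (simp add: dd_def d'_def)
  also have "\<dots> = ((q \<otimes>\<^sub>m q) \<otimes>\<^sub>m \<one>\<^sub>m M) \<cdot> Ainv H H M \<cdot> (\<one>\<^sub>m H \<otimes>\<^sub>m d) \<cdot> d"
    by (subst assoc_inv_nat') simp_all
  also have "\<dots> = (((q \<otimes>\<^sub>m q) \<cdot> \<Delta>) \<otimes>\<^sub>m \<one>\<^sub>m M) \<cdot> d"
    unfolding d[symmetric] by simp
  finally have dd: "dd = (((q \<otimes>\<^sub>m q) \<cdot> \<Delta>) \<otimes>\<^sub>m \<one>\<^sub>m M) \<cdot> d" .
  also have "\<dots> = (\<Upsilon>Q \<otimes>\<^sub>m \<one>\<^sub>m M) \<cdot> d' \<oplus>\<^sub>m (((q \<otimes>\<^sub>m q) \<cdot> \<tau> \<cdot> \<Delta>) \<otimes>\<^sub>m \<one>\<^sub>m M) \<cdot> d"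
    unfolding cobracket_indec_add[symmetric] by (simp add: tens_add comp_add d'_def)
  also have "(q \<otimes>\<^sub>m q) \<cdot> \<tau> \<cdot> \<Delta> = \<gamma>Q \<cdot> (q \<otimes>\<^sub>m q) \<cdot> \<Delta>"
    using comp_extend[OF colie_braid_indec(4), of \<Delta>] by simp
  also have "((\<gamma>Q \<cdot> (q \<otimes>\<^sub>m q) \<cdot> \<Delta>) \<otimes>\<^sub>m \<one>\<^sub>m M) \<cdot> d = (\<gamma>Q \<otimes>\<^sub>m \<one>\<^sub>m M) \<cdot> dd"
    unfolding dd by simp
  finally have "dd = (\<Upsilon>Q \<otimes>\<^sub>m \<one>\<^sub>m M) \<cdot> d' \<oplus>\<^sub>m (\<gamma>Q \<otimes>\<^sub>m \<one>\<^sub>m M) \<cdot> dd" .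
  then have "is_lie_comodule C (indec_colie C B Q q) (M, d')"
    using is_lie_comodule_iff[of "indec_colie C B Q q" M d' dd] by (simp add: dd_def)
  then show ?thesis unfolding d'_def .
qed

end

section \<open>The induced pairing\<close>

locale lie_takeuchi = additive_monoidal_category C +
  prim: primitives C BH P e + indec: indecomposables C BK Q q
  for C :: "('o, 'm) addmon_data" (structure) and BH BK :: "('o, 'm) bialg_data"
    and P Q :: 'o and e q :: 'm +
  fixes p :: 'm
  assumes takeuchi: "takeuchi_pair C BH BK p"
begin

abbreviation "H \<equiv> obj BH"
abbreviation "K \<equiv> obj BK"
abbreviation "p2 \<equiv> pairing2 C H K p"
abbreviation "ev \<equiv> ev_pairing C BK p P e Q q"
abbreviation "ev2 \<equiv> pairing2 C P Q ev"

lemma takeuchi_simps: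
  "p \<in> Arr C" "Dom C p = H \<otimes>\<^sub>o K" "Cod C p = I"
  "p \<cdot> left_unit_insert C K (unt BH) = counit BK"
  "p \<cdot> (mul BH \<otimes>\<^sub>m \<one>\<^sub>m K) = p2 \<cdot> (\<one>\<^sub>m (H \<otimes>\<^sub>o H) \<otimes>\<^sub>m comul BK)"
  "p \<cdot> (\<one>\<^sub>m H \<otimes>\<^sub>m mul BK) = p2 \<cdot> (comul BH \<otimes>\<^sub>m \<one>\<^sub>m (K \<otimes>\<^sub>o K))"
  "p2 \<cdot> (braid BH \<otimes>\<^sub>m \<one>\<^sub>m (K \<otimes>\<^sub>o K)) = p2 \<cdot> (\<one>\<^sub>m (H \<otimes>\<^sub>o H) \<otimes>\<^sub>m braid BK)"
  using takeuchi by (simp_all add: takeuchi_pair_def Let_def)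

lemmas [simp] = takeuchi_simps(1-3)

lemma indec_coequalizers:
  assumes "X \<in> Ob C"
  shows "is_coequalizer C (X \<otimes>\<^sub>o Q) (\<one>\<^sub>m X \<otimes>\<^sub>m q) (\<one>\<^sub>m X \<otimes>\<^sub>m mul BK)
      (\<one>\<^sub>m X \<otimes>\<^sub>m (left_counit_apply C K (counit BK) \<oplus>\<^sub>m right_counit_apply C K (counit BK)))"
    "is_coequalizer C (Q \<otimes>\<^sub>o X) (q \<otimes>\<^sub>m \<one>\<^sub>m X) (mul BK \<otimes>\<^sub>m \<one>\<^sub>m X)
      ((left_counit_apply C K (counit BK) \<oplus>\<^sub>m right_counit_apply C K (counit BK)) \<otimes>\<^sub>m \<one>\<^sub>m X)"
  using indec.pres_coeq indec.indec assms
  unfolding tensor_preserves_coequalizers_def is_indecomposables_def by blast+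

text \<open>A primitive pairs with a product like a derivation at the counit:
  \<open>p(x, ab) = p(x, a)\<epsilon>(b) + \<epsilon>(a)p(x, b)\<close>. This is the condition for
  factoring through \<open>P \<otimes> q\<close>, a coequalizer by preservation.\<close>

lemma ex1_ev: "\<exists>!v. v \<in> Hom C (P \<otimes>\<^sub>o Q) I \<and> v \<cdot> (\<one>\<^sub>m P \<otimes>\<^sub>m q) = p \<cdot> (e \<otimes>\<^sub>m \<one>\<^sub>m K)"
proof -
  let ?l = "left_counit_apply C K (counit BK)" and ?r = "right_counit_apply C K (counit BK)"
  have arr [simp]: "?l \<in> Arr C" "Dom C ?l = K \<otimes>\<^sub>o K" "Cod C ?l = K"
    "?r \<in> Arr C" "Dom C ?r = K \<otimes>\<^sub>o K" "Cod C ?r = K"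
    by (simp_all add: left_counit_apply_def right_counit_apply_def)
  have ins: "p2 \<cdot> (left_unit_insert C H (unt BH) \<otimes>\<^sub>m \<one>\<^sub>m (K \<otimes>\<^sub>o K)) = p \<cdot> (\<one>\<^sub>m H \<otimes>\<^sub>m ?r)"
    "p2 \<cdot> (right_unit_insert C H (unt BH) \<otimes>\<^sub>m \<one>\<^sub>m (K \<otimes>\<^sub>o K)) = p \<cdot> (\<one>\<^sub>m H \<otimes>\<^sub>m ?l)"
    using pairing2_lui[of p H K "unt BH"] by (simp_all add: takeuchi_simps)
  have "(p \<cdot> (e \<otimes>\<^sub>m \<one>\<^sub>m K)) \<cdot> (\<one>\<^sub>m P \<otimes>\<^sub>m mul BK) = (p \<cdot> (\<one>\<^sub>m H \<otimes>\<^sub>m mul BK)) \<cdot> (e \<otimes>\<^sub>m \<one>\<^sub>m (K \<otimes>\<^sub>o K))"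
    by simp
  also have "\<dots> = p2 \<cdot> ((comul BH \<cdot> e) \<otimes>\<^sub>m \<one>\<^sub>m (K \<otimes>\<^sub>o K))"
    unfolding takeuchi_simps by simp
  also have "\<dots> = (p2 \<cdot> (left_unit_insert C H (unt BH) \<otimes>\<^sub>m \<one>\<^sub>m (K \<otimes>\<^sub>o K))) \<cdot> (e \<otimes>\<^sub>m \<one>\<^sub>m (K \<otimes>\<^sub>o K))
      \<oplus>\<^sub>m (p2 \<cdot> (right_unit_insert C H (unt BH) \<otimes>\<^sub>m \<one>\<^sub>m (K \<otimes>\<^sub>o K))) \<cdot> (e \<otimes>\<^sub>m \<one>\<^sub>m (K \<otimes>\<^sub>o K))"
    unfolding prim.comul_prim by (simp add: tens_add comp_add)
  \<comment> \<open>The nested pairing exchanges left and right insertions, so the summands arrive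
    in the opposite order.\<close>
  also have "\<dots> = (p \<cdot> (e \<otimes>\<^sub>m \<one>\<^sub>m K)) \<cdot> (\<one>\<^sub>m P \<otimes>\<^sub>m (?l \<oplus>\<^sub>m ?r))"
    unfolding ins by (simp add: tens_add comp_add add_commute)
  finally show ?thesis
    using coequalizer_universal[OF indec_coequalizers(1)[of P], of "p \<cdot> (e \<otimes>\<^sub>m \<one>\<^sub>m K)"] by simp
qed

lemma ev_arr [simp]: "ev \<in> Arr C" "Dom C ev = P \<otimes>\<^sub>o Q" "Cod C ev = I"
  and ev_coeq: "ev \<cdot> (\<one>\<^sub>m P \<otimes>\<^sub>m q) = p \<cdot> (e \<otimes>\<^sub>m \<one>\<^sub>m K)"
  using theI'[OF ex1_ev] by (simp_all add: ev_pairing_def)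

lemma ev2_coeq: "ev2 \<cdot> (\<one>\<^sub>m (P \<otimes>\<^sub>o P) \<otimes>\<^sub>m (q \<otimes>\<^sub>m q)) = p2 \<cdot> ((e \<otimes>\<^sub>m e) \<otimes>\<^sub>m \<one>\<^sub>m (K \<otimes>\<^sub>o K))"
  by (rule pairing2_restrict) (simp_all add: ev_coeq)

lemma ev2_coeq':
  assumes "f \<in> Arr C" "g \<in> Arr C" "Cod C f = P \<otimes>\<^sub>o P" "Cod C g = K \<otimes>\<^sub>o K"
  shows "ev2 \<cdot> (f \<otimes>\<^sub>m ((q \<otimes>\<^sub>m q) \<cdot> g)) = p2 \<cdot> (((e \<otimes>\<^sub>m e) \<cdot> f) \<otimes>\<^sub>m g)"
  using comp_extend[OF ev2_coeq, of "f \<otimes>\<^sub>m g"] assms by simp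

lemma ev2_braid: "ev2 \<cdot> (prim.\<sigma>P \<otimes>\<^sub>m \<one>\<^sub>m (Q \<otimes>\<^sub>o Q)) = ev2 \<cdot> (\<one>\<^sub>m (P \<otimes>\<^sub>o P) \<otimes>\<^sub>m indec.\<gamma>Q)"
proof -
  let ?E = "(e \<otimes>\<^sub>m e) \<otimes>\<^sub>m \<one>\<^sub>m (K \<otimes>\<^sub>o K)"
  have "(ev2 \<cdot> (prim.\<sigma>P \<otimes>\<^sub>m \<one>\<^sub>m (Q \<otimes>\<^sub>o Q))) \<cdot> (\<one>\<^sub>m (P \<otimes>\<^sub>o P) \<otimes>\<^sub>m (q \<otimes>\<^sub>m q))
      = (p2 \<cdot> (braid BH \<otimes>\<^sub>m \<one>\<^sub>m (K \<otimes>\<^sub>o K))) \<cdot> ?E"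
    using ev2_coeq'[of prim.\<sigma>P "\<one>\<^sub>m (K \<otimes>\<^sub>o K)"] by (simp add: prim.lie_braid_prim(4))
  also have "\<dots> = (ev2 \<cdot> (\<one>\<^sub>m (P \<otimes>\<^sub>o P) \<otimes>\<^sub>m indec.\<gamma>Q)) \<cdot> (\<one>\<^sub>m (P \<otimes>\<^sub>o P) \<otimes>\<^sub>m (q \<otimes>\<^sub>m q))"
    unfolding takeuchi_simps
    using ev2_coeq'[of "\<one>\<^sub>m (P \<otimes>\<^sub>o P)" "braid BK"] by (simp add: indec.colie_braid_indec(4))
  finally have eq: "(ev2 \<cdot> (prim.\<sigma>P \<otimes>\<^sub>m \<one>\<^sub>m (Q \<otimes>\<^sub>o Q))) \<cdot> (\<one>\<^sub>m (P \<otimes>\<^sub>o P) \<otimes>\<^sub>m (q \<otimes>\<^sub>m q))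
      = (ev2 \<cdot> (\<one>\<^sub>m (P \<otimes>\<^sub>o P) \<otimes>\<^sub>m indec.\<gamma>Q)) \<cdot> (\<one>\<^sub>m (P \<otimes>\<^sub>o P) \<otimes>\<^sub>m (q \<otimes>\<^sub>m q))" .
  \<comment> \<open>\<open>q \<otimes> q\<close> is cancelled in two stages:
    \<open>q \<otimes> Q\<close> and \<open>K \<otimes> q\<close> are coequalizers, and remain so
    after tensoring with \<open>P \<otimes> P\<close>.\<close>
  have split: "(f \<cdot> (\<one>\<^sub>m (P \<otimes>\<^sub>o P) \<otimes>\<^sub>m (q \<otimes>\<^sub>m \<one>\<^sub>m Q))) \<cdot> (\<one>\<^sub>m (P \<otimes>\<^sub>o P) \<otimes>\<^sub>m (\<one>\<^sub>m K \<otimes>\<^sub>m q))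
      = f \<cdot> (\<one>\<^sub>m (P \<otimes>\<^sub>o P) \<otimes>\<^sub>m (q \<otimes>\<^sub>m q))"
    if "f \<in> Arr C" "Dom C f = (P \<otimes>\<^sub>o P) \<otimes>\<^sub>o (Q \<otimes>\<^sub>o Q)" for f
    using that by simp
  have epi1: "is_coequalizer C ((P \<otimes>\<^sub>o P) \<otimes>\<^sub>o (Q \<otimes>\<^sub>o Q)) (\<one>\<^sub>m (P \<otimes>\<^sub>o P) \<otimes>\<^sub>m (q \<otimes>\<^sub>m \<one>\<^sub>m Q))
      (\<one>\<^sub>m (P \<otimes>\<^sub>o P) \<otimes>\<^sub>m (mul BK \<otimes>\<^sub>m \<one>\<^sub>m Q)) (\<one>\<^sub>m (P \<otimes>\<^sub>o P) \<otimes>\<^sub>m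
        ((left_counit_apply C K (counit BK) \<oplus>\<^sub>m right_counit_apply C K (counit BK)) \<otimes>\<^sub>m \<one>\<^sub>m Q))"
    and epi2: "is_coequalizer C ((P \<otimes>\<^sub>o P) \<otimes>\<^sub>o (K \<otimes>\<^sub>o Q)) (\<one>\<^sub>m (P \<otimes>\<^sub>o P) \<otimes>\<^sub>m (\<one>\<^sub>m K \<otimes>\<^sub>m q))
      (\<one>\<^sub>m (P \<otimes>\<^sub>o P) \<otimes>\<^sub>m (\<one>\<^sub>m K \<otimes>\<^sub>m mul BK)) (\<one>\<^sub>m (P \<otimes>\<^sub>o P) \<otimes>\<^sub>m
        (\<one>\<^sub>m K \<otimes>\<^sub>m (left_counit_apply C K (counit BK) \<oplus>\<^sub>m right_counit_apply C K (counit BK))))"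
    using indec.pres_coeq indec_coequalizers(2)[of Q] indec_coequalizers(1)[of K]
      tens_ob[of P P]
    unfolding tensor_preserves_coequalizers_def by simp_all
  have "(ev2 \<cdot> (prim.\<sigma>P \<otimes>\<^sub>m \<one>\<^sub>m (Q \<otimes>\<^sub>o Q))) \<cdot> (\<one>\<^sub>m (P \<otimes>\<^sub>o P) \<otimes>\<^sub>m (q \<otimes>\<^sub>m \<one>\<^sub>m Q))
    = (ev2 \<cdot> (\<one>\<^sub>m (P \<otimes>\<^sub>o P) \<otimes>\<^sub>m indec.\<gamma>Q)) \<cdot> (\<one>\<^sub>m (P \<otimes>\<^sub>o P) \<otimes>\<^sub>m (q \<otimes>\<^sub>m \<one>\<^sub>m Q))"
    by (rule coequalizer_epi[OF epi2]; (subst split)?; (subst split)?) (simp_all add: eq[simplified])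
  then show ?thesis
    by - (rule coequalizer_epi[OF epi1, where Z = I], simp_all)
qed

text \<open>Bracket and cobracket are adjoint because both arise from \<open>1 - \<tau>\<close>,
  followed by the multiplication of \<open>H\<close> or preceded by the comultiplication of
  \<open>K\<close>. The Takeuchi axioms make the ingredients adjoint under the iterated
  pairing.\<close>

lemma ev_bracket: "ev \<cdot> (prim.\<Lambda>P \<otimes>\<^sub>m \<one>\<^sub>m Q) = ev2 \<cdot> (\<one>\<^sub>m (P \<otimes>\<^sub>o P) \<otimes>\<^sub>m indec.\<Upsilon>Q)"
proof (rule coequalizer_epi[OF indec_coequalizers(1)[of "P \<otimes>\<^sub>o P"], where Z = I])
  let ?mH = "\<one>\<^sub>m (H \<otimes>\<^sub>o H) \<ominus>\<^sub>m braid BH" and ?mK = "\<one>\<^sub>m (K \<otimes>\<^sub>o K) \<ominus>\<^sub>m braid BK"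
  let ?E = "(e \<otimes>\<^sub>m e) \<otimes>\<^sub>m comul BK"
  have "(ev \<cdot> (prim.\<Lambda>P \<otimes>\<^sub>m \<one>\<^sub>m Q)) \<cdot> (\<one>\<^sub>m (P \<otimes>\<^sub>o P) \<otimes>\<^sub>m q) = (ev \<cdot> (\<one>\<^sub>m P \<otimes>\<^sub>m q)) \<cdot> (prim.\<Lambda>P \<otimes>\<^sub>m \<one>\<^sub>m K)"
    by simp
  also have "\<dots> = p \<cdot> ((e \<cdot> prim.\<Lambda>P) \<otimes>\<^sub>m \<one>\<^sub>m K)"
    unfolding ev_coeq by simp
  also have "\<dots> = (p \<cdot> (mul BH \<otimes>\<^sub>m \<one>\<^sub>m K)) \<cdot> ((?mH \<cdot> (e \<otimes>\<^sub>m e)) \<otimes>\<^sub>m \<one>\<^sub>m K)"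
    unfolding prim.bracket_prim(4) by simp
  also have "\<dots> = (p2 \<cdot> (?mH \<otimes>\<^sub>m \<one>\<^sub>m (K \<otimes>\<^sub>o K))) \<cdot> ?E"
    unfolding takeuchi_simps by simp
  \<comment> \<open>The factor \<open>1 - \<tau>\<close> crosses the pairing, from \<open>H\<close>
    to \<open>K\<close>.\<close>
  also have "p2 \<cdot> (?mH \<otimes>\<^sub>m \<one>\<^sub>m (K \<otimes>\<^sub>o K)) = p2 \<cdot> (\<one>\<^sub>m (H \<otimes>\<^sub>o H) \<otimes>\<^sub>m ?mK)"
    by (simp add: tens_minus comp_minus takeuchi_simps)
  also have "(p2 \<cdot> (\<one>\<^sub>m (H \<otimes>\<^sub>o H) \<otimes>\<^sub>m ?mK)) \<cdot> ?E = p2 \<cdot> ((e \<otimes>\<^sub>m e) \<otimes>\<^sub>m (?mK \<cdot> comul BK))"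
    by simp
  also have "\<dots> = ev2 \<cdot> (\<one>\<^sub>m (P \<otimes>\<^sub>o P) \<otimes>\<^sub>m ((q \<otimes>\<^sub>m q) \<cdot> ?mK \<cdot> comul BK))"
    using ev2_coeq'[of "\<one>\<^sub>m (P \<otimes>\<^sub>o P)" "?mK \<cdot> comul BK"] by simp
  also have "\<dots> = (ev2 \<cdot> (\<one>\<^sub>m (P \<otimes>\<^sub>o P) \<otimes>\<^sub>m indec.\<Upsilon>Q)) \<cdot> (\<one>\<^sub>m (P \<otimes>\<^sub>o P) \<otimes>\<^sub>m q)"
    unfolding indec.cobracket_indec(4)[symmetric] by simp
  finally show "(ev \<cdot> (prim.\<Lambda>P \<otimes>\<^sub>m \<one>\<^sub>m Q)) \<cdot> (\<one>\<^sub>m (P \<otimes>\<^sub>o P) \<otimes>\<^sub>m q)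
      = (ev2 \<cdot> (\<one>\<^sub>m (P \<otimes>\<^sub>o P) \<otimes>\<^sub>m indec.\<Upsilon>Q)) \<cdot> (\<one>\<^sub>m (P \<otimes>\<^sub>o P) \<otimes>\<^sub>m q)" .
qed simp_all

section \<open>Actions induced by coactions, and the square on objects\<close>

lemma pairing_action_module:
  assumes "is_comodule C BK (M, d)"
  shows "is_module C BH (pairing_action C H K p (M, d))"
proof -
  have [simp]: "M \<in> Ob C" "d \<in> Arr C" "Dom C d = M" "Cod C d = K \<otimes>\<^sub>o M"
    and d: "Assoc C K K M \<cdot> (comul BK \<otimes>\<^sub>m \<one>\<^sub>m M) \<cdot> d = (\<one>\<^sub>m K \<otimes>\<^sub>m d) \<cdot> d"
    and counit: "left_counit_apply C M (counit BK) \<cdot> d = \<one>\<^sub>m M"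
    using assms by (simp_all add: is_comodule_def)
  define r where "r = contract H K p M \<cdot> (\<one>\<^sub>m H \<otimes>\<^sub>m d)"
  have [simp]: "r \<in> Arr C" "Dom C r = H \<otimes>\<^sub>o M" "Cod C r = M"
    by (simp_all add: r_def)
  have "r \<cdot> (mul BH \<otimes>\<^sub>m \<one>\<^sub>m M)
      = contract (H \<otimes>\<^sub>o H) K (p \<cdot> (mul BH \<otimes>\<^sub>m \<one>\<^sub>m K)) M \<cdot> (\<one>\<^sub>m (H \<otimes>\<^sub>o H) \<otimes>\<^sub>m d)"
    unfolding r_def using contract_action_comp[of p "mul BH" K d M] by simp
  also have "\<dots> = (contract (H \<otimes>\<^sub>o H) (K \<otimes>\<^sub>o K) p2 M \<cdot> (\<one>\<^sub>m (H \<otimes>\<^sub>o H) \<otimes>\<^sub>m (comul BK \<otimes>\<^sub>m \<one>\<^sub>m M)))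
      \<cdot> (\<one>\<^sub>m (H \<otimes>\<^sub>o H) \<otimes>\<^sub>m d)"
    unfolding takeuchi_simps using contract_dinat[of p2 "\<one>\<^sub>m (H \<otimes>\<^sub>o H)" "comul BK" M] by simp
  also have "\<dots> = contract (H \<otimes>\<^sub>o H) (K \<otimes>\<^sub>o K) p2 M
      \<cdot> (\<one>\<^sub>m (H \<otimes>\<^sub>o H) \<otimes>\<^sub>m (Ainv K K M \<cdot> (\<one>\<^sub>m K \<otimes>\<^sub>m d) \<cdot> d))"
    unfolding d[symmetric] by simp
  also have "\<dots> = r \<cdot> (\<one>\<^sub>m H \<otimes>\<^sub>m r) \<cdot> Assoc C H H M"
    by (rule contract_action_twice[symmetric]) (simp_all add: r_def)
  finally have mul: "r \<cdot> (mul BH \<otimes>\<^sub>m \<one>\<^sub>m M) = r \<cdot> (\<one>\<^sub>m H \<otimes>\<^sub>m r) \<cdot> Assoc C H H M" .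
  \<comment> \<open>Pairing with the unit of \<open>H\<close> is the counit of \<open>K\<close>, so
    unitality of the action is counitality of \<open>d\<close>.\<close>
  have "r \<cdot> left_unit_insert C M (unt BH) = (contract H K p M \<cdot> left_unit_insert C (K \<otimes>\<^sub>o M) (unt BH)) \<cdot> d"
    by (simp add: r_def tens_lui)
  also have "\<dots> = \<one>\<^sub>m M"
    using contract_lui[of p H K "unt BH" M] by (simp add: takeuchi_simps counit)
  finally have "r \<cdot> left_unit_insert C M (unt BH) = \<one>\<^sub>m M" .
  with mul show ?thesis
    using pairing_action_contract[of p H K d M] by (simp add: is_module_def r_def [symmetric])
qed

text \<open>Contraction along \<open>ev2\<close> is additive and carries the comodule axiom to the
  module axiom term by term: the iterated coaction to \<open>rr\<close>, the cobracket term to the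
  bracket term, the braided term to the braided term.\<close>

lemma pairing_action_lie_module:
  assumes "is_lie_comodule C (indec_colie C BK Q q) (M, d)"
  shows "is_lie_module C (prim_lie C BH P e) (pairing_action C P Q ev (M, d))"
proof -
  have [simp]: "M \<in> Ob C" "d \<in> Arr C" "Dom C d = M" "Cod C d = Q \<otimes>\<^sub>o M"
    using assms by (simp_all add: is_lie_comodule_def Let_def)
  define dd where "dd = Ainv Q Q M \<cdot> (\<one>\<^sub>m Q \<otimes>\<^sub>m d) \<cdot> d"
  define r where "r = contract P Q ev M \<cdot> (\<one>\<^sub>m P \<otimes>\<^sub>m d)"
  define rr where "rr = r \<cdot> (\<one>\<^sub>m P \<otimes>\<^sub>m r) \<cdot> Assoc C P P M"
  let ?c = "contract (P \<otimes>\<^sub>o P) (Q \<otimes>\<^sub>o Q) ev2 M" and ?one = "\<one>\<^sub>m (P \<otimes>\<^sub>o P)"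
  have [simp]: "dd \<in> Arr C" "Dom C dd = M" "Cod C dd = (Q \<otimes>\<^sub>o Q) \<otimes>\<^sub>o M"
    "r \<in> Arr C" "Dom C r = P \<otimes>\<^sub>o M" "Cod C r = M"
    by (simp_all add: dd_def r_def)
  have dd: "dd = (indec.\<Upsilon>Q \<otimes>\<^sub>m \<one>\<^sub>m M) \<cdot> d \<oplus>\<^sub>m (indec.\<gamma>Q \<otimes>\<^sub>m \<one>\<^sub>m M) \<cdot> dd"
    using assms by (subst (asm) is_lie_comodule_iff[where dd = dd]) (simp_all add: dd_def [symmetric])
  have rr: "rr = ?c \<cdot> (?one \<otimes>\<^sub>m dd)"
    unfolding rr_def dd_def by (rule contract_action_twice) (simp_all add: r_def)
  have "r \<cdot> (prim.\<Lambda>P \<otimes>\<^sub>m \<one>\<^sub>m M)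
      = contract (P \<otimes>\<^sub>o P) Q (ev \<cdot> (prim.\<Lambda>P \<otimes>\<^sub>m \<one>\<^sub>m Q)) M \<cdot> (?one \<otimes>\<^sub>m d)"
    unfolding r_def using contract_action_comp[of ev prim.\<Lambda>P Q d M] by simp
  also have "\<dots> = ?c \<cdot> (?one \<otimes>\<^sub>m ((indec.\<Upsilon>Q \<otimes>\<^sub>m \<one>\<^sub>m M) \<cdot> d))"
    unfolding ev_bracket using contract_dinat[of ev2 ?one indec.\<Upsilon>Q M] by simp
  finally have bracket: "r \<cdot> (prim.\<Lambda>P \<otimes>\<^sub>m \<one>\<^sub>m M) = ?c \<cdot> (?one \<otimes>\<^sub>m ((indec.\<Upsilon>Q \<otimes>\<^sub>m \<one>\<^sub>m M) \<cdot> d))" .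
  have "rr \<cdot> (prim.\<sigma>P \<otimes>\<^sub>m \<one>\<^sub>m M)
      = contract (P \<otimes>\<^sub>o P) (Q \<otimes>\<^sub>o Q) (ev2 \<cdot> (prim.\<sigma>P \<otimes>\<^sub>m \<one>\<^sub>m (Q \<otimes>\<^sub>o Q))) M \<cdot> (?one \<otimes>\<^sub>m dd)"
    unfolding rr using contract_action_comp[of ev2 prim.\<sigma>P "Q \<otimes>\<^sub>o Q" dd M] by simp
  also have "\<dots> = ?c \<cdot> (?one \<otimes>\<^sub>m ((indec.\<gamma>Q \<otimes>\<^sub>m \<one>\<^sub>m M) \<cdot> dd))"
    unfolding ev2_braid using contract_dinat[of ev2 ?one indec.\<gamma>Q M] by simp
  finally have braid: "rr \<cdot> (prim.\<sigma>P \<otimes>\<^sub>m \<one>\<^sub>m M) = ?c \<cdot> (?one \<otimes>\<^sub>m ((indec.\<gamma>Q \<otimes>\<^sub>m \<one>\<^sub>m M) \<cdot> dd))" .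
  have "rr = ?c \<cdot> (?one \<otimes>\<^sub>m ((indec.\<Upsilon>Q \<otimes>\<^sub>m \<one>\<^sub>m M) \<cdot> d \<oplus>\<^sub>m (indec.\<gamma>Q \<otimes>\<^sub>m \<one>\<^sub>m M) \<cdot> dd))"
    unfolding dd[symmetric] by (rule rr)
  also have "\<dots> = r \<cdot> (prim.\<Lambda>P \<otimes>\<^sub>m \<one>\<^sub>m M) \<oplus>\<^sub>m rr \<cdot> (prim.\<sigma>P \<otimes>\<^sub>m \<one>\<^sub>m M)"
    unfolding bracket braid by (simp add: tens_add comp_add)
  finally have "is_lie_module C (prim_lie C BH P e) (M, r)"
    by (subst is_lie_module_iff[where rr = rr]) (simp_all add: rr_def [symmetric])
  then show ?thesis
    using pairing_action_contract[of ev P Q d M] by (simp add: r_def)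
qed

text \<open>Both actions contract \<open>d\<close> along the same pairing
  \<open>P \<otimes> K \<rightarrow> I\<close>, presented once through \<open>e\<close> and once
  through \<open>q\<close>; \<open>ev_coeq\<close> says that the presentations agree.\<close>

lemma square_on_objects:
  assumes "d \<in> Hom C M (K \<otimes>\<^sub>o M)"
  shows "snd (pairing_action C H K p (M, d)) \<cdot> (e \<otimes>\<^sub>m \<one>\<^sub>m M)
    = snd (pairing_action C P Q ev (M, (q \<otimes>\<^sub>m \<one>\<^sub>m M) \<cdot> d))"
proof -
  have [simp]: "d \<in> Arr C" "Dom C d = M" "Cod C d = K \<otimes>\<^sub>o M"
    using assms by simp_all
  have [simp]: "M \<in> Ob C" using dom_ob[of d] by simp
  have "snd (pairing_action C H K p (M, d)) \<cdot> (e \<otimes>\<^sub>m \<one>\<^sub>m M)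
      = contract P K (p \<cdot> (e \<otimes>\<^sub>m \<one>\<^sub>m K)) M \<cdot> (\<one>\<^sub>m P \<otimes>\<^sub>m d)"
    using pairing_action_contract[of p H K d M] contract_action_comp[of p e K d M] by simp
  also have "\<dots> = snd (pairing_action C P Q ev (M, (q \<otimes>\<^sub>m \<one>\<^sub>m M) \<cdot> d))"
    unfolding ev_coeq[symmetric]
    using pairing_action_contract[of ev P Q "(q \<otimes>\<^sub>m \<one>\<^sub>m M) \<cdot> d" M]
      contract_dinat[of ev "\<one>\<^sub>m P" q M] by simp
  finally show ?thesis .
qed

end

section \<open>The four functors\<close>

context additive_monoidal_category
begin

lemma category_Mod: "obj B \<in> Ob C \<Longrightarrow> category (Mod C B)"
  unfolding Mod_def by (rule category_action) (auto simp: is_module_def)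

lemma category_CoMod: "obj B \<in> Ob C \<Longrightarrow> category (CoMod C B)"
  unfolding CoMod_def by (rule category_coaction) (auto simp: is_comodule_def)

lemma category_LieMod: "lie_obj L \<in> Ob C \<Longrightarrow> category (LieMod C L)"
  unfolding LieMod_def by (rule category_action) (auto simp: is_lie_module_def Let_def)

lemma category_LieCoMod: "colie_obj D \<in> Ob C \<Longrightarrow> category (LieCoMod C D)"
  unfolding LieCoMod_def by (rule category_coaction) (auto simp: is_lie_comodule_def Let_def)

lemma pairing_action_morphism:
  assumes "p \<in> Arr C" "Dom C p = X \<otimes>\<^sub>o Y" "Cod C p = I" "X \<in> Ob C" "Y \<in> Ob C"
    and "snd M \<in> Hom C (fst M) (Y \<otimes>\<^sub>o fst M)" "snd N \<in> Hom C (fst N) (Y \<otimes>\<^sub>o fst N)"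
    and "f \<in> Hom C (fst M) (fst N)" "coaction_morphism C Y M N f"
  shows "action_morphism C X (pairing_action C X Y p M) (pairing_action C X Y p N) f"
proof -
  obtain M0 d N0 d' where [simp]: "M = (M0, d)" "N = (N0, d')"
    by (metis surj_pair)
  have [simp]: "d \<in> Arr C" "Dom C d = M0" "Cod C d = Y \<otimes>\<^sub>o M0" "d' \<in> Arr C" "Dom C d' = N0"
    "Cod C d' = Y \<otimes>\<^sub>o N0" "f \<in> Arr C" "Dom C f = M0" "Cod C f = N0"
    using assms by simp_all
  show ?thesis
    using contract_morphism[OF assms(1-5), of d M0 d' N0 f] assms(9)
      pairing_action_contract[OF assms(1-5), of d M0] pairing_action_contract[OF assms(1-5), of d' N0]
    by (simp add: action_morphism_def coaction_morphism_def)
qed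

end

context lie_takeuchi
begin

lemma cat_functor_F: "cat_functor (CoMod C BK) (Mod C BH) (functor_F C BH BK p)"
  unfolding CoMod_def Mod_def functor_F_def
proof (rule cat_functor_structure_functor)
  show "category (structured_category C (is_comodule C BK) (coaction_morphism C K))"
    "category (structured_category C (is_module C BH) (action_morphism C H))"
    using category_CoMod[of BK] category_Mod[of BH] by (simp_all add: CoMod_def Mod_def)
  fix M assume "is_comodule C BK M"
  then show "is_module C BH (pairing_action C H K p M)"
    using pairing_action_module by (cases M) simp
  show "fst (pairing_action C H K p M) = fst M"
    by (simp add: pairing_action_def split: prod.split)
next
  fix M N f assume "is_comodule C BK M" "is_comodule C BK N" and f: "f \<in> Hom C (fst M) (fst N)"
    "coaction_morphism C K M N f"
  then have M: "snd M \<in> Hom C (fst M) (K \<otimes>\<^sub>o fst M)" and N: "snd N \<in> Hom C (fst N) (K \<otimes>\<^sub>o fst N)"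
    by (cases M; cases N; simp add: is_comodule_def)+
  show "action_morphism C H (pairing_action C H K p M) (pairing_action C H K p N) f"
    by (rule pairing_action_morphism[OF _ _ _ _ _ M N f]) simp_all
qed

lemma cat_functor_F':
  "cat_functor (LieCoMod C (indec_colie C BK Q q)) (LieMod C (prim_lie C BH P e)) (functor_F' C P Q ev)"
  unfolding LieCoMod_def LieMod_def functor_F'_def prim.lie_obj_prim_lie indec.colie_obj_indec_colie
proof (rule cat_functor_structure_functor)
  show "category (structured_category C (is_lie_comodule C (indec_colie C BK Q q)) (coaction_morphism C Q))"
    "category (structured_category C (is_lie_module C (prim_lie C BH P e)) (action_morphism C P))"
    using category_LieCoMod[of "indec_colie C BK Q q"] category_LieMod[of "prim_lie C BH P e"]
    by (simp_all add: LieCoMod_def LieMod_def)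
  fix M assume "is_lie_comodule C (indec_colie C BK Q q) M"
  then show "is_lie_module C (prim_lie C BH P e) (pairing_action C P Q ev M)"
    using pairing_action_lie_module by (cases M) simp
  show "fst (pairing_action C P Q ev M) = fst M"
    by (simp add: pairing_action_def split: prod.split)
next
  fix M N f assume "is_lie_comodule C (indec_colie C BK Q q) M"
    "is_lie_comodule C (indec_colie C BK Q q) N" and f: "f \<in> Hom C (fst M) (fst N)"
    "coaction_morphism C Q M N f"
  then have M: "snd M \<in> Hom C (fst M) (Q \<otimes>\<^sub>o fst M)" and N: "snd N \<in> Hom C (fst N) (Q \<otimes>\<^sub>o fst N)"
    by (cases M; cases N; simp add: is_lie_comodule_def Let_def)+
  show "action_morphism C P (pairing_action C P Q ev M) (pairing_action C P Q ev N) f"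
    by (rule pairing_action_morphism[OF _ _ _ _ _ M N f]) simp_all
qed

lemma cat_functor_G: "cat_functor (Mod C BH) (LieMod C (prim_lie C BH P e)) (functor_G C e)"
  unfolding Mod_def LieMod_def functor_G_def prim.lie_obj_prim_lie
proof (rule cat_functor_structure_functor)
  show "category (structured_category C (is_module C BH) (action_morphism C H))"
    "category (structured_category C (is_lie_module C (prim_lie C BH P e)) (action_morphism C P))"
    using category_Mod[of BH] category_LieMod[of "prim_lie C BH P e"]
    by (simp_all add: Mod_def LieMod_def)
  fix M assume "is_module C BH M"
  then show "is_lie_module C (prim_lie C BH P e) (case M of (M, r) \<Rightarrow> (M, r \<cdot> (e \<otimes>\<^sub>m \<one>\<^sub>m M)))"
    using prim.restrict_lie_module by (cases M) simp
  show "fst (case M of (M, r) \<Rightarrow> (M, r \<cdot> (e \<otimes>\<^sub>m \<one>\<^sub>m M))) = fst M"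
    by (simp split: prod.split)
next
  fix M N f assume MN: "is_module C BH M" "is_module C BH N" and f: "f \<in> Hom C (fst M) (fst N)"
    "action_morphism C H M N f"
  obtain M0 r N0 s where [simp]: "M = (M0, r)" "N = (N0, s)"
    by (metis surj_pair)
  have [simp]: "M0 \<in> Ob C" "N0 \<in> Ob C" "r \<in> Arr C" "Dom C r = H \<otimes>\<^sub>o M0" "Cod C r = M0"
    "s \<in> Arr C" "Dom C s = H \<otimes>\<^sub>o N0" "Cod C s = N0" "f \<in> Arr C" "Dom C f = M0" "Cod C f = N0"
    using MN f by (simp_all add: is_module_def)
  have "f \<cdot> r \<cdot> (e \<otimes>\<^sub>m \<one>\<^sub>m M0) = (f \<cdot> r) \<cdot> (e \<otimes>\<^sub>m \<one>\<^sub>m M0)"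
    by simp
  also have "f \<cdot> r = s \<cdot> (\<one>\<^sub>m H \<otimes>\<^sub>m f)"
    using f by (simp add: action_morphism_def)
  finally show "action_morphism C P (case M of (M, r) \<Rightarrow> (M, r \<cdot> (e \<otimes>\<^sub>m \<one>\<^sub>m M)))
      (case N of (M, r) \<Rightarrow> (M, r \<cdot> (e \<otimes>\<^sub>m \<one>\<^sub>m M))) f"
    by (simp add: action_morphism_def)
qed

lemma cat_functor_G': "cat_functor (CoMod C BK) (LieCoMod C (indec_colie C BK Q q)) (functor_G' C q)"
  unfolding CoMod_def LieCoMod_def functor_G'_def indec.colie_obj_indec_colie
proof (rule cat_functor_structure_functor)
  show "category (structured_category C (is_comodule C BK) (coaction_morphism C K))"
    "category (structured_category C (is_lie_comodule C (indec_colie C BK Q q)) (coaction_morphism C Q))"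
    using category_CoMod[of BK] category_LieCoMod[of "indec_colie C BK Q q"]
    by (simp_all add: CoMod_def LieCoMod_def)
  fix M assume "is_comodule C BK M"
  then show "is_lie_comodule C (indec_colie C BK Q q) (case M of (M, d) \<Rightarrow> (M, (q \<otimes>\<^sub>m \<one>\<^sub>m M) \<cdot> d))"
    using indec.corestrict_lie_comodule by (cases M) simp
  show "fst (case M of (M, d) \<Rightarrow> (M, (q \<otimes>\<^sub>m \<one>\<^sub>m M) \<cdot> d)) = fst M"
    by (simp split: prod.split)
next
  fix M N f assume MN: "is_comodule C BK M" "is_comodule C BK N" and f: "f \<in> Hom C (fst M) (fst N)"
    "coaction_morphism C K M N f"
  obtain M0 r N0 s where [simp]: "M = (M0, r)" "N = (N0, s)"
    by (metis surj_pair)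
  have [simp]: "M0 \<in> Ob C" "N0 \<in> Ob C" "r \<in> Arr C" "Cod C r = K \<otimes>\<^sub>o M0" "Dom C r = M0"
    "s \<in> Arr C" "Cod C s = K \<otimes>\<^sub>o N0" "Dom C s = N0" "f \<in> Arr C" "Dom C f = M0" "Cod C f = N0"
    using MN f by (simp_all add: is_comodule_def)
  have "s \<cdot> f = (\<one>\<^sub>m K \<otimes>\<^sub>m f) \<cdot> r"
    using f by (simp add: coaction_morphism_def)
  then show "coaction_morphism C Q (case M of (M, d) \<Rightarrow> (M, (q \<otimes>\<^sub>m \<one>\<^sub>m M) \<cdot> d))
      (case N of (M, d) \<Rightarrow> (M, (q \<otimes>\<^sub>m \<one>\<^sub>m M) \<cdot> d)) f"
    by (simp add: coaction_morphism_def)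
qed

text \<open>Arrows carry their source and target, and all four functors keep the underlying arrow;
  so agreement on arrows also comes down to agreement on objects.\<close>

lemma functor_square:
  "functor_eq (CoMod C BK) (functor_comp (functor_G C e) (functor_F C BH BK p))
    (functor_comp (functor_F' C P Q ev) (functor_G' C q))"
proof -
  let ?G = "\<lambda>(M, r). (M, r \<cdot> (e \<otimes>\<^sub>m \<one>\<^sub>m M))" and ?G' = "\<lambda>(M, d). (M, (q \<otimes>\<^sub>m \<one>\<^sub>m M) \<cdot> d)"
  have obj: "?G (pairing_action C H K p M) = pairing_action C P Q ev (?G' M)"
    if "is_comodule C BK M" for M
  proof -
    obtain M0 d where M: "M = (M0, d)" by fastforce
    have "d \<in> Hom C M0 (K \<otimes>\<^sub>o M0)"
      using that by (simp add: M is_comodule_def)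
    from square_on_objects[OF this] show ?thesis
      by (simp add: M pairing_action_def)
  qed
  show ?thesis
    unfolding functor_eq_def functor_comp_def functor_F_def functor_G_def functor_F'_def functor_G'_def
      CoMod_def
    using obj by (auto simp: structured_category_def structure_functor_def)
qed

end

theorem theorem6p12:
  fixes C :: "('o, 'm) addmon_data"
    and H K :: "('o, 'm) bialg_data"
    and p :: 'm
    and P Q :: 'o
    and eqH coeqK :: 'm
  assumes "additive_monoidal_category C"
    and "has_equalizers C" and "has_coequalizers C"
    and "tensor_preserves_equalizers C" and "tensor_preserves_coequalizers C"
    and "takeuchi_pair C H K p"
    and "is_primitives C H P eqH"
    and "is_indecomposables C K Q coeqK"
  shows
    "let PH = prim_lie C H P eqH;
         QK = indec_colie C K Q coeqK;
         F = functor_F C H K p;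
         G = functor_G C eqH;
         G' = functor_G' C coeqK;
         F' = functor_F' C P Q (ev_pairing C K p P eqH Q coeqK)
     in cat_functor (CoMod C K) (Mod C H) F \<and>
        cat_functor (Mod C H) (LieMod C PH) G \<and>
        cat_functor (CoMod C K) (LieCoMod C QK) G' \<and>
        cat_functor (LieCoMod C QK) (LieMod C PH) F' \<and>
        functor_eq (CoMod C K) (functor_comp G F) (functor_comp F' G')"
proof -
  interpret additive_monoidal_category C by (rule assms(1))
  \<comment> \<open>The braided bialgebra axioms for \<open>H\<close> and \<open>K\<close> are
    extracted from \<open>takeuchi_pair\<close>.\<close>
  interpret lie_takeuchi C H K P Q eqH coeqK p
    by unfold_locales (use assms in \<open>simp_all add: takeuchi_pair_def Let_def\<close>)
  show ?thesis
    unfolding Let_def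
    using cat_functor_F cat_functor_G cat_functor_G' cat_functor_F' functor_square by blast
qed

end
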